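(* Let $(\mathscr{C}(x))_{x\in\mathcal{H}}$ be an almost surely pre-Markov family (on $\Omega=C([0,\infty);\mathcal{V}')$) such that every $\mathscr{C}(x)$ is non-empty and convex. Then there is a measurable map $x\mapsto P_x$ defined on $\mathcal{H}$ with values in $\Pr(\Omega)$ such that $P_x\in\mathscr{C}(x)$ for all $x\in\mathcal{H}$ and $(P_x)_{x\in\mathcal{H}}$ has the almost sure Markov property.
   Context: Setting. $\mathcal{V}\subset\mathcal{H}\subset\mathcal{V}'$ is a Gelfand triple of separable Hilbert spaces with continuous injections; $\Omega=C([0,\infty);\mathcal{V}')$ with Borel $\sigma$-field $\mathscr{B}$; $\Pr(\Omega)$ is the set of probability measures on $(\Omega,\mathscr{B})$ with the topology of weak convergence (a Polish space); $\xi_t(\omega)=\omega(t)$ is the canonical process; $\mathscr{B}_t=\sigma[\xi_s:0\le s\le t]$. $\mathcal{H}_\sigma$ is $\mathcal{H}$ with its weak topology (the set $C([0,\infty);\mathcal{H}_\sigma)\cap\Omega$ is Borel in $\Omega$). For $t\ge 0$ let $\Omega^t=C([t,\infty);\mathcal{V}')$, $\mathscr{B}^t=\sigma[\xi_s:s\ge t]$, and $\Phi_t:\Omega\to\Omega^t$, $\Phi_t(\omega)(s)=\omega(s-t)$ for $s\ge t$; for $P\in\Pr(\Omega)$, $\Phi_tP$ is the image measure and $\Phi_t\mathscr{C}(x)=\{\Phi_tP:P\in\mathscr{C}(x)\}$. Disintegration: for $P\in\Pr(\Omega)$, $\omega\mapsto P|_{\mathscr{B}_t}^\omega\in\Pr(\Omega^t)$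 denotes a regular conditional probability distribution of $P$ on $\mathscr{B}_t$; it satisfies $P|_{\mathscr{B}_t}^\omega[\xi_t=\omega(t)]=1$ for all $\omega$, and $P(A\cap B)=\int_A P|_{\mathscr{B}_t}^\omega(B)\,P(d\omega)$ for $A\in\mathscr{B}_t$, $B\in\mathscr{B}^t$. Reconstruction: given $P\in\Pr(\Omega)$, $t>0$ and a $\mathscr{B}_t$-measurable map $Q:\Omega\to\Pr(\Omega^t)$ with $Q_\omega[\xi_t=\omega(t)]=1$ for all $\omega$ (it is enough for $P$-a.e. $\omega$), $P\otimes_tQ$ is the unique probability measure on $\Omega$ which agrees with $P$ on $\mathscr{B}_t$ and for which $(Q_\omega)_{\omega}$ is a regular conditional probability distribution on $\mathscr{B}_t$. Almost sure Markov property: a measurable map $x\mapsto P_x$ from $\mathcal{H}$ to $\Pr(\Omega)$ with $P_x[C([0,\infty);\mathcal{H}_\sigma)\cap\Omega]=1$ for all $x$ has the almost sure Markov property if for each $x\in\mathcal{H}$ there is a Lebesgue-null set $T\subset(0,\infty)$ such that for all $t\notin T$, $P_x|_{\mathscr{B}_t}^\omega=\Phi_tP_{\omega(t)}$ for $P_x$-a.e. $\omega$. Almost surely pre-Markov family: let $\mathrm{Comp}(\Pr(\Omega))$ be the family of compact subsets of $\Pr(\Omega)$ with the Hausdorff metric, and let $\mathscr{C}:\mathcal{H}\to\mathrm{Comp}(\Pr(\Omega))$ be Borel measurable with $P[C([0,\infty);\mathcal{H}_\sigma)\cap\Omega]=1$ for all $x\in\mathcal{H}$, $P\in\mathscr{C}(x)$.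 The family is almost surely pre-Markov if for each $x\in\mathcal{H}$ and $P\in\mathscr{C}(x)$ there is a Lebesgue-null set $T\subset(0,\infty)$ such that for all $t\notin T$: (1) (disintegration) there is $N\in\mathscr{B}_t$ with $P(N)=0$ such that for all $\omega\notin N$, $\omega(t)\in\mathcal{H}$ and $P|_{\mathscr{B}_t}^\omega\in\Phi_t\mathscr{C}(\omega(t))$; (2) (reconstruction) for each $\mathscr{B}_t$-measurable map $\omega\mapsto Q_\omega:\Omega\to\Pr(\Omega^t)$ for which there is $N\in\mathscr{B}_t$ with $P(N)=0$ and, for all $\omega\notin N$, $\omega(t)\in\mathcal{H}$ and $Q_\omega\in\Phi_t\mathscr{C}(\omega(t))$, one has $P\otimes_tQ\in\mathscr{C}(x)$. *)

theory Defs
  imports "HOL-Probability.Probability"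
begin

section \<open>Borel sets and weak convergence over an abstract topology\<close>

definition borel_of :: "'a topology \<Rightarrow> 'a measure" where
  "borel_of T = sigma (topspace T) {U. openin T U}"

definition prob_measures :: "'a topology \<Rightarrow> 'a measure set" where
  "prob_measures T = {P. prob_space P \<and> sets P = sets (borel_of T)}"

text \<open>The topology of weak convergence is the coarsest one on \<^term>\<open>prob_measures T\<close> for which
  all integrals of bounded continuous functions are continuous. Values of \<open>f\<close> outside
  \<^term>\<open>topspace T\<close> are irrelevant.\<close>

definition weak_conv_topology :: "'a topology \<Rightarrow> 'a measure topology" where
  "weak_conv_topology T = topology_generated_by
     {{P \<in> prob_measures T. (\<integral>\<omega>. f \<omega> \<partial>P) \<in> U} | (f :: 'a \<Rightarrow> real) U.
        continuous_map T euclideanreal f \<and> bounded (f ` topspace T) \<and> open U}"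

lemma topspace_weak_conv_topology [simp]:
  "topspace (weak_conv_topology T) = prob_measures T"
proof -
  let ?S = "{{P \<in> prob_measures T. (\<integral>\<omega>. f \<omega> \<partial>P) \<in> U} | (f :: 'a \<Rightarrow> real) U.
        continuous_map T euclideanreal f \<and> bounded (f ` topspace T) \<and> open U}"
  have "bounded ((\<lambda>_. 0 :: real) ` topspace T)"
    by (rule finite_imp_bounded) (auto simp: image_constant_conv)
  then have "{P \<in> prob_measures T. (\<integral>\<omega>. (0 :: real) \<partial>P) \<in> UNIV} \<in> ?S"
    by (intro CollectI exI[of _ "\<lambda>_. 0 :: real"] exI[of _ "UNIV :: real set"]) auto
  then have "prob_measures T \<in> ?S"
    by simp
  moreover have "\<Union>?S \<subseteq> prob_measures T"
    by blast
  ultimately have "\<Union>?S = prob_measures T"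
    by blast
  then show ?thesis
    by (simp only: weak_conv_topology_def topology_generated_by_topspace)
qed

text \<open>The convex combination \<open>a P + (1 - a) R\<close> of two probability measures on the same space.\<close>

definition mixture :: "real \<Rightarrow> 'a measure \<Rightarrow> 'a measure \<Rightarrow> 'a measure" where
  "mixture a P R = measure_of (space P) (sets P)
     (\<lambda>A. ennreal a * emeasure P A + ennreal (1 - a) * emeasure R A)"

lemma sets_mixture [simp]: "sets (mixture a P R) = sets P"
  by (simp add: mixture_def)

lemma space_mixture [simp]: "space (mixture a P R) = space P"
  by (simp add: mixture_def)

lemma emeasure_mixture:
  assumes "sets R = sets P" "A \<in> sets P"
  shows "emeasure (mixture a P R) A = ennreal a * emeasure P A + ennreal (1 - a) * emeasure R A"
proof (rule emeasure_measure_of[OF mixture_def])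
  show "sets P \<subseteq> Pow (space P)"
    by (rule sets.space_closed)
  show "A \<in> sets (mixture a P R)"
    using assms by simp
  show "positive (sets (mixture a P R))
      (\<lambda>A. ennreal a * emeasure P A + ennreal (1 - a) * emeasure R A)"
    by (simp add: positive_def)
  show "countably_additive (sets (mixture a P R))
      (\<lambda>A. ennreal a * emeasure P A + ennreal (1 - a) * emeasure R A)"
  proof (rule countably_additiveI)
    fix F :: "nat \<Rightarrow> 'a set"
    assume F: "range F \<subseteq> sets (mixture a P R)" "disjoint_family F"
    then have "(\<Sum>i. emeasure P (F i)) = emeasure P (\<Union>i. F i)"
      "(\<Sum>i. emeasure R (F i)) = emeasure R (\<Union>i. F i)"
      using assms by (simp_all add: suminf_emeasure)
    then show "(\<Sum>i. ennreal a * emeasure P (F i) + ennreal (1 - a) * emeasure R (F i)) =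
        ennreal a * emeasure P (\<Union>i. F i) + ennreal (1 - a) * emeasure R (\<Union>i. F i)"
      by (simp add: suminf_add[symmetric] ennreal_suminf_cmult)
  qed
qed

definition convex_measures :: "'a measure set \<Rightarrow> bool" where
  "convex_measures K \<longleftrightarrow> (\<forall>P\<in>K. \<forall>R\<in>K. \<forall>a\<in>{0..1}. mixture a P R \<in> K)"


section \<open>The Hausdorff metric\<close>

definition metrizes :: "('a \<Rightarrow> 'a \<Rightarrow> real) \<Rightarrow> 'a topology \<Rightarrow> bool" where
  "metrizes d T \<longleftrightarrow> Metric_space (topspace T) d \<and> Metric_space.mtopology (topspace T) d = T"

text \<open>As usual for the Hausdorff metric, the empty set is excluded.\<close>

definition compacts :: "'a topology \<Rightarrow> 'a set set" where
  "compacts T = {K. compactin T K \<and> K \<noteq> {}}"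

text \<open>The value \<open>0\<close> off \<^term>\<open>compacts T\<close> is only there because
  \<^locale>\<open>Metric_space\<close> requires non-negativity on the whole type.\<close>

definition hausdorff_dist ::
    "'a topology \<Rightarrow> ('a \<Rightarrow> 'a \<Rightarrow> real) \<Rightarrow> 'a set \<Rightarrow> 'a set \<Rightarrow> real" where
  "hausdorff_dist T d K L =
     (if K \<in> compacts T \<and> L \<in> compacts T
      then max (SUP a\<in>K. INF b\<in>L. d a b) (SUP b\<in>L. INF a\<in>K. d a b) else 0)"

definition hausdorff_topology :: "'a topology \<Rightarrow> ('a \<Rightarrow> 'a \<Rightarrow> real) \<Rightarrow> 'a set topology" where
  "hausdorff_topology T d = Metric_space.mtopology (compacts T) (hausdorff_dist T d)"

lemma hausdorff_dist_le_iff: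
  assumes d: "metrizes d T" and K: "K \<in> compacts T" and L: "L \<in> compacts T"
  shows "hausdorff_dist T d K L \<le> r \<longleftrightarrow>
    (\<forall>a\<in>K. (INF b\<in>L. d a b) \<le> r) \<and> (\<forall>b\<in>L. (INF a\<in>K. d a b) \<le> r)"
proof -
  interpret M: Metric_space "topspace T" d
    using d by (simp add: metrizes_def)
  have T: "M.mtopology = T"
    using d by (simp add: metrizes_def)
  have bdd: "bdd_above ((\<lambda>a. INF b\<in>L'. d a b) ` K')" "bdd_above ((\<lambda>a. INF b\<in>L'. d b a) ` K')"
    if K': "K' \<in> compacts T" and L': "L' \<in> compacts T" for K' L'
  proof -
    from L' obtain b0 where b0: "b0 \<in> L'" "b0 \<in> topspace T"
      using compactin_subset_topspace[of T L'] by (auto simp: compacts_def)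
    have "M.mbounded K'"
      using K' T M.compactin_imp_mbounded by (auto simp: compacts_def)
    then have "M.mbounded (insert b0 K')"
      using b0(2) by (simp add: M.mbounded_insert)
    then obtain B where B: "\<And>a. a \<in> K' \<Longrightarrow> d b0 a \<le> B"
      unfolding M.mbounded_alt by blast
    have *: "(INF b\<in>L'. d a b) \<le> B" "(INF b\<in>L'. d b a) \<le> B" if "a \<in> K'" for a
      using B[OF that] b0(1) M.commute[of a b0]
      by (auto intro!: cINF_lower2[of _ _ b0] bdd_belowI2[of _ 0])
    show "bdd_above ((\<lambda>a. INF b\<in>L'. d a b) ` K')" "bdd_above ((\<lambda>a. INF b\<in>L'. d b a) ` K')"
      using * by (auto intro!: bdd_aboveI2[of _ _ B])
  qed
  have ne: "K \<noteq> {}" "L \<noteq> {}"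
    using K L by (auto simp: compacts_def)
  show ?thesis
    using K L ne bdd(1)[OF K L] bdd(2)[OF L K]
    by (simp add: hausdorff_dist_def cSUP_le_iff)
qed

lemma Metric_space_hausdorff_dist:
  assumes d: "metrizes d T"
  shows "Metric_space (compacts T) (hausdorff_dist T d)"
proof -
  interpret M: Metric_space "topspace T" d
    using d by (simp add: metrizes_def)
  have T: "M.mtopology = T"
    using d by (simp add: metrizes_def)
  have sub: "K \<subseteq> topspace T" "K \<noteq> {}" "closedin T K" if "K \<in> compacts T" for K
    using that compactin_subset_topspace[of T K] M.Hausdorff_space_mtopology T
    by (auto simp: compacts_def intro: compactin_imp_closedin)
  have bb: "bdd_below ((\<lambda>b. d a b) ` K)" "bdd_below ((\<lambda>b. d b a) ` K)" for a K
    by (auto intro!: bdd_belowI2[of _ 0])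
  have INF0: "0 \<le> (INF b\<in>K. d a b)" "0 \<le> (INF b\<in>K. d b a)" if "K \<noteq> {}" for a K
    using that by (auto intro!: cINF_greatest)
  have nonneg: "0 \<le> hausdorff_dist T d K L" for K L
  proof (cases "K \<in> compacts T \<and> L \<in> compacts T")
    case True
    then obtain a where "a \<in> K" using sub by blast
    have "(INF b\<in>L. d a b) \<le> hausdorff_dist T d K L"
      using hausdorff_dist_le_iff[OF d, of K L "hausdorff_dist T d K L"] True \<open>a \<in> K\<close> by auto
    then show ?thesis
      using INF0(1)[of L a] True sub by force
  qed (simp only: hausdorff_dist_def if_False order_refl)
  have commute: "hausdorff_dist T d K L = hausdorff_dist T d L K" for K L
    by (simp add: hausdorff_dist_def M.commute max.commute conj_commute)
  have near: "\<exists>b\<in>L. d a b < r" if "K \<in> compacts T" "L \<in> compacts T" "a \<in> K"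
    "hausdorff_dist T d K L < r" for K L a r
  proof -
    have "(INF b\<in>L. d a b) < r"
      using hausdorff_dist_le_iff[OF d, of K L "hausdorff_dist T d K L"] that by force
    then show ?thesis
      using sub(2)[OF that(2)] bb by (simp add: cINF_less_iff)
  qed
  have subset: "K \<subseteq> L" if KL: "K \<in> compacts T" "L \<in> compacts T"
    and 0: "hausdorff_dist T d K L = 0" for K L
  proof
    fix a assume a: "a \<in> K"
    have "a \<in> M.mtopology closure_of L"
      unfolding M.metric_closure_of
      using near[OF KL a] 0 a sub[OF KL(1)] sub[OF KL(2)] by fastforce
    then show "a \<in> L"
      using sub(3)[OF KL(2)] by (simp add: T closure_of_closedin)
  qed
  show ?thesis
  proof
    fix K L assume KL: "K \<in> compacts T" "L \<in> compacts T"
    have "hausdorff_dist T d K K \<le> 0"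
      using KL sub(1)[OF KL(1)] bb M.mdist_zero
      by (subst hausdorff_dist_le_iff[OF d]) (auto intro!: cINF_lower2)
    then show "hausdorff_dist T d K L = 0 \<longleftrightarrow> K = L"
      using subset[OF KL] subset[OF KL(2) KL(1)] commute[of K L] nonneg[of K K] by auto
  next
    fix K L J assume KLJ: "K \<in> compacts T" "L \<in> compacts T" "J \<in> compacts T"
    let ?r = "hausdorff_dist T d K L + hausdorff_dist T d L J"
    have half: "(INF c\<in>J. d a c) \<le> hausdorff_dist T d K L + hausdorff_dist T d L J"
      if C: "K \<in> compacts T" "L \<in> compacts T" "J \<in> compacts T" and a: "a \<in> K" for K L J a
    proof (rule field_le_epsilon)
      fix e :: real assume "0 < e"
      then obtain b where b: "b \<in> L" "d a b < hausdorff_dist T d K L + e / 2"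
        using near[OF C(1,2) a, of "hausdorff_dist T d K L + e / 2"] by auto
      then obtain c where c: "c \<in> J" "d b c < hausdorff_dist T d L J + e / 2"
        using near[OF C(2,3) b(1), of "hausdorff_dist T d L J + e / 2"] \<open>0 < e\<close> by auto
      have "(INF c\<in>J. d a c) \<le> d a c"
        using c bb by (intro cINF_lower)
      also have "\<dots> \<le> d a b + d b c"
        using a b c sub[OF C(1)] sub[OF C(2)] sub[OF C(3)] by (intro M.triangle) auto
      finally show "(INF c\<in>J. d a c) \<le> hausdorff_dist T d K L + hausdorff_dist T d L J + e"
        using b c by simp
    qed
    show "hausdorff_dist T d K J \<le> hausdorff_dist T d K L + hausdorff_dist T d L J"
      using half[OF KLJ] half[OF KLJ(3,2,1)] KLJ
      by (subst hausdorff_dist_le_iff[OF d])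
         (auto simp: commute[of L K] commute[of J L] M.commute add.commute)
  qed (rule nonneg commute)+
qed


section \<open>Path spaces\<close>

text \<open>\<^term>\<open>paths t\<close> is \<open>C([t, \<infinity>); E)\<close>. Paths are extended by \<^term>\<open>undefined\<close> to the left
  of \<open>t\<close>, so that equality of functions is equality of paths.\<close>

definition paths :: "real \<Rightarrow> (real \<Rightarrow> 'e::metric_space) set" where
  "paths t = {\<omega> \<in> extensional {t..}. continuous_on {t..} \<omega>}"

text \<open>The topology of uniform convergence on compact time intervals.\<close>

definition paths_open :: "real \<Rightarrow> (real \<Rightarrow> 'e::metric_space) set \<Rightarrow> bool" where
  "paths_open t U \<longleftrightarrow> U \<subseteq> paths t \<and>
     (\<forall>\<omega>\<in>U. \<exists>T\<ge>t. \<exists>e>0. \<forall>\<eta>\<in>paths t. (\<forall>s\<in>{t..T}. dist (\<omega> s) (\<eta> s) < e) \<longrightarrow> \<eta> \<in> U)"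

definition paths_topology :: "real \<Rightarrow> (real \<Rightarrow> 'e::metric_space) topology" where
  "paths_topology t = topology (paths_open t)"

lemma istopology_paths_open: "istopology (paths_open t)"
  unfolding istopology_def
proof (intro conjI allI impI)
  fix U V :: "(real \<Rightarrow> 'e::metric_space) set"
  assume U: "paths_open t U" and V: "paths_open t V"
  show "paths_open t (U \<inter> V)"
    unfolding paths_open_def
  proof (intro conjI ballI)
    show "U \<inter> V \<subseteq> paths t"
      using U by (auto simp: paths_open_def)
    fix \<omega> assume \<omega>: "\<omega> \<in> U \<inter> V"
    obtain T e where T: "t \<le> T" "0 < e"
      "\<And>\<eta>. \<eta> \<in> paths t \<Longrightarrow> (\<forall>s\<in>{t..T}. dist (\<omega> s) (\<eta> s) < e) \<Longrightarrow> \<eta> \<in> U"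
      using U \<omega> unfolding paths_open_def by blast
    obtain T' e' where T': "t \<le> T'" "0 < e'"
      "\<And>\<eta>. \<eta> \<in> paths t \<Longrightarrow> (\<forall>s\<in>{t..T'}. dist (\<omega> s) (\<eta> s) < e') \<Longrightarrow> \<eta> \<in> V"
      using V \<omega> unfolding paths_open_def by blast
    have "\<eta> \<in> U \<inter> V"
      if \<eta>: "\<eta> \<in> paths t" "\<forall>s\<in>{t..max T T'}. dist (\<omega> s) (\<eta> s) < min e e'" for \<eta>
    proof
      show "\<eta> \<in> U"
        using \<eta>(2) by (intro T(3)[OF \<eta>(1)]) auto
      show "\<eta> \<in> V"
        using \<eta>(2) by (intro T'(3)[OF \<eta>(1)]) auto
    qed
    moreover have "t \<le> max T T'" "0 < min e e'"
      using T T' by auto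
    ultimately show "\<exists>T\<ge>t. \<exists>e>0. \<forall>\<eta>\<in>paths t. (\<forall>s\<in>{t..T}. dist (\<omega> s) (\<eta> s) < e) \<longrightarrow> \<eta> \<in> U \<inter> V"
      by blast
  qed
next
  fix \<U> :: "(real \<Rightarrow> 'e::metric_space) set set"
  assume "\<forall>U\<in>\<U>. paths_open t U"
  then show "paths_open t (\<Union>\<U>)"
    unfolding paths_open_def by (intro conjI ballI) (blast, fast)
qed

lemma openin_paths_topology: "openin (paths_topology t) U \<longleftrightarrow> paths_open t U"
  by (simp add: paths_topology_def topology_inverse' istopology_paths_open)

lemma topspace_paths_topology [simp]: "topspace (paths_topology t) = paths t"
proof
  have "paths_open t (paths t)"
    unfolding paths_open_def using zero_less_one by blast
  then have "openin (paths_topology t) (paths t)"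
    by (simp only: openin_paths_topology)
  then show "paths t \<subseteq> topspace (paths_topology t)"
    by (rule openin_subset)
  show "topspace (paths_topology t) \<subseteq> paths t"
    using openin_topspace[of "paths_topology t"]
    unfolding openin_paths_topology paths_open_def by blast
qed

abbreviation path_law_space :: "real \<Rightarrow> (real \<Rightarrow> 'e::metric_space) measure topology" where
  "path_law_space t \<equiv> weak_conv_topology (paths_topology t)"

text \<open>The \<open>\<sigma>\<close>-field generated on \<^term>\<open>paths t\<close> by the coordinates with index in \<open>I\<close>, where
  \<open>I \<subseteq> [t, \<infinity>)\<close>. Thus \<^term>\<open>coord_sigma 0 {0..t}\<close> is \<open>\<B>\<^sub>t\<close> and \<^term>\<open>coord_sigma t {t..}\<close> is
  \<open>\<B>\<^sup>t\<close>, the latter on \<open>\<Omega>\<^sup>t\<close>.\<close>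

definition coord_sigma :: "real \<Rightarrow> real set \<Rightarrow> (real \<Rightarrow> 'e::metric_space) measure" where
  "coord_sigma t I = sigma (paths t) {{\<omega> \<in> paths t. \<omega> s \<in> A} | s A. s \<in> I \<and> A \<in> sets borel}"

definition shift_path :: "real \<Rightarrow> (real \<Rightarrow> 'e::metric_space) \<Rightarrow> real \<Rightarrow> 'e" where
  "shift_path t \<omega> = restrict (\<lambda>s. \<omega> (s - t)) {t..}"

definition shift_law ::
    "real \<Rightarrow> (real \<Rightarrow> 'e::metric_space) measure \<Rightarrow> (real \<Rightarrow> 'e) measure" where
  "shift_law t P = distr P (borel_of (paths_topology t)) (shift_path t)"


section \<open>Disintegration and reconstruction\<close>

text \<open>A set \<open>B \<in> \<B>\<^sup>t\<close>, living on \<open>\<Omega>\<^sup>t\<close>, is read as an event on \<open>\<Omega>\<close> by restricting paths to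
  \<open>[t, \<infinity>)\<close>.\<close>

definition conditional_kernel ::
    "(real \<Rightarrow> 'e::metric_space) measure \<Rightarrow> real \<Rightarrow> ((real \<Rightarrow> 'e) \<Rightarrow> (real \<Rightarrow> 'e) measure) \<Rightarrow> bool" where
  "conditional_kernel P t Q \<longleftrightarrow>
     Q \<in> coord_sigma 0 {0..t} \<rightarrow>\<^sub>M borel_of (path_law_space t) \<and>
     (\<forall>A\<in>sets (coord_sigma 0 {0..t}). \<forall>B\<in>sets (coord_sigma t {t..}).
        measure P {\<omega> \<in> A. restrict \<omega> {t..} \<in> B} = (\<integral>\<omega>\<in>A. measure (Q \<omega>) B \<partial>P))"

definition starts_at :: "real \<Rightarrow> 'e \<Rightarrow> (real \<Rightarrow> 'e::metric_space) measure \<Rightarrow> bool" where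
  "starts_at t x P \<longleftrightarrow> measure P {\<eta> \<in> paths t. \<eta> t = x} = 1"

text \<open>\<open>Q\<close> is a version of the regular conditional probability distribution of \<open>P\<close> on
  \<open>\<B>\<^sub>t\<close>. Versions agree off a \<open>P\<close>-null set of \<open>\<B>\<^sub>t\<close>.\<close>

definition rcpd ::
    "(real \<Rightarrow> 'e::metric_space) measure \<Rightarrow> real \<Rightarrow> ((real \<Rightarrow> 'e) \<Rightarrow> (real \<Rightarrow> 'e) measure) \<Rightarrow> bool" where
  "rcpd P t Q \<longleftrightarrow> conditional_kernel P t Q \<and> (\<forall>\<omega>\<in>paths 0. starts_at t (\<omega> t) (Q \<omega>))"

text \<open>\<open>P \<otimes>\<^sub>t Q\<close>. It is defined for \<open>\<B>\<^sub>t\<close>-measurable \<open>Q\<close> such that \<open>Q \<omega>\<close> starts at \<open>\<omega> t\<close> for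
  \<open>P\<close>-almost every \<open>\<omega>\<close>; since this is not required for all \<open>\<omega>\<close>,
  \<^const>\<open>conditional_kernel\<close> is used instead of \<^const>\<open>rcpd\<close>.\<close>

definition reconstruction ::
    "(real \<Rightarrow> 'e::metric_space) measure \<Rightarrow> real \<Rightarrow> ((real \<Rightarrow> 'e) \<Rightarrow> (real \<Rightarrow> 'e) measure) \<Rightarrow>
     (real \<Rightarrow> 'e) measure" where
  "reconstruction P t Q =
     (THE R. R \<in> prob_measures (paths_topology 0) \<and>
        (\<forall>A\<in>sets (coord_sigma 0 {0..t}). measure R A = measure P A) \<and>
        conditional_kernel R t Q)"


section \<open>Gelfand triples\<close>

text \<open>A Gelfand triple \<open>V \<subseteq> H \<subseteq> V'\<close> is given by a continuous injection \<open>j\<close> of \<open>V\<close> into \<open>H\<close> with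
  dense range; \<open>V'\<close> is the normed dual \<^typ>\<open>'v \<Rightarrow>\<^sub>L real\<close>, and \<open>H\<close>, identified with its own
  dual, is embedded by sending \<open>h\<close> to the functional \<open>v \<mapsto> h \<bullet> j v\<close>.\<close>

definition gelfand_triple ::
    "('v::{real_inner, polish_space} \<Rightarrow>\<^sub>L 'h::{real_inner, polish_space}) \<Rightarrow> bool" where
  "gelfand_triple j \<longleftrightarrow> inj (blinfun_apply j) \<and> closure (range (blinfun_apply j)) = UNIV"

definition gelfand_embedding ::
    "('v::{real_inner, polish_space} \<Rightarrow>\<^sub>L 'h::{real_inner, polish_space}) \<Rightarrow> 'h \<Rightarrow> ('v \<Rightarrow>\<^sub>L real)" where
  "gelfand_embedding j h = blinfun_inner_right h o\<^sub>L j"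

lemma gelfand_embedding_apply: "gelfand_embedding j h v = h \<bullet> j v"
  by (simp add: gelfand_embedding_def)

lemma inj_gelfand_embedding:
  assumes "gelfand_triple j"
  shows "inj (gelfand_embedding j)"
proof (rule injI)
  fix x y assume eq: "gelfand_embedding j x = gelfand_embedding j y"
  have "range (blinfun_apply j) \<subseteq> {z. (x - y) \<bullet> z = 0}"
    using arg_cong[OF eq, of blinfun_apply]
    by (auto simp: gelfand_embedding_apply inner_diff_left fun_eq_iff)
  then have "closure (range (blinfun_apply j)) \<subseteq> {z. (x - y) \<bullet> z = 0}"
    by (rule closure_minimal) (rule closed_hyperplane)
  then have "x - y \<in> {z. (x - y) \<bullet> z = 0}"
    using assms unfolding gelfand_triple_def by blast
  then show "x = y"
    by simp
qed

definition hilbert_weak_topology :: "'h::real_normed_vector topology" where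
  "hilbert_weak_topology =
     topology_generated_by {blinfun_apply \<phi> -` U | (\<phi> :: 'h \<Rightarrow>\<^sub>L real) U. open U}"

text \<open>\<open>C([0, \<infinity>); H\<^sub>\<sigma>) \<inter> \<Omega>\<close>, for \<open>H\<close> embedded into \<open>E\<close> by \<open>\<iota>\<close>.\<close>

definition weakly_continuous_paths ::
    "('h::real_normed_vector \<Rightarrow> 'e::metric_space) \<Rightarrow> (real \<Rightarrow> 'e) set" where
  "weakly_continuous_paths \<iota> = {\<omega> \<in> paths 0.
     \<exists>h. continuous_map (top_of_set {0..}) hilbert_weak_topology h \<and> (\<forall>s\<ge>0. \<omega> s = \<iota> (h s))}"


section \<open>The almost sure Markov and pre-Markov properties\<close>

text \<open>In what follows \<open>\<exists>h. \<omega> t = \<iota> h \<and> \<dots>\<close> says that \<open>\<omega> t\<close> lies in \<open>H\<close> and names it as an element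
  of \<open>H\<close>.\<close>

definition almost_sure_Markov ::
    "('h::real_normed_vector \<Rightarrow> 'e::metric_space) \<Rightarrow> ('h \<Rightarrow> (real \<Rightarrow> 'e) measure) \<Rightarrow> bool" where
  "almost_sure_Markov \<iota> P \<longleftrightarrow>
     P \<in> borel \<rightarrow>\<^sub>M borel_of (path_law_space 0) \<and>
     (\<forall>x. measure (P x) (weakly_continuous_paths \<iota>) = 1) \<and>
     (\<forall>x. \<exists>T \<in> null_sets lebesgue. T \<subseteq> {0<..} \<and> (\<forall>t\<in>{0<..} - T.
        \<exists>Q. rcpd (P x) t Q \<and>
          (AE \<omega> in P x. \<exists>h. \<omega> t = \<iota> h \<and> Q \<omega> = shift_law t (P h))))"

text \<open>\<open>selects \<iota> \<C> P t Q\<close>: off a \<open>P\<close>-null set of \<open>\<B>\<^sub>t\<close>, \<open>\<omega> t\<close> lies in \<open>H\<close> and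
  \<open>Q \<omega> \<in> \<Phi>\<^sub>t \<C>(\<omega> t)\<close>.\<close>

definition selects ::
    "('h \<Rightarrow> 'e::metric_space) \<Rightarrow> ('h \<Rightarrow> (real \<Rightarrow> 'e) measure set) \<Rightarrow> (real \<Rightarrow> 'e) measure \<Rightarrow> real \<Rightarrow>
     ((real \<Rightarrow> 'e) \<Rightarrow> (real \<Rightarrow> 'e) measure) \<Rightarrow> bool" where
  "selects \<iota> \<C> P t Q \<longleftrightarrow> (\<exists>N\<in>sets (coord_sigma 0 {0..t}). emeasure P N = 0 \<and>
     (\<forall>\<omega>\<in>paths 0 - N. \<exists>h. \<omega> t = \<iota> h \<and> Q \<omega> \<in> shift_law t ` \<C> h))"

text \<open>\<open>d\<close> is the metric on the space of laws from which the Hausdorff metric is formed. The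
  Hausdorff topology on compact sets depends only on the topology induced by \<open>d\<close>.\<close>

definition almost_surely_pre_Markov ::
    "('h::real_normed_vector \<Rightarrow> 'e::metric_space) \<Rightarrow>
     ((real \<Rightarrow> 'e) measure \<Rightarrow> (real \<Rightarrow> 'e) measure \<Rightarrow> real) \<Rightarrow>
     ('h \<Rightarrow> (real \<Rightarrow> 'e) measure set) \<Rightarrow> bool" where
  "almost_surely_pre_Markov \<iota> d \<C> \<longleftrightarrow>
     \<C> \<in> borel \<rightarrow>\<^sub>M borel_of (hausdorff_topology (path_law_space 0) d) \<and>
     (\<forall>x. \<forall>P\<in>\<C> x. measure P (weakly_continuous_paths \<iota>) = 1) \<and>
     (\<forall>x. \<forall>P\<in>\<C> x. \<exists>T \<in> null_sets lebesgue. T \<subseteq> {0<..} \<and> (\<forall>t\<in>{0<..} - T.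
        (\<exists>Q. rcpd P t Q \<and> selects \<iota> \<C> P t Q) \<and>
        (\<forall>Q. Q \<in> coord_sigma 0 {0..t} \<rightarrow>\<^sub>M borel_of (path_law_space t) \<longrightarrow>
             (AE \<omega> in P. starts_at t (\<omega> t) (Q \<omega>)) \<longrightarrow>
             selects \<iota> \<C> P t Q \<longrightarrow>
             reconstruction P t Q \<in> \<C> x)))"

end

theory Submission
  imports Defs
begin

text \<open>
  The selection is Krylov's. Fix countably many functionals \<open>J(P) = E\<^sup>P[f(\<xi>\<^sub>\<tau>)]\<close>, with an independent
  exponential time \<open>\<tau>\<close> and a bounded Lipschitz \<open>f\<close>, and maximize them one after the other over
  \<open>\<C>(x)\<close>. Since \<open>\<tau>\<close> has no memory, \<open>J(P)\<close> is the sum of a term depending only on \<open>P\<close> on \<open>\<B>\<^sub>t\<close> and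
  of a positive multiple of the mean of \<open>J\<close> over the conditional laws of \<open>P\<close> on \<open>\<B>\<^sub>t\<close>. Reconstruction therefore forces the conditional laws of a
  maximizer to be maximizers, so that each step again yields an almost surely pre-Markov family. By
  uniqueness of Laplace transforms, the laws left in the intersection have the same one-dimensional
  distributions; conditioning at the times at which disintegration holds, they have the same
  finite-dimensional ones. So the intersection is a single law \<open>P\<^sub>x\<close>, and disintegration of the limit
  family is the almost sure Markov property.
\<close>

section \<open>The dual space and the Gelfand embedding\<close>

text \<open>The excluded times depend on the law, and infinitely many maximizations are made.
  Disintegration is therefore carried along as a statement about every version of the conditional
  law that already lies in \<C>: the version never changes, each step costs one more null set of
  times, and what remains is dense, which by continuity of paths determines a law. Replacing
  conditional laws by better ones needs a measurable choice of maximizers; for this it suffices to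
  know which closed sets a compact-valued map hits, so that the Hausdorff metric is left at once. A
  replacement must also start where the past ends, although nothing ties the laws in \<C>(x) to x;
  this costs a preliminary minimization of the distance from x at time 0. States are points of V',
  so the inverse of the embedding of H has to be Borel: by Riesz, closed balls of H are closed in
  V'. Finally, Lipschitz f make the functionals weakly continuous although the exponential time is
  unbounded, and the rates 1, 2, 3, ... are enough, as Laplace transforms at integers are moments of
  \<open>exp (- s)\<close>.\<close>

text \<open>The variational proof of Riesz' theorem, run in \<open>'v\<close> but converging in
  \<open>'h\<close>: a minimizing sequence \<open>u\<close> of
  \<open>(norm (J v))^2 - 2 * \<phi> v\<close> need not converge, but \<open>J (u n)\<close> is
  Cauchy and \<open>'h\<close> is complete. So \<open>'v\<close> may be a bare vector space, and the
  bound \<open>r\<close> survives for \<open>h\<close>.\<close>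

lemma riesz_dense_range:
  fixes J :: "'v::real_vector \<Rightarrow> 'h::{real_inner, complete_space}" and \<phi> :: "'v \<Rightarrow> real"
  assumes J: "linear J" and \<phi>: "linear \<phi>" and bound: "\<And>v. \<bar>\<phi> v\<bar> \<le> r * norm (J v)" and r: "0 \<le> r"
  shows "\<exists>h. norm h \<le> r \<and> (\<forall>v. \<phi> v = h \<bullet> J v)"
proof -
  interpret J: linear J by (rule J)
  interpret \<phi>: linear \<phi> by (rule \<phi>)
  define q where "q v = (norm (J v))\<^sup>2 - 2 * \<phi> v" for v
  have q_below: "- r\<^sup>2 \<le> q v" for v
  proof -
    have "0 \<le> (norm (J v) - r)\<^sup>2" by simp
    then show ?thesis
      using bound[of v] by (simp add: q_def power2_eq_square algebra_simps)
  qed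
  define s where "s = Inf (range q)"
  have bdd: "bdd_below (range q)"
    using q_below by (auto intro!: bdd_belowI2[of _ "- r\<^sup>2"])
  have s_le: "s \<le> q v" for v
    unfolding s_def using bdd by (auto intro!: cInf_lower)
  have "\<exists>v. q v < s + 1 / Suc n" for n
    using cInf_lessD[of "range q" "s + 1 / Suc n"] by (auto simp: s_def)
  then obtain u where u: "\<And>n. q (u n) < s + 1 / Suc n"
    by metis
  \<comment> \<open>The parallelogram identity turns near-minimality into closeness: at the midpoint
    of \<open>u m\<close> and \<open>u n\<close> the functional is still at least
    \<open>s\<close>.\<close>
  have par: "(dist (J (u m)) (J (u n)))\<^sup>2 \<le> 2 / Suc m + 2 / Suc n" for m n
  proof -
    have *: "4 * q ((1/2) *\<^sub>R (u m + u n)) = (norm (J (u m) + J (u n)))\<^sup>2 - 4 * (\<phi> (u m) + \<phi> (u n))"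
      unfolding q_def J.scaleR J.add \<phi>.scaleR \<phi>.add scaleR_add_right[symmetric] norm_scaleR
      by (simp add: power2_eq_square field_simps)
    have "(norm (J (u m) - J (u n)))\<^sup>2 + (norm (J (u m) + J (u n)))\<^sup>2 =
        2 * (norm (J (u m)))\<^sup>2 + 2 * (norm (J (u n)))\<^sup>2"
      by (simp add: power2_norm_eq_inner algebra_simps inner_commute)
    then have "(dist (J (u m)) (J (u n)))\<^sup>2 = 2 * q (u m) + 2 * q (u n) - 4 * q ((1/2) *\<^sub>R (u m + u n))"
      unfolding * by (simp add: dist_norm q_def)
    also have "\<dots> \<le> 2 * (s + 1 / Suc m) + 2 * (s + 1 / Suc n) - 4 * s"
      using u[of m] u[of n] s_le[of "(1/2) *\<^sub>R (u m + u n)"] by argo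
    finally show ?thesis by simp
  qed
  have "Cauchy (\<lambda>n. J (u n))"
  proof (rule metric_CauchyI)
    fix e :: real assume e: "0 < e"
    obtain N where N: "4 / Suc N < e\<^sup>2"
      using reals_Archimedean[of "e\<^sup>2 / 4"] e by (auto simp: field_simps)
    show "\<exists>M. \<forall>m\<ge>M. \<forall>n\<ge>M. dist (J (u m)) (J (u n)) < e"
    proof (intro exI[of _ N] allI impI)
      fix m n assume mn: "N \<le> m" "N \<le> n"
      have "2 / Suc m \<le> 2 / Suc N" "2 / Suc n \<le> 2 / Suc N"
        using mn by (auto simp: field_simps)
      then have "(dist (J (u m)) (J (u n)))\<^sup>2 < e\<^sup>2"
        using par[of m n] N by linarith
      then show "dist (J (u m)) (J (u n)) < e"
        using e by (rule_tac power2_less_imp_less) auto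
    qed
  qed
  then obtain h where h: "(\<lambda>n. J (u n)) \<longlonglongrightarrow> h"
    by (auto simp: Cauchy_convergent_iff convergent_def)
  have h_eq: "\<phi> v = h \<bullet> J v" for v
  proof -
    define b where "b = h \<bullet> J v - \<phi> v"
    define c where "c = (norm (J v))\<^sup>2"
    \<comment> \<open>First variation: moving from the minimizing sequence by
      \<open>\<tau> *\<^sub>R v\<close> cannot bring \<open>q\<close> below \<open>s\<close>, and
      this passes to the limit of \<open>J (u n)\<close>.\<close>
    have quad: "0 \<le> 2 * \<tau> * b + \<tau>\<^sup>2 * c" for \<tau>
    proof -
      have le: "0 \<le> 1 / Suc n + (2 * \<tau> * (J (u n) \<bullet> J v - \<phi> v) + \<tau>\<^sup>2 * c)" for n
      proof -
        have "s \<le> q (u n + \<tau> *\<^sub>R v)" by (rule s_le)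
        also have "\<dots> = q (u n) + (2 * \<tau> * (J (u n) \<bullet> J v - \<phi> v) + \<tau>\<^sup>2 * c)"
          unfolding q_def c_def power2_norm_eq_inner
          by (simp add: J.scaleR J.add \<phi>.scaleR \<phi>.add algebra_simps inner_commute power2_eq_square)
        finally show ?thesis using u[of n] by linarith
      qed
      have "(\<lambda>n. 1 / Suc n + (2 * \<tau> * (J (u n) \<bullet> J v - \<phi> v) + \<tau>\<^sup>2 * c)) \<longlonglongrightarrow>
          0 + (2 * \<tau> * (h \<bullet> J v - \<phi> v) + \<tau>\<^sup>2 * c)"
        by (intro tendsto_intros h LIMSEQ_Suc[OF lim_1_over_n])
      from LIMSEQ_le_const[OF this] le show ?thesis
        by (auto simp: b_def)
    qed
    have "c \<ge> 0" by (simp add: c_def)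
    \<comment> \<open>A slope \<open>b \<noteq> 0\<close> is contradicted at
      \<open>\<tau> = - b / (c + 1)\<close>; adding 1 to \<open>c\<close> keeps the quotient
      meaningful when \<open>J v = 0\<close>.\<close>
    have "b = 0"
    proof (rule ccontr)
      assume b: "b \<noteq> 0"
      have "2 * (- b / (c + 1)) * b + (- b / (c + 1))\<^sup>2 * c = - b\<^sup>2 * (c + 2) / (c + 1)\<^sup>2"
        using \<open>c \<ge> 0\<close> by (simp add: divide_simps) (simp add: power2_eq_square algebra_simps)
      moreover have "- b\<^sup>2 * (c + 2) / (c + 1)\<^sup>2 < 0"
        using b \<open>c \<ge> 0\<close> by (auto intro!: divide_neg_pos mult_neg_pos)
      ultimately show False
        using quad[of "- b / (c + 1)"] by linarith
    qed
    then show ?thesis by (simp add: b_def)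
  qed
  have "(norm h)\<^sup>2 \<le> r * norm h"
  proof (rule LIMSEQ_le)
    show "(\<lambda>n. h \<bullet> J (u n)) \<longlonglongrightarrow> (norm h)\<^sup>2"
      using h by (auto simp: power2_norm_eq_inner intro!: tendsto_intros)
    show "(\<lambda>n. r * norm (J (u n))) \<longlonglongrightarrow> r * norm h"
      by (intro tendsto_intros h)
    show "\<exists>N. \<forall>n\<ge>N. h \<bullet> J (u n) \<le> r * norm (J (u n))"
      using bound h_eq by (metis abs_le_D1)
  qed
  then have "norm h \<le> r"
    using r by (cases "norm h = 0") (auto simp: power2_eq_square)
  with h_eq show ?thesis by blast
qed

text \<open>With \<open>J\<close> the identity, functionals on \<open>'v\<close> are inner products
  with vectors, and passing from vectors to functionals does not increase distances; a countable
  dense set of vectors thus gives one of functionals.\<close>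

lemma separable_dual:
  "\<exists>a :: nat \<Rightarrow> 'v::{real_inner, polish_space} \<Rightarrow>\<^sub>L real. \<forall>y. \<forall>e>0. \<exists>k. dist y (a k) < e"
proof -
  obtain D :: "'v set" where D: "countable D" "\<And>X. open X \<Longrightarrow> X \<noteq> {} \<Longrightarrow> \<exists>d\<in>D. d \<in> X"
    using countable_dense_setE by blast
  have "D \<noteq> {}" using D(2)[of UNIV] by auto
  define a where "a k = blinfun_inner_right (from_nat_into D k)" for k
  have "\<exists>k. dist y (a k) < e" if e: "e > 0" for y :: "'v \<Rightarrow>\<^sub>L real" and e
  proof -
    have "\<exists>h. norm h \<le> norm y \<and> (\<forall>v. blinfun_apply y v = h \<bullet> id v)"
    proof (rule riesz_dense_range)
      show "linear (id :: 'v \<Rightarrow> 'v)" using linear_id by (simp add: id_def)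
      show "linear (blinfun_apply y)" by (rule bounded_linear.linear[OF blinfun.bounded_linear_right])
      show "\<bar>blinfun_apply y v\<bar> \<le> norm y * norm (id v)" for v
        using norm_blinfun[of y v] by simp
    qed simp
    then obtain h where h: "\<And>v. blinfun_apply y v = h \<bullet> v" by auto
    then have y: "y = blinfun_inner_right h" by (intro blinfun_eqI) simp
    obtain d where d: "d \<in> D" "d \<in> ball h e"
      using D(2)[of "ball h e"] e by auto
    obtain k where k: "from_nat_into D k = d"
      using from_nat_into_surj[OF D(1) d(1)] by auto
    have "norm (blinfun_inner_right h - blinfun_inner_right d) \<le> norm (h - d)"
      by (rule norm_blinfun_bound)
        (auto simp: blinfun.diff_left inner_diff_left[symmetric] Cauchy_Schwarz_ineq2)
    then have "dist y (a k) < e"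
      using d by (simp add: y a_def k dist_norm)
    then show ?thesis by blast
  qed
  then show ?thesis by blast
qed

section \<open>Borel measurability of the inverse embedding\<close>

text \<open>Membership in the image of a ball becomes a family of closed conditions on
  \<open>\<phi>\<close>, one for each test vector \<open>v\<close>. That a functional satisfying
  them comes from H at all is Riesz with the bound \<open>r\<close>.\<close>

lemma gelfand_embedding_cball:
  fixes j :: "'v::{real_inner, polish_space} \<Rightarrow>\<^sub>L 'h::{real_inner, polish_space}"
  assumes "0 \<le> r"
  shows "gelfand_embedding j ` cball c r =
    (\<Inter>v. {\<phi>. \<bar>blinfun_apply \<phi> v - c \<bullet> blinfun_apply j v\<bar> \<le> r * norm (blinfun_apply j v)})"
    (is "_ = ?R")
proof (intro equalityI subsetI)
  fix \<phi> assume "\<phi> \<in> gelfand_embedding j ` cball c r"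
  then obtain h where h: "\<phi> = gelfand_embedding j h" "norm (c - h) \<le> r"
    by (auto simp: dist_norm)
  have "\<bar>(h - c) \<bullet> j v\<bar> \<le> r * norm (j v)" for v
    using Cauchy_Schwarz_ineq2[of "h - c" "j v"] mult_right_mono[OF h(2), of "norm (j v)"]
    by (simp add: norm_minus_commute)
  then show "\<phi> \<in> ?R"
    by (simp add: h(1) gelfand_embedding_apply inner_diff_left)
next
  fix \<phi> assume \<phi>: "\<phi> \<in> ?R"
  have "\<exists>h. norm h \<le> r \<and> (\<forall>v. blinfun_apply \<phi> v - c \<bullet> blinfun_apply j v = h \<bullet> blinfun_apply j v)"
  proof (rule riesz_dense_range)
    show "linear (blinfun_apply j)" by (rule bounded_linear.linear[OF blinfun.bounded_linear_right])
    show "linear (\<lambda>v. blinfun_apply \<phi> v - c \<bullet> blinfun_apply j v)"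
      by (intro linearI) (simp_all add: blinfun.add_right blinfun.scaleR_right algebra_simps)
  qed (use \<phi> assms in auto)
  then obtain h where h: "norm h \<le> r" "\<And>v. blinfun_apply \<phi> v - c \<bullet> blinfun_apply j v = h \<bullet> blinfun_apply j v"
    by blast
  have "\<phi> = gelfand_embedding j (c + h)"
    using h(2) by (intro blinfun_eqI) (simp add: gelfand_embedding_apply inner_add_left algebra_simps)
  then show "\<phi> \<in> gelfand_embedding j ` cball c r"
    using h(1) by (auto simp: dist_norm)
qed

lemma closed_gelfand_embedding_cball:
  fixes j :: "'v::{real_inner, polish_space} \<Rightarrow>\<^sub>L 'h::{real_inner, polish_space}"
  shows "closed (gelfand_embedding j ` cball c r)"
proof (cases "0 \<le> r")
  case True
  show ?thesis
    unfolding gelfand_embedding_cball[OF True]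
    by (intro closed_INT ballI closed_Collect_le continuous_intros)
next
  case False
  then show ?thesis by (simp add: not_le)
qed

text \<open>Balls of radius \<open>1 / Suc n\<close> about a countable dense set; closed ones,
  because for these the image under the embedding is known to be closed.\<close>

lemma open_eq_Union_cball:
  fixes U :: "'a::{metric_space, second_countable_topology} set"
  assumes "open U"
  shows "\<exists>\<C>. countable \<C> \<and> (\<forall>C\<in>\<C>. \<exists>c r. C = cball c r) \<and> U = \<Union>\<C>"
proof -
  obtain D :: "'a set" where D: "countable D" "\<And>X. open X \<Longrightarrow> X \<noteq> {} \<Longrightarrow> \<exists>d\<in>D. d \<in> X"
    using countable_dense_setE by blast
  let ?\<C> = "{C. \<exists>c n. C = cball c (1 / real (Suc n)) \<and> c \<in> D \<and> C \<subseteq> U}"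
  have "?\<C> \<subseteq> (\<lambda>(c, n). cball c (1 / real (Suc n))) ` (D \<times> UNIV)" by auto
  then have "countable ?\<C>"
    by (rule countable_subset) (use D(1) in \<open>intro countable_image countable_SIGMA; simp\<close>)
  moreover have "U \<subseteq> \<Union>?\<C>"
  proof
    fix x assume "x \<in> U"
    then obtain e where e: "0 < e" "ball x e \<subseteq> U"
      using assms openE by blast
    obtain n where n: "1 / real (Suc n) < e / 2"
      using reals_Archimedean[of "e/2"] e by (auto simp: inverse_eq_divide)
    obtain c where c: "c \<in> D" "c \<in> ball x (1 / real (Suc n))"
      using D(2)[of "ball x (1 / real (Suc n))"] by auto
    have "y \<in> U" if "y \<in> cball c (1 / real (Suc n))" for y
    proof -
      have "dist x y \<le> dist x c + dist c y" by (rule dist_triangle)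
      then have "dist x y < e" using n c(2) that by auto
      then show ?thesis using e by auto
    qed
    then have "cball c (1 / real (Suc n)) \<in> ?\<C>" using c by blast
    moreover have "x \<in> cball c (1 / real (Suc n))" using c(2) by (auto simp: dist_commute)
    ultimately show "x \<in> \<Union>?\<C>" by blast
  qed
  ultimately show ?thesis
    by (intro exI[of _ ?\<C>]) blast
qed

text \<open>An elementary Hilbert space case of the Lusin-Souslin theorem. For \<open>UNIV\<close>
  it makes H Borel in the dual, and for all open sets it makes the inverse of the embedding
  Borel.\<close>

lemma gelfand_embedding_open_borel:
  fixes j :: "'v::{real_inner, polish_space} \<Rightarrow>\<^sub>L 'h::{real_inner, polish_space}"
  assumes "open U"
  shows "gelfand_embedding j ` U \<in> sets borel"
proof -
  obtain \<C> where \<C>: "countable \<C>" "\<forall>C\<in>\<C>. \<exists>c r. C = cball c r" "U = \<Union>\<C>"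
    using open_eq_Union_cball[OF assms] by blast
  have "gelfand_embedding j ` U = (\<Union>C\<in>\<C>. gelfand_embedding j ` C)"
    using \<C>(3) by blast
  also have "\<dots> \<in> sets borel"
    using \<C>(1,2) by (intro sets.countable_UN') (auto intro!: borel_closed closed_gelfand_embedding_cball)
  finally show ?thesis .
qed

lemma continuous_gelfand_embedding: "continuous_on UNIV (gelfand_embedding j)"
  unfolding gelfand_embedding_def by (intro continuous_intros)

section \<open>The Borel sets of the path space\<close>

lemma space_borel_of [simp]: "space (borel_of T) = topspace T"
  unfolding borel_of_def by (rule space_measure_of) (auto dest: openin_subset)

lemma sets_borel_of: "sets (borel_of T) = sigma_sets (topspace T) {U. openin T U}"
  unfolding borel_of_def by (rule sets_measure_of) (auto dest: openin_subset)

lemma openin_sets_borel_of: "openin T U \<Longrightarrow> U \<in> sets (borel_of T)"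
  by (simp add: sets_borel_of sigma_sets.Basic)

lemma measurable_borel_of:
  assumes "f \<in> space M \<rightarrow> topspace T" "\<And>U. openin T U \<Longrightarrow> f -` U \<inter> space M \<in> sets M"
  shows "f \<in> M \<rightarrow>\<^sub>M borel_of T"
  unfolding borel_of_def using assms by (intro measurable_measure_of) (auto dest: openin_subset)

lemma measurable_borel_of_closed:
  assumes "f \<in> space M \<rightarrow> topspace T" "\<And>F. closedin T F \<Longrightarrow> f -` F \<inter> space M \<in> sets M"
  shows "f \<in> M \<rightarrow>\<^sub>M borel_of T"
proof (rule measurable_borel_of)
  fix U assume U: "openin T U"
  have "f -` U \<inter> space M = space M - (f -` (topspace T - U) \<inter> space M)"
    using assms(1) openin_subset[OF U] by auto
  also have "\<dots> \<in> sets M"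
    using U by (intro sets.compl_sets assms(2)) auto
  finally show "f -` U \<inter> space M \<in> sets M" .
qed (rule assms(1))

lemma continuous_map_measurable:
  assumes "continuous_map X Y f"
  shows "f \<in> borel_of X \<rightarrow>\<^sub>M borel_of Y"
proof (rule measurable_borel_of)
  show "f \<in> space (borel_of X) \<rightarrow> topspace Y"
    using assms by (auto simp: continuous_map_def)
  fix U assume "openin Y U"
  then have "openin X {x \<in> topspace X. f x \<in> U}"
    using assms by (auto simp: continuous_map_def)
  moreover have "f -` U \<inter> space (borel_of X) = {x \<in> topspace X. f x \<in> U}" by auto
  ultimately show "f -` U \<inter> space (borel_of X) \<in> sets (borel_of X)"
    by (simp add: openin_sets_borel_of)
qed

lemma borel_of_euclidean: "borel_of euclidean = borel"
  by (simp add: borel_of_def borel_def)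

lemma continuous_map_borel_measurable:
  "continuous_map X euclidean f \<Longrightarrow> f \<in> borel_measurable (borel_of X)"
  using continuous_map_measurable[of X euclidean f] by (simp add: borel_of_euclidean)

section \<open>Coordinate fields\<close>

lemma space_coord_sigma [simp]: "space (coord_sigma t I) = paths t"
  unfolding coord_sigma_def by (rule space_measure_of) auto

lemma sets_coord_sigma:
  "sets (coord_sigma t I) = sigma_sets (paths t) {{\<omega> \<in> paths t. \<omega> s \<in> A} | s A. s \<in> I \<and> A \<in> sets borel}"
  unfolding coord_sigma_def by (rule sets_measure_of) auto

lemma measurable_coord:
  assumes "s \<in> I" shows "(\<lambda>\<omega>. \<omega> s) \<in> coord_sigma t I \<rightarrow>\<^sub>M borel"
proof (rule measurableI)
  fix A :: "'a set" assume "A \<in> sets borel"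
  then have "{\<omega> \<in> paths t. \<omega> s \<in> A} \<in> sets (coord_sigma t I)"
    unfolding sets_coord_sigma using assms by (intro sigma_sets.Basic) auto
  moreover have "(\<lambda>\<omega>. \<omega> s) -` A \<inter> space (coord_sigma t I) = {\<omega> \<in> paths t. \<omega> s \<in> A}" by auto
  ultimately show "(\<lambda>\<omega>. \<omega> s) -` A \<inter> space (coord_sigma t I) \<in> sets (coord_sigma t I)" by simp
qed auto

lemma measurable_coord_sigma:
  fixes f :: "'a \<Rightarrow> real \<Rightarrow> 'e::metric_space"
  assumes "f \<in> space M \<rightarrow> paths t" "\<And>s. s \<in> I \<Longrightarrow> (\<lambda>x. f x s) \<in> M \<rightarrow>\<^sub>M borel"
  shows "f \<in> M \<rightarrow>\<^sub>M coord_sigma t I"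
  unfolding coord_sigma_def
proof (rule measurable_measure_of)
  fix B :: "(real \<Rightarrow> 'e) set" assume "B \<in> {{\<omega> \<in> paths t. \<omega> s \<in> A} | s A. s \<in> I \<and> A \<in> sets borel}"
  then obtain s A where B: "B = {\<omega> \<in> paths t. \<omega> s \<in> A}" "s \<in> I" "A \<in> sets borel" by blast
  have "f -` B \<inter> space M = (\<lambda>x. f x s) -` A \<inter> space M"
    using assms(1) B(1) by auto
  then show "f -` B \<inter> space M \<in> sets M"
    using assms(2)[OF B(2)] B(3) by (simp add: measurable_sets)
qed (use assms(1) in auto)

lemma sets_coord_sigma_mono:
  assumes "I \<subseteq> K" shows "sets (coord_sigma t I) \<subseteq> sets (coord_sigma t K)"
  unfolding sets_coord_sigma by (rule sigma_sets_mono') (use assms in blast)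

lemma measurable_coord_sigma_mono:
  assumes "I \<subseteq> K" "f \<in> coord_sigma t I \<rightarrow>\<^sub>M M"
  shows "f \<in> coord_sigma t K \<rightarrow>\<^sub>M M"
  using assms(2) sets_coord_sigma_mono[OF assms(1), of t]
  by (auto simp: measurable_def)

lemma paths_continuous: "\<omega> \<in> paths t \<Longrightarrow> continuous_on {t..} \<omega>"
  by (simp add: paths_def)

lemma paths_eqI:
  assumes "\<omega> \<in> paths t" "\<eta> \<in> paths t" "\<And>s. t \<le> s \<Longrightarrow> \<omega> s = \<eta> s"
  shows "\<omega> = \<eta>"
  using assms by (intro extensionalityI[of _ "{t..}"]) (auto simp: paths_def)

lemma restrict_in_paths:
  assumes "continuous_on {t..} f" shows "restrict f {t..} \<in> paths t"
proof -
  have "continuous_on {t..} (restrict f {t..})"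
    using assms by (subst continuous_on_cong[OF refl, of _ _ f]) auto
  then show ?thesis by (simp add: paths_def)
qed

lemma measurable_coord_closure:
  assumes I: "I \<subseteq> {t..}" and s: "t \<le> s" "s \<in> closure I"
  shows "(\<lambda>\<omega> :: real \<Rightarrow> 'e::metric_space. \<omega> s) \<in> coord_sigma t I \<rightarrow>\<^sub>M borel"
proof -
  obtain u where u: "\<And>n. u n \<in> I" "u \<longlonglongrightarrow> s"
    using s(2) by (auto simp: closure_sequential)
  show ?thesis
  proof (rule borel_measurable_LIMSEQ_metric)
    show "(\<lambda>\<omega> :: real \<Rightarrow> 'e. \<omega> (u n)) \<in> coord_sigma t I \<rightarrow>\<^sub>M borel" for n
      by (rule measurable_coord) (rule u)
    fix \<omega> :: "real \<Rightarrow> 'e" assume "\<omega> \<in> space (coord_sigma t I)"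
    then have "continuous_on {t..} \<omega>" by (simp add: paths_continuous)
    then show "(\<lambda>n. \<omega> (u n)) \<longlonglongrightarrow> \<omega> s"
    proof (rule continuous_on_tendsto_compose)
      show "u \<longlonglongrightarrow> s" by (rule u)
      have "u n \<in> {t..}" for n using u(1) I by blast
      then show "\<forall>\<^sub>F n in sequentially. u n \<in> {t..}" by simp
    qed (use s(1) in simp)
  qed
qed

text \<open>Disintegration is available for almost every time only; by continuity of paths the
  coordinates at a dense set of times already generate everything.\<close>

lemma sets_coord_sigma_dense:
  assumes I: "I \<subseteq> {t..}" "{t..} \<subseteq> closure I"
  shows "sets (coord_sigma t I :: (real \<Rightarrow> 'e::metric_space) measure) = sets (coord_sigma t {t..})" (is "?L = ?R")
proof
  show "?L \<subseteq> ?R"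
    by (rule sets_coord_sigma_mono) (rule I(1))
  show "?R \<subseteq> ?L"
    unfolding sets_coord_sigma[of t "{t..}"]
  proof (rule sets.sigma_sets_subset[of _ "coord_sigma t I", unfolded space_coord_sigma], safe)
    fix s :: real and A :: "'e set" assume s: "t \<le> s" and A: "A \<in> sets borel"
    have "{\<omega> \<in> paths t. \<omega> s \<in> A} = (\<lambda>\<omega>. \<omega> s) -` A \<inter> space (coord_sigma t I)" by auto
    also have "\<dots> \<in> sets (coord_sigma t I)"
      using s I(2) by (intro measurable_sets[OF measurable_coord_closure[OF I(1)] A]) auto
    finally show "{\<omega> \<in> paths t. \<omega> s \<in> A} \<in> sets (coord_sigma t I)" .
  qed
qed

text \<open>With \<open>I = {0..t}\<close>: an event of the past does not see what a path does
  later, so replacing the future of a path by \<open>glue\<close> cannot change it.\<close>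

lemma coord_sigma_depends:
  assumes A: "A \<in> sets (coord_sigma t I)"
    and "\<omega> \<in> paths t" "\<eta> \<in> paths t" "\<And>s. s \<in> I \<Longrightarrow> \<omega> s = \<eta> s"
  shows "\<omega> \<in> A \<longleftrightarrow> \<eta> \<in> A"
  using A unfolding sets_coord_sigma
  by (induction rule: sigma_sets.induct) (use assms(2-4) in auto)

lemma continuous_map_coord:
  assumes "t \<le> s" shows "continuous_map (paths_topology t) euclidean (\<lambda>\<omega>. \<omega> s)"
  unfolding continuous_map_def
proof (intro conjI allI impI)
  fix U :: "'a set" assume "openin euclidean U"
  then have U: "open U" by simp
  show "openin (paths_topology t) {\<omega> \<in> topspace (paths_topology t). \<omega> s \<in> U}"
    unfolding openin_paths_topology paths_open_def
  proof (intro conjI ballI)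
    fix \<omega> assume "\<omega> \<in> {\<omega> \<in> topspace (paths_topology t). \<omega> s \<in> U}"
    then obtain e where "0 < e" "\<And>y. dist y (\<omega> s) < e \<Longrightarrow> y \<in> U"
      using U by (auto simp: open_dist)
    then show "\<exists>T\<ge>t. \<exists>e>0. \<forall>\<eta>\<in>paths t. (\<forall>r\<in>{t..T}. dist (\<omega> r) (\<eta> r) < e) \<longrightarrow>
        \<eta> \<in> {\<omega> \<in> topspace (paths_topology t). \<omega> s \<in> U}"
      using assms by (intro exI[of _ s] conjI exI[of _ e]) (auto simp: dist_commute)
  qed auto
qed auto

lemma sets_coord_sigma_subset_borel_of:
  "sets (coord_sigma t {t..} :: (real \<Rightarrow> 'e::metric_space) measure) \<subseteq> sets (borel_of (paths_topology t))"
proof -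
  have "(\<lambda>\<omega>. \<omega>) \<in> borel_of (paths_topology t) \<rightarrow>\<^sub>M coord_sigma t {t..}"
    by (rule measurable_coord_sigma) (auto intro: continuous_map_borel_measurable continuous_map_coord)
  then have m: "(\<lambda>\<omega>. \<omega>) -` A \<inter> paths t \<in> sets (borel_of (paths_topology t))"
    if "A \<in> sets (coord_sigma t {t..} :: (real \<Rightarrow> 'e) measure)" for A
    using measurable_sets[of "\<lambda>\<omega>. \<omega>" "borel_of (paths_topology t)" "coord_sigma t {t..}" A] that by simp
  show ?thesis
  proof
    fix A :: "(real \<Rightarrow> 'e) set" assume A: "A \<in> sets (coord_sigma t {t..})"
    then have "A \<subseteq> paths t" using sets.sets_into_space by fastforce
    then have "(\<lambda>\<omega>. \<omega>) -` A \<inter> paths t = A" by auto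
    with m[OF A] show "A \<in> sets (borel_of (paths_topology t))" by simp
  qed
qed

text \<open>By continuity, a weak inequality on a countable dense set of times extends to the whole
  interval, so that countably many coordinates decide the event.\<close>

lemma tube_in_coord_sigma:
  fixes y :: "'e::metric_space"
  assumes "t \<le> u"
  shows "{\<omega> \<in> paths t. \<forall>s\<in>{u..v}. dist (\<omega> s) y \<le> r} \<in> sets (coord_sigma t {t..})"
proof -
  obtain T where T: "countable T" "T \<subseteq> {u..v}" "{u..v} \<subseteq> closure T"
    using separable[of "{u..v}"] by metis
  have "{\<omega> \<in> paths t. \<forall>s\<in>{u..v}. dist (\<omega> s) y \<le> r} =
      {\<omega> \<in> space (coord_sigma t {t..}). \<forall>s\<in>T. dist (\<omega> s) y \<le> r}"
    (is "_ = ?R")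
  proof (intro equalityI subsetI)
    fix \<omega> assume \<omega>: "\<omega> \<in> ?R"
    have "closure T \<subseteq> {u..v}"
      using T(2) by (rule closure_minimal) simp
    then have "closure T \<subseteq> {t..}"
      using assms by auto
    then have "continuous_on (closure T) \<omega>"
      using \<omega> paths_continuous[of \<omega> t] by (auto intro: continuous_on_subset)
    then have *: "continuous_on (closure T) (\<lambda>s. dist (\<omega> s) y)"
      by (intro continuous_intros)
    have "dist (\<omega> s) y \<le> r" if "s \<in> {u..v}" for s
      using continuous_le_on_closure[OF *, of s r] \<omega> that T(3) by auto
    then show "\<omega> \<in> {\<omega> \<in> paths t. \<forall>s\<in>{u..v}. dist (\<omega> s) y \<le> r}"
      using \<omega> by simp
  qed (use T(2) in auto)
  also have "\<dots> \<in> sets (coord_sigma t {t..})"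
  proof (intro sets.sets_Collect_countable_All' T(1))
    fix s assume "s \<in> T"
    then have [measurable]: "(\<lambda>\<omega>. \<omega> s) \<in> coord_sigma t {t..} \<rightarrow>\<^sub>M borel"
      using T(2) assms by (intro measurable_coord) auto
    have [measurable]: "(\<lambda>z. dist z y) \<in> borel_measurable borel"
      by (intro borel_measurable_continuous_onI continuous_intros)
    show "{\<omega> \<in> space (coord_sigma t {t..}). dist (\<omega> s) y \<le> r} \<in> sets (coord_sigma t {t..})"
      by measurable
  qed
  finally show ?thesis .
qed

section \<open>Separable state spaces: coordinates generate the Borel field of the path
  space\<close>

text \<open>Separability is given as a sequence, the form in which \<open>separable_dual\<close>
  provides it for the dual of \<open>'v\<close>, the state space to which all this is
  applied.\<close>

locale dense_sequence =
  fixes a :: "nat \<Rightarrow> 'e::metric_space"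
  assumes dense: "0 < e \<Longrightarrow> \<exists>k. dist y (a k) < e"
begin

lemma ex_countable_basis_of_dense: "\<exists>\<U> :: 'e set set. countable \<U> \<and> topological_basis \<U>"
proof (intro exI conjI)
  let ?\<U> = "range (\<lambda>(k, n). ball (a k) (1 / real (Suc n)))"
  show "countable ?\<U>" by simp
  show "topological_basis ?\<U>"
  proof (rule topological_basisI)
    fix O' and y :: 'e assume "open O'" "y \<in> O'"
    then obtain e where e: "0 < e" "ball y e \<subseteq> O'" by (auto elim: openE)
    obtain n where n: "1 / real (Suc n) < e / 2"
      using reals_Archimedean[of "e/2"] e by (auto simp: inverse_eq_divide)
    obtain k where k: "dist y (a k) < 1 / real (Suc n)"
      using dense[of "1 / real (Suc n)" y] by auto
    have "z \<in> O'" if "z \<in> ball (a k) (1 / real (Suc n))" for z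
    proof -
      have "dist y z \<le> dist y (a k) + dist (a k) z" by (rule dist_triangle)
      then have "dist y z < e" using that k n by auto
      then show ?thesis using e(2) by auto
    qed
    then show "\<exists>B'\<in>?\<U>. y \<in> B' \<and> B' \<subseteq> O'"
      using k by (intro bexI[of _ "ball (a k) (1 / real (Suc n))"]) (auto simp: dist_commute)
  qed auto
qed

text \<open>An open set of paths is a union of sets prescribing, up to a fixed precision \<open>1/m\<close>, the path
  on each of finitely many equal time intervals by a point of the dense sequence; there are only
  countably many such sets.\<close>

lemma open_paths_in_coord_sigma:
  assumes U: "openin (paths_topology t) (U :: (real \<Rightarrow> 'e) set)"
  shows "U \<in> sets (coord_sigma t {t..})"
proof -
  define S where "S M K m l = {\<omega> \<in> paths t. \<forall>i<K. \<forall>s\<in>{t + real i * real M / real K..t + real (Suc i) * real M / real K}.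
      dist (\<omega> s) (a (l ! i)) \<le> 1 / real (Suc m)}"
    for M K m :: nat and l :: "nat list"
  have S_sets: "S M K m l \<in> sets (coord_sigma t {t..})" for M K m l
  proof -
    have "S M K m l = {\<omega> \<in> space (coord_sigma t {t..}). \<forall>i\<in>{..<K}. \<omega> \<in> {\<omega> \<in> paths t.
        \<forall>s\<in>{t + real i * real M / real K..t + real (Suc i) * real M / real K}. dist (\<omega> s) (a (l ! i)) \<le> 1 / real (Suc m)}}"
      by (auto simp: S_def)
    also have "\<dots> \<in> sets (coord_sigma t {t..})"
    proof (intro sets.sets_Collect_countable_All' countable_finite finite_lessThan)
      fix i
      have *: "{\<omega> \<in> space (coord_sigma t {t..}). \<omega> \<in> B} = B" if "B \<subseteq> paths t" for B :: "(real \<Rightarrow> 'e) set"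
        using that by auto
      show "{\<omega> \<in> space (coord_sigma t {t..}). \<omega> \<in> {\<omega> \<in> paths t.
        \<forall>s\<in>{t + real i * real M / real K..t + real (Suc i) * real M / real K}. dist (\<omega> s) (a (l ! i)) \<le> 1 / real (Suc m)}}
        \<in> sets (coord_sigma t {t..})"
        by (subst *) (auto intro!: tube_in_coord_sigma)
    qed
    finally show ?thesis .
  qed
  let ?\<S> = "{S M K m l | M K m l. S M K m l \<subseteq> U}"
  have "?\<S> \<subseteq> (\<lambda>(M, K, m, l). S M K m l) ` UNIV" by auto
  then have count: "countable ?\<S>" by (rule countable_subset) simp
  have "U \<subseteq> \<Union>?\<S>"
  proof
    fix \<omega> assume \<omega>: "\<omega> \<in> U"
    have "paths_open t U" using U by (simp add: openin_paths_topology)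
    with \<omega> obtain T e where T: "t \<le> T" "0 < e" "\<And>\<eta>. \<eta> \<in> paths t \<Longrightarrow> (\<forall>s\<in>{t..T}. dist (\<omega> s) (\<eta> s) < e) \<Longrightarrow> \<eta> \<in> U"
      unfolding paths_open_def by meson
    have \<omega>p: "\<omega> \<in> paths t"
      using \<omega> \<open>paths_open t U\<close> by (auto simp: paths_open_def)
    obtain M :: nat where M: "T - t \<le> real M" using real_arch_simple by blast
    obtain m where m: "1 / real (Suc m) < e / 2"
      using reals_Archimedean[of "e/2"] T(2) by (auto simp: inverse_eq_divide)
    \<comment> \<open>Half of the precision \<open>1 / Suc m\<close> is spent on the oscillation of
      \<open>\<omega>\<close> over one time interval, half on the distance of its value at the left
      end from the dense sequence.\<close>
    define \<delta> where "\<delta> = 1 / (2 * real (Suc m))"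
    have \<delta>: "0 < \<delta>" "\<delta> + \<delta> = 1 / real (Suc m)" by (auto simp: \<delta>_def field_simps)
    have "uniformly_continuous_on {t..t + real M} \<omega>"
      using paths_continuous[OF \<omega>p] by (intro compact_uniformly_continuous) (auto intro: continuous_on_subset)
    then obtain d where d: "0 < d" "\<And>r s. r \<in> {t..t + real M} \<Longrightarrow> s \<in> {t..t + real M} \<Longrightarrow> dist s r < d \<Longrightarrow> dist (\<omega> s) (\<omega> r) < \<delta>"
      using \<delta>(1) unfolding uniformly_continuous_on_def by metis
    obtain K0 :: nat where K0: "real M / d < real K0" using reals_Archimedean2 by blast
    define K where "K = Suc K0"
    have Kpos: "real K > 0" by (simp add: K_def)
    have "real M / d < real K" using K0 by (simp add: K_def)
    then have K: "real M / real K < d"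
      using d(1) Kpos by (simp add: field_simps)
    define \<tau> where "\<tau> i = t + real i * real M / real K" for i :: nat
    have \<tau>_Suc: "t + real (Suc i) * real M / real K = \<tau> i + real M / real K" for i
      by (simp add: \<tau>_def add_divide_distrib distrib_right)
    have \<tau>_bounds: "t \<le> \<tau> i" "\<tau> i + real M / real K \<le> t + real M" if "i < K" for i
    proof -
      show "t \<le> \<tau> i" by (simp add: \<tau>_def)
      have "real (Suc i) * real M / real K \<le> real K * real M / real K"
        using that by (intro divide_right_mono mult_right_mono) auto
      then show "\<tau> i + real M / real K \<le> t + real M"
        using Kpos by (simp flip: \<tau>_Suc)
    qed
    have "\<exists>k. dist (\<omega> (\<tau> i)) (a k) < \<delta>" for i
      using dense[OF \<delta>(1)] .
    then obtain k where k: "\<And>i. dist (\<omega> (\<tau> i)) (a (k i)) < \<delta>" by metis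
    define l where "l = map k [0..<K]"
    have l: "l ! i = k i" if "i < K" for i using that by (simp add: l_def)
    have "\<omega> \<in> S M K m l"
      unfolding S_def
    proof (intro CollectI conjI \<omega>p allI impI ballI)
      fix i s assume i: "i < K" and "s \<in> {t + real i * real M / real K..t + real (Suc i) * real M / real K}"
      then have s: "\<tau> i \<le> s" "s \<le> \<tau> i + real M / real K"
        unfolding \<tau>_Suc by (auto simp: \<tau>_def)
      have "dist (\<omega> s) (\<omega> (\<tau> i)) < \<delta>"
        using s \<tau>_bounds[OF i] K by (intro d(2)) (auto simp: dist_real_def)
      then have "dist (\<omega> s) (a (k i)) < \<delta> + \<delta>"
        using k[of i] dist_triangle[of "\<omega> s" "a (k i)" "\<omega> (\<tau> i)"] by linarith
      then show "dist (\<omega> s) (a (l ! i)) \<le> 1 / real (Suc m)"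
        using \<delta>(2) l[OF i] by simp
    qed
    moreover have "S M K m l \<subseteq> U"
    proof
      fix \<eta> assume \<eta>: "\<eta> \<in> S M K m l"
      show "\<eta> \<in> U"
      proof (rule T(3))
        show "\<eta> \<in> paths t" using \<eta> by (simp add: S_def)
        show "\<forall>s\<in>{t..T}. dist (\<omega> s) (\<eta> s) < e"
        proof
          fix s assume s: "s \<in> {t..T}"
          have "\<exists>i<K. s \<in> {t + real i * real M / real K..t + real (Suc i) * real M / real K}"
          \<comment> \<open>\<open>M = 0\<close> leaves the single point \<open>t\<close>, and the
            rescaling below would divide by 0.\<close>
          proof (cases "M = 0")
            case True
            then have "s = t" using s M by auto
            then show ?thesis using True by (intro exI[of _ 0]) (auto simp: K_def)
          next
            case False
            define x where "x = (s - t) * real K / real M"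
            have x: "0 \<le> x" "x \<le> real K"
              using s M False Kpos by (auto simp: x_def divide_simps intro!: mult_right_mono)
            have sx: "s = t + x * real M / real K"
              using False Kpos by (simp add: x_def)
            \<comment> \<open>The minimum treats the right end \<open>x = K\<close>, which belongs
              to the last interval, of index \<open>K0\<close>.\<close>
            define i where "i = min (nat \<lfloor>x\<rfloor>) K0"
            have "real i \<le> x"
              using x(1) of_int_floor_le[of x] by (simp add: i_def min_def) linarith
            moreover have "x \<le> real (Suc i)"
            proof (cases "nat \<lfloor>x\<rfloor> \<le> K0")
              case True
              then have "i = nat \<lfloor>x\<rfloor>" by (simp add: i_def)
              then show ?thesis using x(1) real_of_int_floor_add_one_ge[of x] by (simp add: add.commute)
            next
              case False
              then show ?thesis using x(2) by (simp add: i_def K_def)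
            qed
            ultimately have "real i * real M / real K \<le> x * real M / real K" "x * real M / real K \<le> real (Suc i) * real M / real K"
              by (auto intro!: divide_right_mono mult_right_mono)
            then show ?thesis
              unfolding sx by (intro exI[of _ i]) (auto simp: i_def K_def)
          qed
          then obtain i where i: "i < K" "s \<in> {t + real i * real M / real K..t + real (Suc i) * real M / real K}" by blast
          have "dist (\<omega> s) (a (l ! i)) \<le> 1 / real (Suc m)" "dist (\<eta> s) (a (l ! i)) \<le> 1 / real (Suc m)"
            using \<eta> \<open>\<omega> \<in> S M K m l\<close> i by (auto simp: S_def)
          then show "dist (\<omega> s) (\<eta> s) < e"
            using dist_triangle2[of "\<omega> s" "\<eta> s" "a (l ! i)"] m by linarith
        qed
      qed
    qed
    ultimately show "\<omega> \<in> \<Union>?\<S>" by blast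
  qed
  then have "U = \<Union>?\<S>" by blast
  also have "\<dots> \<in> sets (coord_sigma t {t..})"
    using count by (intro sets.countable_Union) (auto intro: S_sets)
  finally show ?thesis .
qed

lemma sets_borel_of_paths:
  "sets (borel_of (paths_topology t :: (real \<Rightarrow> 'e) topology)) = sets (coord_sigma t {t..})"
proof
  show "sets (borel_of (paths_topology t)) \<subseteq> sets (coord_sigma t {t..} :: (real \<Rightarrow> 'e) measure)"
    unfolding sets_borel_of
    by (rule sets.sigma_sets_subset[of _ "coord_sigma t {t..}", unfolded space_coord_sigma, folded topspace_paths_topology])
      (auto intro: open_paths_in_coord_sigma)
qed (rule sets_coord_sigma_subset_borel_of)

end

section \<open>Laws of paths\<close>

text \<open>Stopping, shifting in either direction and forgetting the past are all composition with
  a change of time; continuity and measurability are proved once for all of them.\<close>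

definition reparam :: "real \<Rightarrow> (real \<Rightarrow> real) \<Rightarrow> (real \<Rightarrow> 'e) \<Rightarrow> real \<Rightarrow> 'e" where
  "reparam u \<phi> \<omega> = restrict (\<lambda>s. \<omega> (\<phi> s)) {u..}"

text \<open>The last clause sends bounded time intervals to bounded ones, which is what uniform
  convergence on compacts asks of a change of time.\<close>

definition time_change :: "real \<Rightarrow> real \<Rightarrow> (real \<Rightarrow> real) \<Rightarrow> bool" where
  "time_change t u \<phi> \<longleftrightarrow> continuous_on {u..} \<phi> \<and> (\<forall>s\<ge>u. t \<le> \<phi> s) \<and> (\<forall>T. \<exists>T'\<ge>t. \<forall>s\<in>{u..T}. \<phi> s \<le> T')"

lemma reparam_in_paths:
  assumes "time_change t u \<phi>" "\<omega> \<in> paths t"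
  shows "reparam u \<phi> \<omega> \<in> paths u"
  unfolding reparam_def
proof (rule restrict_in_paths)
  show "continuous_on {u..} (\<lambda>s. \<omega> (\<phi> s))"
    using assms paths_continuous[OF assms(2)]
    by (intro continuous_on_compose2[of "{t..}" \<omega> "{u..}" \<phi>]) (auto simp: time_change_def)
qed

lemma continuous_map_reparam:
  assumes \<phi>: "time_change t u \<phi>"
  shows "continuous_map (paths_topology t) (paths_topology u :: (real \<Rightarrow> 'e::metric_space) topology) (reparam u \<phi>)"
  unfolding continuous_map_def
proof (intro conjI allI impI)
  show "reparam u \<phi> \<in> topspace (paths_topology t) \<rightarrow> topspace (paths_topology u)"
    using reparam_in_paths[OF \<phi>] by auto
  fix U :: "(real \<Rightarrow> 'e) set" assume "openin (paths_topology u) U"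
  then have U: "paths_open u U" by (simp add: openin_paths_topology)
  show "openin (paths_topology t) {\<omega> \<in> topspace (paths_topology t). reparam u \<phi> \<omega> \<in> U}"
    unfolding openin_paths_topology paths_open_def
  proof (intro conjI ballI)
    fix \<omega> assume \<omega>: "\<omega> \<in> {\<omega> \<in> topspace (paths_topology t). reparam u \<phi> \<omega> \<in> U}"
    then obtain T e where T: "u \<le> T" "0 < e" and
      *: "\<And>\<eta>. \<eta> \<in> paths u \<Longrightarrow> (\<forall>s\<in>{u..T}. dist (reparam u \<phi> \<omega> s) (\<eta> s) < e) \<Longrightarrow> \<eta> \<in> U"
      using U unfolding paths_open_def by blast
    have "\<exists>T'\<ge>t. \<forall>s\<in>{u..T}. \<phi> s \<le> T'"
      using \<phi> by (simp add: time_change_def)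
    then obtain T' where T': "t \<le> T'" "\<And>s. s \<in> {u..T} \<Longrightarrow> \<phi> s \<le> T'"
      by blast
    have "reparam u \<phi> \<eta> \<in> U" if \<eta>: "\<eta> \<in> paths t" "\<forall>s\<in>{t..T'}. dist (\<omega> s) (\<eta> s) < e" for \<eta>
    proof (rule *)
      show "reparam u \<phi> \<eta> \<in> paths u" by (rule reparam_in_paths) fact+
      show "\<forall>s\<in>{u..T}. dist (reparam u \<phi> \<omega> s) (reparam u \<phi> \<eta> s) < e"
        using \<eta>(2) T' \<phi> by (auto simp: reparam_def time_change_def)
    qed
    then show "\<exists>T\<ge>t. \<exists>e>0. \<forall>\<eta>\<in>paths t. (\<forall>s\<in>{t..T}. dist (\<omega> s) (\<eta> s) < e) \<longrightarrow>
        \<eta> \<in> {\<omega> \<in> topspace (paths_topology t). reparam u \<phi> \<omega> \<in> U}"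
      using T' T by (intro exI[of _ T'] conjI exI[of _ e]) auto
  qed auto
qed

lemma measurable_reparam:
  assumes \<phi>: "time_change t u \<phi>" and I: "\<And>s. s \<in> K \<Longrightarrow> u \<le> s \<and> \<phi> s \<in> I"
  shows "reparam u \<phi> \<in> coord_sigma t I \<rightarrow>\<^sub>M coord_sigma u K"
proof (rule measurable_coord_sigma)
  show "reparam u \<phi> \<in> space (coord_sigma t I) \<rightarrow> paths u"
    using reparam_in_paths[OF \<phi>] by auto
  show "(\<lambda>\<omega>. reparam u \<phi> \<omega> s) \<in> coord_sigma t I \<rightarrow>\<^sub>M borel" if "s \<in> K" for s
    using I[OF that] by (simp add: reparam_def measurable_coord)
qed

abbreviation stop_path :: "real \<Rightarrow> (real \<Rightarrow> 'e) \<Rightarrow> real \<Rightarrow> 'e" where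
  "stop_path t \<equiv> reparam 0 (\<lambda>s. min s t)"

text \<open>On a path starting at time \<open>t\<close> it undoes the shift; on one starting at 0 it
  forgets the past before \<open>t\<close>.\<close>

abbreviation unshift_path :: "real \<Rightarrow> (real \<Rightarrow> 'e) \<Rightarrow> real \<Rightarrow> 'e" where
  "unshift_path t \<equiv> reparam 0 (\<lambda>s. s + t)"

abbreviation future_path :: "real \<Rightarrow> (real \<Rightarrow> 'e) \<Rightarrow> real \<Rightarrow> 'e" where
  "future_path t \<equiv> reparam t (\<lambda>s. s)"

lemma restrict_eq_future_path: "restrict \<omega> {t..} = future_path t \<omega>"
  by (simp add: reparam_def)

lemma shift_path_eq: "shift_path t = reparam t (\<lambda>s. s - t)"
  by (simp add: fun_eq_iff shift_path_def reparam_def)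

lemma time_change_stop: "0 \<le> t \<Longrightarrow> time_change 0 0 (\<lambda>s. min s t)"
  unfolding time_change_def by (intro conjI continuous_intros allI) (auto intro!: exI[of _ t])

lemma time_change_unshift: "time_change t 0 (\<lambda>s. s + t)"
  unfolding time_change_def
proof (intro conjI continuous_intros allI)
  fix T show "\<exists>T'\<ge>t. \<forall>s\<in>{0..T}. s + t \<le> T'" by (intro exI[of _ "max t (T + t)"]) auto
qed auto

lemma time_change_future: "0 \<le> t \<Longrightarrow> time_change 0 t (\<lambda>s. s)"
  unfolding time_change_def
proof (intro conjI continuous_intros allI)
  fix T show "\<exists>T'\<ge>0. \<forall>s\<in>{t..T}. s \<le> T'" by (intro exI[of _ "max 0 T"]) auto
qed auto

lemma time_change_shift: "time_change 0 t (\<lambda>s. s - t)"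
  unfolding time_change_def
proof (intro conjI continuous_intros allI)
  fix T show "\<exists>T'\<ge>0. \<forall>s\<in>{t..T}. s - t \<le> T'" by (intro exI[of _ "max 0 (T - t)"]) auto
qed auto

lemma unshift_shift_path: "\<omega> \<in> paths 0 \<Longrightarrow> unshift_path t (shift_path t \<omega>) = \<omega>"
  using reparam_in_paths[OF time_change_unshift reparam_in_paths[OF time_change_shift], of \<omega> t]
  by (intro paths_eqI[of _ 0]) (auto simp: shift_path_eq reparam_def)

lemma prob_measuresD:
  assumes "P \<in> prob_measures T"
  shows "prob_space P" "sets P = sets (borel_of T)" "space P = topspace T"
  using assms sets_eq_imp_space_eq[of P "borel_of T"] by (auto simp: prob_measures_def)

lemma distr_in_prob_measures:
  assumes "P \<in> prob_measures X" "g \<in> borel_of X \<rightarrow>\<^sub>M borel_of Y"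
  shows "distr P (borel_of Y) g \<in> prob_measures Y"
proof -
  have "g \<in> P \<rightarrow>\<^sub>M borel_of Y"
    using assms(2) prob_measuresD(2)[OF assms(1)] by (simp cong: measurable_cong_sets)
  then show ?thesis
    using prob_space.prob_space_distr[OF prob_measuresD(1)[OF assms(1)]] by (simp add: prob_measures_def)
qed

lemma continuous_map_weak_integral:
  fixes f :: "'a \<Rightarrow> real"
  assumes "continuous_map T euclideanreal f" "bounded (f ` topspace T)"
  shows "continuous_map (weak_conv_topology T) euclideanreal (\<lambda>P. \<integral>\<omega>. f \<omega> \<partial>P)"
  unfolding continuous_map_def
proof (intro conjI allI impI)
  fix U :: "real set" assume "openin euclideanreal U"
  then have "{P \<in> prob_measures T. (\<integral>\<omega>. f \<omega> \<partial>P) \<in> U} \<in> {{P \<in> prob_measures T. (\<integral>\<omega>. f \<omega> \<partial>P) \<in> U} | (f :: 'a \<Rightarrow> real) U.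
        continuous_map T euclideanreal f \<and> bounded (f ` topspace T) \<and> open U}"
    using assms by auto
  then show "openin (weak_conv_topology T) {P \<in> topspace (weak_conv_topology T). (\<integral>\<omega>. f \<omega> \<partial>P) \<in> U}"
    unfolding topspace_weak_conv_topology by (subst weak_conv_topology_def) (rule topology_generated_by_Basis)
qed auto

lemma continuous_map_distr:
  assumes g: "continuous_map X Y g"
  shows "continuous_map (weak_conv_topology X) (weak_conv_topology Y) (\<lambda>P. distr P (borel_of Y) g)"
proof -
  have img: "(\<lambda>P. distr P (borel_of Y) g) ` topspace (weak_conv_topology X) \<subseteq> topspace (weak_conv_topology Y)"
    using distr_in_prob_measures continuous_map_measurable[OF g] by auto
  show ?thesis
    unfolding weak_conv_topology_def[of Y]
  proof (rule continuous_on_generated_topo)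
    fix \<U> assume "\<U> \<in> {{P \<in> prob_measures Y. (\<integral>\<omega>. f \<omega> \<partial>P) \<in> U} | (f :: 'b \<Rightarrow> real) U.
        continuous_map Y euclideanreal f \<and> bounded (f ` topspace Y) \<and> open U}"
    then obtain f :: "'b \<Rightarrow> real" and U where \<U>: "\<U> = {P \<in> prob_measures Y. (\<integral>\<omega>. f \<omega> \<partial>P) \<in> U}"
      and f: "continuous_map Y euclideanreal f" "bounded (f ` topspace Y)" "open U" by blast
    have int: "(\<integral>\<omega>. f \<omega> \<partial>distr P (borel_of Y) g) = (\<integral>\<omega>. f (g \<omega>) \<partial>P)" if "P \<in> prob_measures X" for P
      using continuous_map_borel_measurable[OF f(1)] continuous_map_measurable[OF g] prob_measuresD(2)[OF that]
      by (intro integral_distr) (auto cong: measurable_cong_sets)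
    have "continuous_map X euclideanreal (\<lambda>x. f (g x))"
      using continuous_map_compose[OF g f(1)] by (simp add: o_def)
    moreover have "bounded ((\<lambda>x. f (g x)) ` topspace X)"
      using f(2) continuous_map_image_subset_topspace[OF g] by (rule_tac bounded_subset) auto
    ultimately have "continuous_map (weak_conv_topology X) euclideanreal (\<lambda>P. \<integral>\<omega>. f (g \<omega>) \<partial>P)"
      by (rule continuous_map_weak_integral)
    then have "openin (weak_conv_topology X) {P \<in> topspace (weak_conv_topology X). (\<integral>\<omega>. f (g \<omega>) \<partial>P) \<in> U}"
      using f(3) by (auto simp: continuous_map_def)
    also have "{P \<in> topspace (weak_conv_topology X). (\<integral>\<omega>. f (g \<omega>) \<partial>P) \<in> U} =
        (\<lambda>P. distr P (borel_of Y) g) -` \<U> \<inter> topspace (weak_conv_topology X)"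
      using img int by (auto simp: \<U>)
    finally show "openin (weak_conv_topology X) ((\<lambda>P. distr P (borel_of Y) g) -` \<U> \<inter> topspace (weak_conv_topology X))" .
  next
    show "(\<lambda>P. distr P (borel_of Y) g) ` topspace (weak_conv_topology X)
      \<subseteq> \<Union>{{P \<in> prob_measures Y. (\<integral>\<omega>. f \<omega> \<partial>P) \<in> U} | (f :: 'b \<Rightarrow> real) U.
        continuous_map Y euclideanreal f \<and> bounded (f ` topspace Y) \<and> open U}"
      using img by (simp only: weak_conv_topology_def topology_generated_by_topspace)
  qed
qed

text \<open>A left inverse of \<open>shift_law t\<close>. It carries conditional laws back to time
  0, where the functionals and the family live.\<close>

definition unshift_law :: "real \<Rightarrow> (real \<Rightarrow> 'e::metric_space) measure \<Rightarrow> (real \<Rightarrow> 'e) measure" where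
  "unshift_law t Q = distr Q (borel_of (paths_topology 0)) (unshift_path t)"

lemma continuous_map_shift_law: "continuous_map (path_law_space 0) (path_law_space t) (shift_law t)"
  using continuous_map_distr[OF continuous_map_reparam[OF time_change_shift]]
  by (simp add: shift_law_def[abs_def] shift_path_eq)

lemma continuous_map_unshift_law: "continuous_map (path_law_space t) (path_law_space 0) (unshift_law t)"
  using continuous_map_distr[OF continuous_map_reparam[OF time_change_unshift]]
  by (simp add: unshift_law_def[abs_def])

lemma measurable_shift_path: "shift_path t \<in> borel_of (paths_topology 0) \<rightarrow>\<^sub>M borel_of (paths_topology t)"
  unfolding shift_path_eq by (intro continuous_map_measurable continuous_map_reparam time_change_shift)

lemma measurable_unshift_path: "unshift_path t \<in> borel_of (paths_topology t) \<rightarrow>\<^sub>M borel_of (paths_topology 0)"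
  by (intro continuous_map_measurable continuous_map_reparam time_change_unshift)

lemma distr_eq_self:
  assumes "sets M = sets N" "\<And>x. x \<in> space M \<Longrightarrow> f x = x"
  shows "distr M N f = M"
  using distr_cong[of M M N N f "\<lambda>x. x"] distr_id2[of N M] assms by simp

lemma unshift_shift_law:
  assumes "P \<in> prob_measures (paths_topology 0)"
  shows "unshift_law t (shift_law t P) = P"
proof -
  have "unshift_law t (shift_law t P) = distr P (borel_of (paths_topology 0)) (unshift_path t \<circ> shift_path t)"
    unfolding unshift_law_def shift_law_def
    using measurable_shift_path prob_measuresD(2)[OF assms]
    by (intro distr_distr measurable_unshift_path) (simp cong: measurable_cong_sets)
  also have "\<dots> = P"
    using prob_measuresD(2,3)[OF assms] by (intro distr_eq_self) (auto simp: unshift_shift_path)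
  finally show ?thesis .
qed

lemma shift_law_in_prob_measures:
  "P \<in> prob_measures (paths_topology 0) \<Longrightarrow> shift_law t P \<in> prob_measures (paths_topology t)"
  unfolding shift_law_def by (rule distr_in_prob_measures[OF _ measurable_shift_path])

lemma unshift_law_in_prob_measures:
  "Q \<in> prob_measures (paths_topology t) \<Longrightarrow> unshift_law t Q \<in> prob_measures (paths_topology 0)"
  unfolding unshift_law_def by (rule distr_in_prob_measures[OF _ measurable_unshift_path])

section \<open>Lipschitz approximation of cylinder events\<close>

text \<open>Lipschitz functions that increase to the indicator of an open \<open>U\<close>. The case
  \<open>UNIV\<close> is separate since \<open>infdist\<close> to the empty set is 0, which would
  make them vanish.\<close>

definition bump :: "'e::metric_space set \<Rightarrow> nat \<Rightarrow> 'e \<Rightarrow> real" where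
  "bump U n y = (if U = UNIV then 1 else min 1 (real n * infdist y (- U)))"

lemma bump_bounds: "0 \<le> bump U n y" "bump U n y \<le> 1"
  by (auto simp: bump_def infdist_nonneg)

lemma bump_lipschitz: "\<bar>bump U n x - bump U n y\<bar> \<le> real n * dist x y"
proof -
  have "\<bar>min 1 (real n * infdist x (- U)) - min 1 (real n * infdist y (- U))\<bar>
      \<le> \<bar>real n * infdist x (- U) - real n * infdist y (- U)\<bar>"
    by (auto simp: min_def)
  also have "\<dots> = real n * \<bar>infdist x (- U) - infdist y (- U)\<bar>"
    by (simp add: abs_mult flip: right_diff_distrib)
  also have "\<dots> \<le> real n * dist x y"
    by (intro mult_left_mono infdist_triangle_abs) auto
  finally show ?thesis by (simp add: bump_def)
qed

lemma continuous_bump: "continuous_on S (bump U n)"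
  unfolding bump_def by (cases "U = UNIV") (auto intro!: continuous_intros)

lemma bump_tendsto:
  assumes "open U" shows "(\<lambda>n. bump U n y) \<longlonglongrightarrow> indicator U y"
proof (cases "U = UNIV")
  case False
  show ?thesis
  proof (cases "y \<in> U")
    case True
    have "infdist y (- U) > 0"
      using assms True False by (intro infdist_pos_not_in_closed) auto
    then obtain N where N: "1 < real N * infdist y (- U)"
      using reals_Archimedean3 by blast
    have "bump U n y = 1" if "N \<le> n" for n
      using N mult_right_mono[of "real N" "real n" "infdist y (- U)"] that infdist_nonneg[of y "- U"] False
      by (simp add: bump_def min_def)
    then have "\<forall>\<^sub>F n in sequentially. bump U n y = indicator U y"
      using True by (auto simp: eventually_sequentially)
    then show ?thesis by (rule tendsto_eventually)
  next
    case out: False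
    then show ?thesis using False by (simp add: bump_def)
  qed
qed (simp add: bump_def)

text \<open>Constraints are kept in a list, so that intersecting cylinders is appending lists; a
  time may occur repeatedly.\<close>

definition cyl :: "real \<Rightarrow> (real \<times> 'e::metric_space set) list \<Rightarrow> (real \<Rightarrow> 'e) set" where
  "cyl t l = {\<omega> \<in> paths t. \<forall>(s, U)\<in>set l. \<omega> s \<in> U}"

definition cyl_bump :: "nat \<Rightarrow> (real \<times> 'e::metric_space set) list \<Rightarrow> (real \<Rightarrow> 'e) \<Rightarrow> real" where
  "cyl_bump n l \<omega> = (\<Prod>(s, U)\<leftarrow>l. bump U n (\<omega> s))"

lemma cyl_bump_bounds: "0 \<le> cyl_bump n l \<omega> \<and> cyl_bump n l \<omega> \<le> 1"
  by (induction l) (auto simp: cyl_bump_def bump_bounds intro!: mult_le_one mult_nonneg_nonneg)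

lemma continuous_map_cyl_bump:
  assumes "\<And>s U. (s, U) \<in> set l \<Longrightarrow> t \<le> s"
  shows "continuous_map (paths_topology t) euclideanreal (cyl_bump n l)"
  using assms
proof (induction l)
  case Nil
  then show ?case by (simp add: cyl_bump_def[abs_def])
next
  case (Cons x l)
  obtain s U where x: "x = (s, U)" by fastforce
  have "continuous_map (paths_topology t) euclideanreal (bump U n \<circ> (\<lambda>\<omega>. \<omega> s))"
    using Cons.prems continuous_bump[of UNIV U n]
    by (intro continuous_map_compose[OF continuous_map_coord]) (auto simp: x)
  moreover have "continuous_map (paths_topology t) euclideanreal (cyl_bump n l)"
    using Cons by auto
  ultimately have "continuous_map (paths_topology t) euclideanreal (\<lambda>\<omega>. bump U n (\<omega> s) * cyl_bump n l \<omega>)"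
    by (intro continuous_map_real_mult) (auto simp: o_def)
  then show ?case by (simp add: cyl_bump_def[abs_def] x)
qed

lemma cyl_bump_tendsto:
  assumes "\<And>s U. (s, U) \<in> set l \<Longrightarrow> open U" "\<omega> \<in> paths t"
  shows "(\<lambda>n. cyl_bump n l \<omega>) \<longlonglongrightarrow> indicator (cyl t l) \<omega>"
  using assms(1)
proof (induction l)
  case Nil
  then show ?case using assms(2) by (simp add: cyl_bump_def cyl_def)
next
  case (Cons x l)
  obtain s U where x: "x = (s, U)" by fastforce
  have "(\<lambda>n. bump U n (\<omega> s) * cyl_bump n l \<omega>) \<longlonglongrightarrow> indicator U (\<omega> s) * indicator (cyl t l) \<omega>"
    using Cons by (intro tendsto_mult bump_tendsto) (auto simp: x)
  also have "indicator U (\<omega> s) * indicator (cyl t l) \<omega> = (indicator (cyl t (x # l)) \<omega> :: real)"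
    by (auto simp: x cyl_def indicator_def)
  finally show ?case by (simp add: cyl_bump_def x)
qed

lemma cyl_append: "cyl t l \<inter> cyl t l' = cyl t (l @ l')"
  by (auto simp: cyl_def)

lemma cyl_sets:
  assumes "\<And>s U. (s, U) \<in> set l \<Longrightarrow> s \<in> I \<and> U \<in> sets borel"
  shows "cyl t l \<in> sets (coord_sigma t I)"
  using assms
proof (induction l)
  case Nil
  then show ?case using sets.top[of "coord_sigma t I"] by (simp add: cyl_def)
next
  case (Cons x l)
  obtain s U where x: "x = (s, U)" by fastforce
  have "cyl t (x # l) = ((\<lambda>\<omega>. \<omega> s) -` U \<inter> space (coord_sigma t I)) \<inter> cyl t l"
    by (auto simp: cyl_def x)
  also have "\<dots> \<in> sets (coord_sigma t I)"
    using Cons by (intro sets.Int measurable_sets[OF measurable_coord]) (auto simp: x)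
  finally show ?case .
qed

text \<open>The cylinders are a generating \<pi>-system. \<open>\<U>\<close> may be any generator of
  the Borel field of states: a countable base gives countably many cylinders once \<open>I\<close>
  is countable too.\<close>

lemma sets_coord_sigma_cyl:
  assumes \<U>: "borel = sigma UNIV (\<U> :: 'e::metric_space set set)"
  shows "sets (coord_sigma t I) = sigma_sets (paths t) {cyl t l | l. set l \<subseteq> I \<times> \<U>}" (is "_ = sigma_sets _ ?G")
proof
  have \<U>_sets: "U \<in> sets borel" if "U \<in> \<U>" for U using that by (simp add: \<U>)
  have G: "?G \<subseteq> Pow (paths t)" by (auto simp: cyl_def)
  have "(\<lambda>\<omega>. \<omega>) \<in> sigma (paths t) ?G \<rightarrow>\<^sub>M coord_sigma t I"
  proof (rule measurable_coord_sigma)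
    fix s assume s: "s \<in> I"
    have "(\<lambda>\<omega>. \<omega> s) \<in> sigma (paths t) ?G \<rightarrow>\<^sub>M sigma UNIV \<U>"
    proof (rule measurable_measure_of)
      fix U assume U: "U \<in> \<U>"
      have "(\<lambda>\<omega>. \<omega> s) -` U \<inter> space (sigma (paths t) ?G) = cyl t [(s, U)]"
        using G by (auto simp: cyl_def)
      also have "\<dots> \<in> sets (sigma (paths t) ?G)"
        using G U s by (auto intro!: sigma_sets.Basic exI[of _ "[(s, U)]"])
      finally show "(\<lambda>\<omega>. \<omega> s) -` U \<inter> space (sigma (paths t) ?G) \<in> sets (sigma (paths t) ?G)" .
    qed auto
    then show "(\<lambda>\<omega>. \<omega> s) \<in> sigma (paths t) ?G \<rightarrow>\<^sub>M borel" by (simp only: \<U>)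
  qed (use G in auto)
  then have m: "(\<lambda>\<omega>. \<omega>) -` A \<inter> paths t \<in> sigma_sets (paths t) ?G" if "A \<in> sets (coord_sigma t I)" for A
    using measurable_sets[of "\<lambda>\<omega>. \<omega>" "sigma (paths t) ?G" "coord_sigma t I" A] that G by simp
  show "sets (coord_sigma t I) \<subseteq> sigma_sets (paths t) ?G"
  proof
    fix A :: "(real \<Rightarrow> 'e) set" assume A: "A \<in> sets (coord_sigma t I)"
    then have "A \<subseteq> paths t" using sets.sets_into_space by fastforce
    then have "(\<lambda>\<omega>. \<omega>) -` A \<inter> paths t = A" by auto
    with m[OF A] show "A \<in> sigma_sets (paths t) ?G" by simp
  qed
  show "sigma_sets (paths t) ?G \<subseteq> sets (coord_sigma t I)"
    using \<U>_sets
    by (intro sets.sigma_sets_subset[of _ "coord_sigma t I", unfolded space_coord_sigma]) (auto intro!: cyl_sets)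
qed

lemma Int_stable_cyl: "Int_stable {cyl t l | l. set l \<subseteq> X}"
proof (rule Int_stableI)
  fix A B assume "A \<in> {cyl t l | l. set l \<subseteq> X}" "B \<in> {cyl t l | l. set l \<subseteq> X}"
  then obtain l l' where l: "A = cyl t l" "B = cyl t l'" "set (l @ l') \<subseteq> X" by auto
  then have "A \<inter> B = cyl t (l @ l')" by (simp only: cyl_append)
  then show "A \<inter> B \<in> {cyl t l | l. set l \<subseteq> X}"
    using l(3) by blast
qed

section \<open>Laws are determined by cylinders; the space of laws\<close>

context dense_sequence begin

lemma laws_eqI:
  fixes P R :: "(real \<Rightarrow> 'e) measure"
  assumes PR: "P \<in> prob_measures (paths_topology t)" "R \<in> prob_measures (paths_topology t)"
    and I: "I \<subseteq> {t..}" "{t..} \<subseteq> closure I" and \<U>: "borel = sigma UNIV \<U>"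
    and eq: "\<And>l. set l \<subseteq> I \<times> \<U> \<Longrightarrow> measure P (cyl t l) = measure R (cyl t l)"
  shows "P = R"
proof -
  interpret P: prob_space P by (rule prob_measuresD) fact
  interpret R: prob_space R by (rule prob_measuresD) fact
  have sets: "sets P = sigma_sets (paths t) {cyl t l | l. set l \<subseteq> I \<times> \<U>}"
    "sets R = sigma_sets (paths t) {cyl t l | l. set l \<subseteq> I \<times> \<U>}"
    using prob_measuresD(2)[OF PR(1)] prob_measuresD(2)[OF PR(2)] sets_coord_sigma_dense[OF I]
      sets_coord_sigma_cyl[OF \<U>, of t I]
    by (auto simp: sets_borel_of_paths)
  have top: "cyl t [] = paths t" by (simp add: cyl_def)
  show ?thesis
  proof (rule measure_eqI_generator_eq[OF Int_stable_cyl _ _ sets, where A="\<lambda>_. paths t"])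
    show "{cyl t l |l. set l \<subseteq> I \<times> \<U>} \<subseteq> Pow (paths t)" by (auto simp: cyl_def)
    show "emeasure P X = emeasure R X" if "X \<in> {cyl t l |l. set l \<subseteq> I \<times> \<U>}" for X
      using that eq by (auto simp: P.emeasure_eq_measure R.emeasure_eq_measure)
    have "paths t = cyl t []" by (simp add: top)
    then show "range (\<lambda>_::nat. paths t) \<subseteq> {cyl t l |l. set l \<subseteq> I \<times> \<U>}"
      by (auto intro!: exI[of _ "[]"])
  qed auto
qed

lemma measure_cyl_tendsto:
  assumes P: "P \<in> prob_measures (paths_topology t :: (real \<Rightarrow> 'e) topology)"
    and l: "\<And>s U. (s, U) \<in> set l \<Longrightarrow> t \<le> s \<and> open U"
  shows "(\<lambda>n. \<integral>\<omega>. cyl_bump n l \<omega> \<partial>P) \<longlonglongrightarrow> measure P (cyl t l)"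
proof -
  interpret P: prob_space P by (rule prob_measuresD) fact
  note sp = prob_measuresD(2,3)[OF P, simplified]
  have m: "cyl t l \<in> sets P"
    using l by (auto simp: sp sets_borel_of_paths intro!: cyl_sets)
  have "(\<lambda>n. \<integral>\<omega>. cyl_bump n l \<omega> \<partial>P) \<longlonglongrightarrow> (\<integral>\<omega>. indicator (cyl t l) \<omega> \<partial>P)"
  proof (rule integral_dominated_convergence[where w="\<lambda>_. 1"])
    show "cyl_bump n l \<in> borel_measurable P" for n
      using continuous_map_borel_measurable[OF continuous_map_cyl_bump, of l t n] l
      by (auto cong: measurable_cong_sets simp: sp)
    show "AE \<omega> in P. (\<lambda>n. cyl_bump n l \<omega>) \<longlonglongrightarrow> indicator (cyl t l) \<omega>"
      using l by (intro AE_I2 cyl_bump_tendsto) (auto simp: sp)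
    show "AE \<omega> in P. norm (cyl_bump n l \<omega>) \<le> 1" for n
      using cyl_bump_bounds[of n l] by (auto simp: abs_le_iff intro: order_trans[of _ 0])
  qed (use m in auto)
  then show ?thesis using m by simp
qed

lemma continuous_map_integral_cyl_bump:
  assumes "\<And>s U. (s, U) \<in> set l \<Longrightarrow> t \<le> s"
  shows "continuous_map (path_law_space t :: (real \<Rightarrow> 'e) measure topology) euclideanreal (\<lambda>P. \<integral>\<omega>. cyl_bump n l \<omega> \<partial>P)"
proof (rule continuous_map_weak_integral)
  show "continuous_map (paths_topology t :: (real \<Rightarrow> 'e) topology) euclideanreal (cyl_bump n l)"
    using assms by (rule continuous_map_cyl_bump)
  show "bounded (cyl_bump n l ` topspace (paths_topology t))"
    using cyl_bump_bounds[of n l] by (auto simp: bounded_iff abs_le_iff intro!: exI[of _ 1] intro: order_trans[of _ 0])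
qed

text \<open>Links the Borel field of weak convergence with the one generated by evaluations of
  measures, where kernels can be integrated and composed. Probabilities of open cylinders, being
  limits of weakly continuous integrals, are enough.\<close>

lemma measurable_law_subprob:
  "(\<lambda>P. P) \<in> borel_of (path_law_space t :: (real \<Rightarrow> 'e) measure topology) \<rightarrow>\<^sub>M subprob_algebra (coord_sigma t {t..})"
proof (rule measurable_subprob_algebra_generated)
  show "sets (coord_sigma t {t..}) = sigma_sets (paths t) {cyl t l | l. set l \<subseteq> {t..} \<times> {U :: 'e set. open U}}"
    by (rule sets_coord_sigma_cyl) (simp add: borel_def)
  show "Int_stable {cyl t l |l. set l \<subseteq> {t..} \<times> {U :: 'e set. open U}}"
    by (rule Int_stable_cyl)
  show "subprob_space P" if "P \<in> space (borel_of (path_law_space t))" for P :: "(real \<Rightarrow> 'e) measure"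
    using that by (auto simp: prob_measures_def intro: prob_space_imp_subprob_space)
  show "sets P = sets (coord_sigma t {t..})" if "P \<in> space (borel_of (path_law_space t))" for P :: "(real \<Rightarrow> 'e) measure"
    using that by (auto simp: prob_measures_def sets_borel_of_paths)
  have *: "(\<lambda>P. emeasure P (cyl t l)) \<in> borel_measurable (borel_of (path_law_space t))"
    if l: "set l \<subseteq> {t..} \<times> {U :: 'e set. open U}" for l
  proof -
    have "(\<lambda>P. measure P (cyl t l)) \<in> borel_measurable (borel_of (path_law_space t))"
    proof (rule borel_measurable_LIMSEQ_metric)
      show "(\<lambda>P. \<integral>\<omega>. cyl_bump n l \<omega> \<partial>P) \<in> borel_measurable (borel_of (path_law_space t))" for n
        using l by (intro continuous_map_borel_measurable continuous_map_integral_cyl_bump) auto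
      show "(\<lambda>n. \<integral>\<omega>. cyl_bump n l \<omega> \<partial>P) \<longlonglongrightarrow> measure P (cyl t l)"
        if "P \<in> space (borel_of (path_law_space t))" for P
        using that l by (intro measure_cyl_tendsto) auto
    qed
    then have "(\<lambda>P. ennreal (measure P (cyl t l))) \<in> borel_measurable (borel_of (path_law_space t))"
      by measurable
    then show ?thesis
      by (subst measurable_cong[where g="\<lambda>P. ennreal (measure P (cyl t l))"])
        (auto dest!: prob_measuresD(1) intro!: finite_measure.emeasure_eq_measure simp: prob_space_def)
  qed
  then show "(\<lambda>P. emeasure P A) \<in> borel_measurable (borel_of (path_law_space t))"
    if "A \<in> {cyl t l |l. set l \<subseteq> {t..} \<times> {U :: 'e set. open U}}" for A
    using that by auto
  show "(\<lambda>P. emeasure P (paths t)) \<in> borel_measurable (borel_of (path_law_space t :: (real \<Rightarrow> 'e) measure topology))"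
    using *[of "[]"] by (simp add: cyl_def)
qed (auto simp: cyl_def)

text \<open>Serves the measurable selection of a maximizer. Countably many times, base sets and
  degrees of smoothing give countably many functions \<open>cyl_bump\<close>, whose integrals
  determine a law.\<close>

lemma countable_separating_functionals:
  "\<exists>G :: nat \<Rightarrow> (real \<Rightarrow> 'e) measure \<Rightarrow> real. (\<forall>k. continuous_map (path_law_space t) euclideanreal (G k)) \<and>
    (\<forall>P R. P \<in> prob_measures (paths_topology t) \<longrightarrow> R \<in> prob_measures (paths_topology t) \<longrightarrow> (\<forall>k. G k P = G k R) \<longrightarrow> P = R)"
proof -
  obtain \<U> :: "'e set set" where \<U>: "countable \<U>" "topological_basis \<U>"
    using ex_countable_basis_of_dense by blast
  obtain I where I: "countable I" "I \<subseteq> {t..}" "{t..} \<subseteq> closure I"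
    using separable[of "{t..}"] by metis
  define L where "L = (UNIV :: nat set) \<times> lists (I \<times> \<U>)"
  have "countable L"
    unfolding L_def using \<U>(1) I(1) by (intro countable_SIGMA countable_lists) auto
  have "L \<noteq> {}" by (auto simp: L_def)
  define G where "G k P = (\<integral>\<omega>. cyl_bump (fst (from_nat_into L k)) (snd (from_nat_into L k)) \<omega> \<partial>P)"
    for k and P :: "(real \<Rightarrow> 'e) measure"
  have open_\<U>: "open U" if "U \<in> \<U>" for U using that \<U>(2) by (rule topological_basis_open[rotated])
  show ?thesis
  proof (intro exI[of _ G] conjI allI impI)
    fix k
    have "from_nat_into L k \<in> L" using \<open>L \<noteq> {}\<close> by (rule from_nat_into)
    then show "continuous_map (path_law_space t) euclideanreal (G k)"
      unfolding G_def using I(2)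
      by (intro continuous_map_integral_cyl_bump) (fastforce simp: L_def in_lists_conv_set)
  next
    fix P R :: "(real \<Rightarrow> 'e) measure"
    assume PR: "P \<in> prob_measures (paths_topology t)" "R \<in> prob_measures (paths_topology t)" and eq: "\<forall>k. G k P = G k R"
    show "P = R"
    proof (rule laws_eqI[OF PR I(2,3)])
      show "borel = sigma UNIV \<U>" by (rule borel_eq_countable_basis) fact+
      fix l assume l: "set l \<subseteq> I \<times> \<U>"
      have "(\<integral>\<omega>. cyl_bump n l \<omega> \<partial>P) = (\<integral>\<omega>. cyl_bump n l \<omega> \<partial>R)" for n
      proof -
        have "(n, l) \<in> L" using l by (auto simp: L_def in_lists_conv_set)
        then obtain k where "from_nat_into L k = (n, l)"
          using from_nat_into_surj[OF \<open>countable L\<close>] by blast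
        then show ?thesis using eq[rule_format, of k] by (simp add: G_def)
      qed
      moreover have "t \<le> s \<and> open U" if "(s, U) \<in> set l" for s U
        using that l I(2) open_\<U> by auto
      ultimately show "measure P (cyl t l) = measure R (cyl t l)"
        using measure_cyl_tendsto[OF PR(1), of l] measure_cyl_tendsto[OF PR(2), of l]
        by (auto intro: LIMSEQ_unique)
    qed
  qed
qed

end

section \<open>Conditional kernels and reconstruction\<close>

lemma past_future_in_coord_sigma:
  assumes t: "0 \<le> t" and A: "A \<in> sets (coord_sigma 0 {0..t} :: (real \<Rightarrow> 'e::metric_space) measure)"
    and B: "B \<in> sets (coord_sigma t {t..})"
  shows "{\<omega> \<in> A. restrict \<omega> {t..} \<in> B} \<in> sets (coord_sigma 0 {0..})"
proof -
  have "A \<in> sets (coord_sigma 0 {0..})"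
    using A sets_coord_sigma_mono[of "{0..t}" "{0..}" 0] by auto
  moreover have "future_path t \<in> coord_sigma 0 {0..} \<rightarrow>\<^sub>M coord_sigma t {t..}"
    using t by (intro measurable_reparam time_change_future) auto
  then have "future_path t -` B \<inter> space (coord_sigma 0 {0..}) \<in> sets (coord_sigma 0 {0..})"
    using B by (rule measurable_sets)
  moreover have "{\<omega> \<in> A. restrict \<omega> {t..} \<in> B} = A \<inter> (future_path t -` B \<inter> space (coord_sigma 0 {0..}))"
    using sets.sets_into_space[OF A] by (auto simp: restrict_eq_future_path)
  ultimately show ?thesis by auto
qed

section \<open>Gluing a past and a future\<close>

text \<open>If the two pieces do not fit at time \<open>t\<close>, the result is
  \<open>\<omega>\<close> stopped at \<open>t\<close>. So it is a path in every case and jointly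
  measurable without exceptional set; the misfit has probability 0 under laws that start at
  \<open>\<omega> t\<close>.\<close>

definition glue :: "real \<Rightarrow> (real \<Rightarrow> 'e) \<Rightarrow> (real \<Rightarrow> 'e) \<Rightarrow> real \<Rightarrow> 'e" where
  "glue t \<omega> \<eta> = restrict (\<lambda>s. if \<eta> t = \<omega> t \<and> t < s then \<eta> s else \<omega> (min s t)) {0..}"

lemma glue_in_paths:
  assumes t: "0 \<le> t" and \<omega>: "\<omega> \<in> paths 0" and \<eta>: "\<eta> \<in> paths t"
  shows "glue t \<omega> \<eta> \<in> paths 0"
proof (cases "\<eta> t = \<omega> t")
  case True
  have "continuous_on ({0..t} \<union> {t..}) (\<lambda>s. if s \<le> t then \<omega> s else \<eta> s)"
    using paths_continuous[OF \<omega>] paths_continuous[OF \<eta>] True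
    by (intro continuous_on_If) (auto intro: continuous_on_subset)
  moreover have "{0..t} \<union> {t..} = {0..}" using t by auto
  ultimately have "restrict (\<lambda>s. if s \<le> t then \<omega> s else \<eta> s) {0..} \<in> paths 0"
    by (intro restrict_in_paths) simp
  also have "restrict (\<lambda>s. if s \<le> t then \<omega> s else \<eta> s) {0..} = glue t \<omega> \<eta>"
    using True by (auto simp: glue_def fun_eq_iff)
  finally show ?thesis .
next
  case False
  then have "glue t \<omega> \<eta> = stop_path t \<omega>" by (auto simp: glue_def reparam_def)
  then show ?thesis using reparam_in_paths[OF time_change_stop[OF t] \<omega>] by simp
qed

lemma conditional_kernel_space:
  assumes "Q \<in> coord_sigma 0 {0..t} \<rightarrow>\<^sub>M borel_of (path_law_space t)" "\<omega> \<in> paths 0"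
  shows "Q \<omega> \<in> prob_measures (paths_topology t)"
  using measurable_space[OF assms(1), of \<omega>] assms(2) by simp

context dense_sequence begin

lemma sets_law:
  "P \<in> prob_measures (paths_topology t :: (real \<Rightarrow> 'e) topology) \<Longrightarrow> sets P = sets (coord_sigma t {t..})"
  using prob_measuresD(2)[of P] by (simp add: sets_borel_of_paths)

lemma space_law: "P \<in> prob_measures (paths_topology t) \<Longrightarrow> space P = paths t"
  using prob_measuresD(3)[of P] by simp

lemma past_sets_law:
  assumes "P \<in> prob_measures (paths_topology 0 :: (real \<Rightarrow> 'e) topology)" "A \<in> sets (coord_sigma 0 {0..t})"
  shows "A \<in> sets P"
  using assms sets_coord_sigma_mono[of "{0..t}" "{0..}" 0] by (auto simp: sets_law)

lemma past_measurable_law: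
  assumes "P \<in> prob_measures (paths_topology 0 :: (real \<Rightarrow> 'e) topology)" "f \<in> coord_sigma 0 {0..t} \<rightarrow>\<^sub>M M"
  shows "f \<in> P \<rightarrow>\<^sub>M M"
proof -
  have "f \<in> coord_sigma 0 {0..} \<rightarrow>\<^sub>M M"
    by (rule measurable_coord_sigma_mono[OF _ assms(2)]) auto
  then show ?thesis
    using sets_law[OF assms(1)] by (simp cong: measurable_cong_sets)
qed

lemma measurable_kernel:
  assumes "Q \<in> coord_sigma 0 {0..t} \<rightarrow>\<^sub>M borel_of (path_law_space t :: (real \<Rightarrow> 'e) measure topology)"
  shows "Q \<in> coord_sigma 0 {0..t} \<rightarrow>\<^sub>M subprob_algebra (coord_sigma t {t..})"
  using measurable_compose[OF assms measurable_law_subprob] by simp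

lemma measurable_kernel_measure:
  assumes "Q \<in> coord_sigma 0 {0..t} \<rightarrow>\<^sub>M borel_of (path_law_space t :: (real \<Rightarrow> 'e) measure topology)"
    and "B \<in> sets (coord_sigma t {t..})"
  shows "(\<lambda>\<omega>. measure (Q \<omega>) B) \<in> borel_measurable (coord_sigma 0 {0..t})"
  by (rule measurable_compose[OF measurable_kernel[OF assms(1)] measurable_measure_subprob_algebra[OF assms(2)]])

lemma integral_eq_of_past:
  fixes f :: "(real \<Rightarrow> 'e) \<Rightarrow> real"
  assumes P: "P \<in> prob_measures (paths_topology 0)" and R: "R \<in> prob_measures (paths_topology 0)"
    and eq: "\<And>A. A \<in> sets (coord_sigma 0 {0..t}) \<Longrightarrow> measure R A = measure P A"
    and f: "f \<in> borel_measurable (coord_sigma 0 {0..t})"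
  shows "(\<integral>\<omega>. f \<omega> \<partial>R) = (\<integral>\<omega>. f \<omega> \<partial>P)"
proof -
  let ?B = "coord_sigma 0 {0..t} :: (real \<Rightarrow> 'e) measure"
  interpret P: prob_space P by (rule prob_measuresD) fact
  interpret R: prob_space R by (rule prob_measuresD) fact
  have mP: "(\<lambda>\<omega>. \<omega>) \<in> P \<rightarrow>\<^sub>M ?B"
    by (rule past_measurable_law[OF P, where t=t]) simp
  have mR: "(\<lambda>\<omega>. \<omega>) \<in> R \<rightarrow>\<^sub>M ?B"
    by (rule past_measurable_law[OF R, where t=t]) simp
  have id: "A \<inter> paths 0 = A" if "A \<in> sets ?B" for A
    using sets.sets_into_space[OF that] by auto
  \<comment> \<open>The trace of a law on the past field is its image under the identity into that
    coarser field.\<close>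
  have "distr R ?B (\<lambda>\<omega>. \<omega>) = distr P ?B (\<lambda>\<omega>. \<omega>)"
  proof (rule measure_eqI)
    fix A assume "A \<in> sets (distr R ?B (\<lambda>\<omega>. \<omega>))"
    then have A: "A \<in> sets ?B" by simp
    show "emeasure (distr R ?B (\<lambda>\<omega>. \<omega>)) A = emeasure (distr P ?B (\<lambda>\<omega>. \<omega>)) A"
      using A mP mR eq[OF A]
      by (simp add: emeasure_distr id space_law[OF P] space_law[OF R] P.emeasure_eq_measure R.emeasure_eq_measure)
  qed simp
  then have "(\<integral>\<omega>. f \<omega> \<partial>distr R ?B (\<lambda>\<omega>. \<omega>)) = (\<integral>\<omega>. f \<omega> \<partial>distr P ?B (\<lambda>\<omega>. \<omega>))" by simp
  then show ?thesis
    using integral_distr[OF mP f] integral_distr[OF mR f] by simp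
qed

text \<open>A kernel is defined by its action on events. Read with the sure event as past event,
  this says that the law of the future is the mixture \<open>P \<bind> Q\<close>, which extends to
  bounded functions.\<close>

lemma integral_conditional_kernel:
  fixes F :: "(real \<Rightarrow> 'e) \<Rightarrow> real"
  assumes t: "0 \<le> t" and P: "P \<in> prob_measures (paths_topology 0)" and Q: "conditional_kernel P t Q"
    and F: "F \<in> borel_measurable (coord_sigma t {t..})" "\<And>\<eta>. \<eta> \<in> paths t \<Longrightarrow> \<bar>F \<eta>\<bar> \<le> C"
  shows "(\<integral>\<omega>. F (future_path t \<omega>) \<partial>P) = (\<integral>\<omega>. (\<integral>\<eta>. F \<eta> \<partial>Q \<omega>) \<partial>P)"
proof -
  interpret P: prob_space P by (rule prob_measuresD) fact
  have Qm: "Q \<in> coord_sigma 0 {0..t} \<rightarrow>\<^sub>M borel_of (path_law_space t)"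
    using Q by (simp add: conditional_kernel_def)
  have QP: "Q \<in> P \<rightarrow>\<^sub>M subprob_algebra (coord_sigma t {t..})"
    by (rule past_measurable_law[OF P measurable_kernel[OF Qm]])
  have Qpr: "Q \<omega> \<in> prob_measures (paths_topology t)" if "\<omega> \<in> space P" for \<omega>
    using conditional_kernel_space[OF Qm] that by (simp add: space_law[OF P])
  have fut: "future_path t \<in> P \<rightarrow>\<^sub>M coord_sigma t {t..}"
    using measurable_reparam[OF time_change_future[OF t], of "{t..}" "{0..}"] t sets_law[OF P]
    by (auto cong: measurable_cong_sets)
  have "distr P (coord_sigma t {t..}) (future_path t) = P \<bind> Q"
  proof (rule measure_eqI)
    show "sets (distr P (coord_sigma t {t..}) (future_path t)) = sets (P \<bind> Q)"
      using Qpr P.not_empty by (subst sets_bind[where N="coord_sigma t {t..}"]) (auto simp: sets_law)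
    fix B assume "B \<in> sets (distr P (coord_sigma t {t..}) (future_path t))"
    then have B: "B \<in> sets (coord_sigma t {t..})" by simp
    have "emeasure (distr P (coord_sigma t {t..}) (future_path t)) B = measure P {\<omega> \<in> paths 0. restrict \<omega> {t..} \<in> B}"
      using fut B by (auto simp: emeasure_distr P.emeasure_eq_measure space_law[OF P] restrict_eq_future_path
          intro!: arg_cong[where f="measure P"])
    also have "measure P {\<omega> \<in> paths 0. restrict \<omega> {t..} \<in> B} = (\<integral>\<omega>\<in>paths 0. measure (Q \<omega>) B \<partial>P)"
      using Q B sets.top[of "coord_sigma 0 {0..t}"] unfolding conditional_kernel_def by auto
    also have "\<dots> = (\<integral>\<omega>. measure (Q \<omega>) B \<partial>P)"
      using set_integral_space[of P "\<lambda>\<omega>. measure (Q \<omega>) B"]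
        P.integrable_const_bound[where B=1]
      unfolding set_lebesgue_integral_def
      by (intro Bochner_Integration.integral_cong) (auto simp: space_law[OF P])
    also have "\<dots> = measure (P \<bind> Q) B"
      using P.measure_bind[OF QP B] by simp
    also have "ennreal \<dots> = emeasure (P \<bind> Q) B"
    proof -
      interpret PQ: subprob_space "P \<bind> Q"
        by (rule subprob_space_bind[OF _ QP]) (rule P.subprob_space_axioms)
      show ?thesis by (simp add: PQ.emeasure_eq_measure)
    qed
    finally show "emeasure (distr P (coord_sigma t {t..}) (future_path t)) B = emeasure (P \<bind> Q) B" .
  qed
  moreover have "(\<integral>\<eta>. F \<eta> \<partial>(P \<bind> Q)) = (\<integral>\<omega>. (\<integral>\<eta>. F \<eta> \<partial>Q \<omega>) \<partial>P)"
  proof (rule integral_bind[OF F(1) _ QP P.finite_measure_axioms])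
    show "\<bar>F \<eta>\<bar> \<le> C" if "\<eta> \<in> space (coord_sigma t {t..})" for \<eta> using F(2) that by simp
    show "AE \<omega> in P. emeasure (Q \<omega>) (space (Q \<omega>)) \<le> ennreal 1"
      using prob_space.emeasure_space_1[OF prob_measuresD(1)[OF Qpr]] by (intro AE_I2) simp
  qed
  ultimately show ?thesis
    using integral_distr[OF fut F(1)] by simp
qed

lemma measurable_glue:
  assumes t: "0 \<le> t"
  shows "(\<lambda>(\<omega>, \<eta>). glue t \<omega> \<eta>) \<in> coord_sigma 0 {0..t} \<Otimes>\<^sub>M coord_sigma t {t..} \<rightarrow>\<^sub>M (coord_sigma 0 {0..} :: (real \<Rightarrow> 'e) measure)"
    (is "_ \<in> ?M \<rightarrow>\<^sub>M _")
proof (rule measurable_coord_sigma)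
  show "(\<lambda>(\<omega>, \<eta>). glue t \<omega> \<eta>) \<in> space ?M \<rightarrow> paths 0"
    using glue_in_paths[OF t] by (auto simp: space_pair_measure)
  fix s :: real assume "s \<in> {0..}"
  have \<omega>m: "(\<lambda>x. fst x r) \<in> ?M \<rightarrow>\<^sub>M borel" if "0 \<le> r" "r \<le> t" for r
    using that by (intro measurable_compose[OF measurable_fst] measurable_coord) auto
  have \<eta>m: "(\<lambda>x. snd x r) \<in> ?M \<rightarrow>\<^sub>M borel" if "t \<le> r" for r
    using that by (intro measurable_compose[OF measurable_snd] measurable_coord) auto
  have dist_m: "(\<lambda>y. dist y (a k)) \<in> borel_measurable borel" for k
    by (intro borel_measurable_continuous_onI continuous_intros)
  \<comment> \<open>Distances to the dense sequence separate points; this writes the diagonal as a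
    countable intersection, which the product field can measure.\<close>
  have eq_iff: "y = z \<longleftrightarrow> (\<forall>k. dist y (a k) = dist z (a k))" for y z
  proof
    assume *: "\<forall>k. dist y (a k) = dist z (a k)"
    have "dist y z \<le> e" if e: "0 < e" for e
    proof -
      obtain k where "dist y (a k) < e / 2" using dense[of "e / 2" y] e by auto
      then show ?thesis using * dist_triangle2[of y z "a k"] by (smt (verit) field_sum_of_halves)
    qed
    then have "dist y z \<le> 0" by (rule field_le_epsilon) (simp)
    then show "y = z" by simp
  qed simp
  have [measurable]: "Measurable.pred ?M (\<lambda>x. snd x t = fst x t)"
    unfolding eq_iff
  proof (intro pred_intros_countable(1) pred_eq_const2)
    fix k
    have [measurable]: "(\<lambda>x. dist (fst x t) (a k)) \<in> borel_measurable ?M"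
      using measurable_compose[OF \<omega>m dist_m] t by simp
    have [measurable]: "(\<lambda>x. dist (snd x t) (a k)) \<in> borel_measurable ?M"
      using measurable_compose[OF \<eta>m dist_m] by simp
    show "Measurable.pred ?M (\<lambda>x. dist (snd x t) (a k) = dist (fst x t) (a k))"
      by measurable
  qed
  show "(\<lambda>x. (case x of (\<omega>, \<eta>) \<Rightarrow> glue t \<omega> \<eta>) s) \<in> ?M \<rightarrow>\<^sub>M borel"
  proof (cases "t < s")
    case True
    have [measurable]: "(\<lambda>x. snd x s) \<in> ?M \<rightarrow>\<^sub>M borel" "(\<lambda>x. fst x t) \<in> ?M \<rightarrow>\<^sub>M borel"
      using \<eta>m[of s] \<omega>m[of t] True t by auto
    have "(\<lambda>x. if snd x t = fst x t then snd x s else fst x t) \<in> ?M \<rightarrow>\<^sub>M borel"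
      by measurable
    then show ?thesis
      using True t by (simp add: glue_def case_prod_beta cong: if_cong)
  next
    case False
    then show ?thesis
      using \<omega>m[of s] \<open>s \<in> {0..}\<close> by (simp add: glue_def case_prod_beta)
  qed
qed

lemma starts_at_AE:
  assumes "Q \<in> prob_measures (paths_topology t :: (real \<Rightarrow> 'e) topology)" "starts_at t x Q"
  shows "AE \<eta> in Q. \<eta> t = x"
proof -
  interpret prob_space Q by (rule prob_measuresD) fact
  have "AE \<eta> in Q. \<eta> \<in> {\<eta> \<in> paths t. \<eta> t = x}"
    using assms(2) AE_prob_1[of "{\<eta> \<in> paths t. \<eta> t = x}"] by (simp add: starts_at_def)
  then show ?thesis by auto
qed

text \<open>Draw \<open>\<omega>\<close> from \<open>P\<close>, a future from
  \<open>Q \<omega>\<close>, and glue. Together with uniqueness this gives the definite description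
  in \<open>reconstruction\<close> its meaning.\<close>

lemma reconstruction_exists:
  assumes t: "0 \<le> t" and P: "P \<in> prob_measures (paths_topology 0 :: (real \<Rightarrow> 'e) topology)"
    and Q: "Q \<in> coord_sigma 0 {0..t} \<rightarrow>\<^sub>M borel_of (path_law_space t)"
    and start: "AE \<omega> in P. starts_at t (\<omega> t) (Q \<omega>)"
  shows "\<exists>R. R \<in> prob_measures (paths_topology 0) \<and>
    (\<forall>A\<in>sets (coord_sigma 0 {0..t}). measure R A = measure P A) \<and> conditional_kernel R t Q"
proof -
  interpret P: prob_space P by (rule prob_measuresD) fact
  let ?B = "coord_sigma 0 {0..t} :: (real \<Rightarrow> 'e) measure"
  define \<kappa> where "\<kappa> \<omega> = distr (Q \<omega>) (coord_sigma 0 {0..}) (glue t \<omega>)" for \<omega>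
  have Qpr: "Q \<omega> \<in> prob_measures (paths_topology t)" if "\<omega> \<in> paths 0" for \<omega>
    using conditional_kernel_space[OF Q that] .
  have \<kappa>: "\<kappa> \<in> P \<rightarrow>\<^sub>M subprob_algebra (coord_sigma 0 {0..})"
    unfolding \<kappa>_def
    by (rule past_measurable_law[OF P measurable_distr2[OF measurable_glue[OF t] measurable_kernel[OF Q]]])
  have glue_m: "glue t \<omega> \<in> Q \<omega> \<rightarrow>\<^sub>M coord_sigma 0 {0..}" if "\<omega> \<in> paths 0" for \<omega>
    using measurable_Pair2[OF measurable_glue[OF t], of \<omega>] that sets_law[OF Qpr[OF that]]
    by (auto cong: measurable_cong_sets)
  define R where "R = P \<bind> \<kappa>"
  have "prob_space R"
    unfolding R_def
  proof (rule P.prob_space_bind[OF _ \<kappa>], rule AE_I2)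
    fix \<omega> assume "\<omega> \<in> space P"
    then have \<omega>: "\<omega> \<in> paths 0" by (simp add: space_law[OF P])
    show "prob_space (\<kappa> \<omega>)"
      unfolding \<kappa>_def by (rule prob_space.prob_space_distr[OF prob_measuresD(1)[OF Qpr[OF \<omega>]] glue_m[OF \<omega>]])
  qed
  moreover have "sets R = sets (coord_sigma 0 {0..})"
    unfolding R_def using P.not_empty by (intro sets_bind) (auto simp: \<kappa>_def)
  ultimately have R: "R \<in> prob_measures (paths_topology 0)"
    by (simp add: prob_measures_def sets_borel_of_paths)
  interpret R: prob_space R by fact
  have key: "measure R {\<omega> \<in> A. restrict \<omega> {t..} \<in> C} = (\<integral>\<omega>\<in>A. measure (Q \<omega>) C \<partial>P)"
    if A: "A \<in> sets ?B" and C: "C \<in> sets (coord_sigma t {t..})" for A C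
  proof -
    have E: "{\<omega> \<in> A. restrict \<omega> {t..} \<in> C} \<in> sets (coord_sigma 0 {0..})" (is "?E \<in> _")
      by (rule past_future_in_coord_sigma[OF t A C])
    have "measure R ?E = (\<integral>\<omega>. measure (\<kappa> \<omega>) ?E \<partial>P)"
      unfolding R_def by (rule P.measure_bind[OF \<kappa> E])
    also have "\<dots> = (\<integral>\<omega>. indicator A \<omega> * measure (Q \<omega>) C \<partial>P)"
    proof (rule integral_cong_AE)
      show "(\<lambda>\<omega>. measure (\<kappa> \<omega>) ?E) \<in> borel_measurable P"
        by (rule measurable_compose[OF \<kappa> measurable_measure_subprob_algebra[OF E]])
      show "(\<lambda>\<omega>. indicator A \<omega> * measure (Q \<omega>) C) \<in> borel_measurable P"
        using past_measurable_law[OF P measurable_kernel_measure[OF Q C]] past_sets_law[OF P A] by measurable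
      show "AE \<omega> in P. measure (\<kappa> \<omega>) ?E = indicator A \<omega> * measure (Q \<omega>) C"
        using start
      proof (rule AE_mp, intro AE_I2 impI)
        fix \<omega> assume "\<omega> \<in> space P" and st: "starts_at t (\<omega> t) (Q \<omega>)"
        then have \<omega>: "\<omega> \<in> paths 0" by (simp add: space_law[OF P])
        interpret Q: prob_space "Q \<omega>" using prob_measuresD(1)[OF Qpr[OF \<omega>]] .
        \<comment> \<open>Only futures that fit count: the glued path then has the past of
          \<open>\<omega>\<close>, which decides \<open>A\<close>, and exactly the future
          \<open>\<eta>\<close>, which decides \<open>C\<close>.\<close>
        have iff: "glue t \<omega> \<eta> \<in> ?E \<longleftrightarrow> \<omega> \<in> A \<and> \<eta> \<in> C" if \<eta>: "\<eta> \<in> paths t" "\<eta> t = \<omega> t" for \<eta>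
        proof -
          have g: "glue t \<omega> \<eta> \<in> paths 0" by (rule glue_in_paths[OF t \<omega> \<eta>(1)])
          have glue_eq: "glue t \<omega> \<eta> s = (if s \<le> t then \<omega> s else \<eta> s)" if "0 \<le> s" for s
            using \<eta>(2) that by (simp add: glue_def)
          have "glue t \<omega> \<eta> \<in> A \<longleftrightarrow> \<omega> \<in> A"
            by (rule coord_sigma_depends[OF A g \<omega>]) (simp add: glue_eq)
          moreover have "restrict (glue t \<omega> \<eta>) {t..} = \<eta>"
          proof (rule paths_eqI[OF _ \<eta>(1)])
            show "restrict (glue t \<omega> \<eta>) {t..} \<in> paths t"
              unfolding restrict_eq_future_path by (rule reparam_in_paths[OF time_change_future[OF t] g])
            fix s assume "t \<le> s"
            then show "restrict (glue t \<omega> \<eta>) {t..} s = \<eta> s"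
              using t \<eta>(2) by (cases "s = t") (simp_all add: glue_eq)
          qed
          ultimately show ?thesis by simp
        qed
        have "measure (\<kappa> \<omega>) ?E = measure (Q \<omega>) (glue t \<omega> -` ?E \<inter> space (Q \<omega>))"
          unfolding \<kappa>_def by (rule measure_distr[OF glue_m[OF \<omega>] E])
        also have "\<dots> = measure (Q \<omega>) (if \<omega> \<in> A then C else {})"
        proof (rule Q.finite_measure_eq_AE)
          show "AE \<eta> in Q \<omega>. (\<eta> \<in> glue t \<omega> -` ?E \<inter> space (Q \<omega>)) = (\<eta> \<in> (if \<omega> \<in> A then C else {}))"
            using starts_at_AE[OF Qpr[OF \<omega>] st] AE_space
          proof eventually_elim
            fix \<eta> assume "\<eta> t = \<omega> t" "\<eta> \<in> space (Q \<omega>)"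
            then show "(\<eta> \<in> glue t \<omega> -` ?E \<inter> space (Q \<omega>)) = (\<eta> \<in> (if \<omega> \<in> A then C else {}))"
              using iff[of \<eta>] space_law[OF Qpr[OF \<omega>]] by auto
          qed
          show "glue t \<omega> -` ?E \<inter> space (Q \<omega>) \<in> sets (Q \<omega>)"
            by (rule measurable_sets[OF glue_m[OF \<omega>] E])
        qed (use C sets_law[OF Qpr[OF \<omega>]] in auto)
        finally show "measure (\<kappa> \<omega>) ?E = indicator A \<omega> * measure (Q \<omega>) C"
          by (auto simp: indicator_def)
      qed
    qed
    finally show ?thesis by (simp add: set_lebesgue_integral_def)
  qed
  have agree: "measure R A = measure P A" if A: "A \<in> sets ?B" for A
  proof -
    have A': "A \<subseteq> paths 0" using sets.sets_into_space[OF A] by simp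
    have "{\<omega> \<in> A. restrict \<omega> {t..} \<in> paths t} = A"
      using A' reparam_in_paths[OF time_change_future[OF t]] by (auto simp: restrict_eq_future_path)
    then have "measure R A = (\<integral>\<omega>\<in>A. measure (Q \<omega>) (paths t) \<partial>P)"
      using key[OF A sets.top] by simp
    also have "\<dots> = (\<integral>\<omega>. indicator A \<omega> \<partial>P)"
      unfolding set_lebesgue_integral_def
    proof (rule Bochner_Integration.integral_cong)
      fix \<omega> assume "\<omega> \<in> space P"
      then have \<omega>: "\<omega> \<in> paths 0" by (simp add: space_law[OF P])
      show "indicator A \<omega> *\<^sub>R measure (Q \<omega>) (paths t) = indicator A \<omega>"
        using prob_space.prob_space[OF prob_measuresD(1)[OF Qpr[OF \<omega>]]] space_law[OF Qpr[OF \<omega>]] by simp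
    qed simp
    also have "\<dots> = measure P A"
      using past_sets_law[OF P A] by simp
    finally show ?thesis .
  qed
  \<comment> \<open>The kernel identity is asked with integrals over \<open>R\<close>; they are
    those over \<open>P\<close>, because the integrand depends on the past and the two laws agree
    there.\<close>
  have "conditional_kernel R t Q"
    unfolding conditional_kernel_def
  proof (intro conjI Q ballI)
    fix A C assume A: "A \<in> sets ?B" and C: "C \<in> sets (coord_sigma t {t..} :: (real \<Rightarrow> 'e) measure)"
    have "(\<lambda>\<omega>. indicator A \<omega> *\<^sub>R measure (Q \<omega>) C) \<in> borel_measurable ?B"
      using measurable_kernel_measure[OF Q C] A by measurable
    from integral_eq_of_past[OF P R agree this]
    show "measure R {\<omega> \<in> A. restrict \<omega> {t..} \<in> C} = (\<integral>\<omega>\<in>A. measure (Q \<omega>) C \<partial>R)"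
      unfolding key[OF A C] set_lebesgue_integral_def by simp
  qed
  with R agree show ?thesis by blast
qed

text \<open>Events that combine a past event with a future event are a generating \<pi>-system, and
  their probabilities are integrals, over the past, of the common kernel.\<close>

lemma reconstruction_unique:
  assumes t: "0 \<le> t" and P: "P \<in> prob_measures (paths_topology 0 :: (real \<Rightarrow> 'e) topology)"
    and R: "R \<in> prob_measures (paths_topology 0)"
    and agree: "\<And>A. A \<in> sets (coord_sigma 0 {0..t}) \<Longrightarrow> measure R A = measure P A"
    and RQ: "conditional_kernel R t Q" and PQ: "conditional_kernel P t Q"
  shows "R = P"
proof -
  interpret P: prob_space P by (rule prob_measuresD) fact
  interpret R: prob_space R by (rule prob_measuresD) fact
  let ?B = "coord_sigma 0 {0..t} :: (real \<Rightarrow> 'e) measure" and ?C = "coord_sigma t {t..} :: (real \<Rightarrow> 'e) measure"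
  let ?G = "{{\<omega> \<in> A. restrict \<omega> {t..} \<in> C} | A C. A \<in> sets ?B \<and> C \<in> sets ?C}"
  have G: "?G \<subseteq> Pow (paths 0)"
    using sets.sets_into_space[of _ ?B] by auto
  have fut: "restrict \<omega> {t..} \<in> paths t" if "\<omega> \<in> paths 0" for \<omega> :: "real \<Rightarrow> 'e"
    using reparam_in_paths[OF time_change_future[OF t] that] by (simp add: restrict_eq_future_path)
  have topG: "paths 0 \<in> ?G"
    using fut sets.top[of ?B] sets.top[of ?C] by (intro CollectI exI[of _ "paths 0"] exI[of _ "paths t"]) auto
  have gen: "sets (coord_sigma 0 {0..}) = sigma_sets (paths 0) ?G"
  proof
    have "(\<lambda>\<omega>. \<omega>) \<in> sigma (paths 0) ?G \<rightarrow>\<^sub>M coord_sigma 0 {0..}"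
    proof (rule measurable_coord_sigma)
      fix s :: real assume s: "s \<in> {0..}"
      show "(\<lambda>\<omega>. \<omega> s) \<in> sigma (paths 0) ?G \<rightarrow>\<^sub>M borel"
      proof (rule measurableI)
        fix X :: "'e set" assume X: "X \<in> sets borel"
        have "{\<omega> \<in> paths 0. \<omega> s \<in> X} \<in> ?G"
        \<comment> \<open>A condition on a coordinate up to \<open>t\<close> is a past event with
          trivial future, one on a later coordinate a future event with trivial past.\<close>
        proof (cases "s \<le> t")
          case True
          then have "(\<lambda>\<omega>. \<omega> s) -` X \<inter> space ?B \<in> sets ?B"
            using s X by (intro measurable_sets[OF measurable_coord]) auto
          also have "(\<lambda>\<omega>. \<omega> s) -` X \<inter> space ?B = {\<omega> \<in> paths 0. \<omega> s \<in> X}" by auto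
          finally show ?thesis
            using fut sets.top[of ?C]
            by (intro CollectI exI[of _ "{\<omega> \<in> paths 0. \<omega> s \<in> X}"] exI[of _ "paths t"]) auto
        next
          case False
          then have "(\<lambda>\<omega>. \<omega> s) -` X \<inter> space ?C \<in> sets ?C"
            using X by (intro measurable_sets[OF measurable_coord]) auto
          also have "(\<lambda>\<omega>. \<omega> s) -` X \<inter> space ?C = {\<omega> \<in> paths t. \<omega> s \<in> X}" by auto
          finally show ?thesis
            using fut sets.top[of ?B] False
            by (intro CollectI exI[of _ "paths 0"] exI[of _ "{\<omega> \<in> paths t. \<omega> s \<in> X}"]) auto
        qed
        then have "{\<omega> \<in> paths 0. \<omega> s \<in> X} \<in> sigma_sets (paths 0) ?G" by (rule sigma_sets.Basic)
        moreover have "(\<lambda>\<omega>. \<omega> s) -` X \<inter> paths 0 = {\<omega> \<in> paths 0. \<omega> s \<in> X}" by auto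
        ultimately show "(\<lambda>\<omega>. \<omega> s) -` X \<inter> space (sigma (paths 0) ?G) \<in> sets (sigma (paths 0) ?G)"
          by (simp only: space_measure_of[OF G] sets_measure_of[OF G])
      qed simp
    qed (simp add: space_measure_of[OF G])
    then have m: "(\<lambda>\<omega>. \<omega>) -` A \<inter> paths 0 \<in> sigma_sets (paths 0) ?G" if "A \<in> sets (coord_sigma 0 {0..})" for A
      using measurable_sets[of "\<lambda>\<omega>. \<omega>" "sigma (paths 0) ?G" "coord_sigma 0 {0..}" A] that
      by (simp only: space_measure_of[OF G] sets_measure_of[OF G])
    show "sets (coord_sigma 0 {0..}) \<subseteq> sigma_sets (paths 0) ?G"
    proof
      fix A :: "(real \<Rightarrow> 'e) set" assume A: "A \<in> sets (coord_sigma 0 {0..})"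
      then have "A \<subseteq> paths 0" using sets.sets_into_space by fastforce
      then have "(\<lambda>\<omega>. \<omega>) -` A \<inter> paths 0 = A" by auto
      with m[OF A] show "A \<in> sigma_sets (paths 0) ?G" by simp
    qed
    show "sigma_sets (paths 0) ?G \<subseteq> sets (coord_sigma 0 {0..})"
      using past_future_in_coord_sigma[OF t]
      by (intro sets.sigma_sets_subset[of _ "coord_sigma 0 {0..}", unfolded space_coord_sigma]) blast
  qed
  show ?thesis
  proof (rule measure_eqI_generator_eq[where E="?G" and \<Omega>="paths 0" and A="\<lambda>_. paths 0"])
    show "Int_stable ?G"
    proof (rule Int_stableI)
      fix X Y assume "X \<in> ?G" "Y \<in> ?G"
      then obtain A C A' C' where *: "X = {\<omega> \<in> A. restrict \<omega> {t..} \<in> C}" "A \<in> sets ?B" "C \<in> sets ?C"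
        "Y = {\<omega> \<in> A'. restrict \<omega> {t..} \<in> C'}" "A' \<in> sets ?B" "C' \<in> sets ?C" by blast
      then have "X \<inter> Y = {\<omega> \<in> A \<inter> A'. restrict \<omega> {t..} \<in> C \<inter> C'}" by blast
      moreover have "A \<inter> A' \<in> sets ?B" "C \<inter> C' \<in> sets ?C" using * by auto
      ultimately show "X \<inter> Y \<in> ?G" by blast
    qed
    show "sets R = sigma_sets (paths 0) ?G" "sets P = sigma_sets (paths 0) ?G"
      unfolding gen[symmetric] by (rule sets_law; fact)+
    show "range (\<lambda>_::nat. paths 0) \<subseteq> ?G" using topG by blast
    fix X assume "X \<in> ?G"
    then obtain A C where X: "X = {\<omega> \<in> A. restrict \<omega> {t..} \<in> C}" "A \<in> sets ?B" "C \<in> sets ?C" by blast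
    have Q: "Q \<in> ?B \<rightarrow>\<^sub>M borel_of (path_law_space t)" using PQ by (simp add: conditional_kernel_def)
    have "(\<lambda>\<omega>. indicator A \<omega> *\<^sub>R measure (Q \<omega>) C) \<in> borel_measurable ?B"
      using measurable_kernel_measure[OF Q X(3)] X(2) by measurable
    from integral_eq_of_past[OF P R agree this] have "measure R X = measure P X"
      using RQ PQ X unfolding conditional_kernel_def set_lebesgue_integral_def by auto
    then show "emeasure R X = emeasure P X"
      by (simp add: P.emeasure_eq_measure R.emeasure_eq_measure)
  qed (use G in auto)
qed

lemma reconstruction_properties:
  assumes t: "0 \<le> t" and P: "P \<in> prob_measures (paths_topology 0 :: (real \<Rightarrow> 'e) topology)"
    and Q: "Q \<in> coord_sigma 0 {0..t} \<rightarrow>\<^sub>M borel_of (path_law_space t)"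
    and start: "AE \<omega> in P. starts_at t (\<omega> t) (Q \<omega>)"
  shows "reconstruction P t Q \<in> prob_measures (paths_topology 0)"
    "\<And>A. A \<in> sets (coord_sigma 0 {0..t}) \<Longrightarrow> measure (reconstruction P t Q) A = measure P A"
    "conditional_kernel (reconstruction P t Q) t Q"
proof -
  obtain R where R: "R \<in> prob_measures (paths_topology 0)"
    "\<forall>A\<in>sets (coord_sigma 0 {0..t}). measure R A = measure P A" "conditional_kernel R t Q"
    using reconstruction_exists[OF assms] by blast
  have "reconstruction P t Q \<in> prob_measures (paths_topology 0) \<and>
    (\<forall>A\<in>sets (coord_sigma 0 {0..t}). measure (reconstruction P t Q) A = measure P A) \<and>
    conditional_kernel (reconstruction P t Q) t Q"
    unfolding reconstruction_def
  proof (rule theI[of _ R])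
    fix S assume S: "S \<in> prob_measures (paths_topology 0) \<and>
      (\<forall>A\<in>sets (coord_sigma 0 {0..t}). measure S A = measure P A) \<and> conditional_kernel S t Q"
    then show "S = R"
      using R by (intro reconstruction_unique[OF t R(1)]) auto
  qed (use R in blast)
  then show "reconstruction P t Q \<in> prob_measures (paths_topology 0)"
    "\<And>A. A \<in> sets (coord_sigma 0 {0..t}) \<Longrightarrow> measure (reconstruction P t Q) A = measure P A"
    "conditional_kernel (reconstruction P t Q) t Q"
    by auto
qed

end

section \<open>Measurable correspondences\<close>

text \<open>Measurability through the closed sets that are hit: in this form it passes to maximizers
  and to decreasing intersections by direct compactness arguments.\<close>

definition measurable_correspondence :: "'a topology \<Rightarrow> 'x measure \<Rightarrow> ('x \<Rightarrow> 'a set) \<Rightarrow> bool" where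
  "measurable_correspondence X M K \<longleftrightarrow> (\<forall>x\<in>space M. K x \<in> compacts X) \<and>
     (\<forall>F. closedin X F \<longrightarrow> {x \<in> space M. K x \<inter> F \<noteq> {}} \<in> sets M)"

text \<open>The objective may depend on the parameter x, as the distance of the initial state from
  \<iota> x does.\<close>

definition argmax :: "('x \<Rightarrow> 'a \<Rightarrow> real) \<Rightarrow> ('x \<Rightarrow> 'a set) \<Rightarrow> 'x \<Rightarrow> 'a set" where
  "argmax g K x = {P \<in> K x. \<forall>R\<in>K x. g x R \<le> g x P}"

lemma compactin_attains_sup:
  assumes "compactin X S" "S \<noteq> {}" "continuous_map X euclideanreal g"
  shows "\<exists>P\<in>S. \<forall>R\<in>S. g R \<le> g P"
proof -
  have "compact (g ` S)"
    using image_compactin[OF assms(1,3)] by simp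
  from compact_attains_sup[OF this] assms(2) show ?thesis by auto
qed

text \<open>A closed \<open>F\<close> meets the maximizers exactly when it meets \<open>K x\<close>
  and the maximum over \<open>K x \<inter> F\<close> reaches that over \<open>K x\<close>. Both
  maxima are attained, so rational levels \<open>q\<close> suffice to compare them.\<close>

lemma measurable_correspondence_argmax:
  assumes K: "measurable_correspondence X M K"
    and g: "\<And>x. x \<in> space M \<Longrightarrow> continuous_map X euclideanreal (g x)"
    and meas: "\<And>F q. closedin X F \<Longrightarrow> {x \<in> space M. \<exists>P\<in>K x \<inter> F. q \<le> g x P} \<in> sets M"
  shows "measurable_correspondence X M (argmax g K)"
  unfolding measurable_correspondence_def
proof (intro conjI ballI allI impI)
  have comp: "compactin X (K x)" "K x \<noteq> {}" if "x \<in> space M" for x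
    using K that by (auto simp: measurable_correspondence_def compacts_def)
  fix x assume x: "x \<in> space M"
  obtain P where P: "P \<in> K x" "\<forall>R\<in>K x. g x R \<le> g x P"
    using compactin_attains_sup[OF comp[OF x] g[OF x]] by blast
  have "closedin X {R \<in> topspace X. g x P \<le> g x R}"
    using g[OF x] by (simp add: continuous_map_upper_lower_semicontinuous_le)
  then have "compactin X (K x \<inter> {R \<in> topspace X. g x P \<le> g x R})"
    by (rule compact_Int_closedin[OF comp(1)[OF x]])
  moreover have "K x \<inter> {R \<in> topspace X. g x P \<le> g x R} = argmax g K x"
    using P compactin_subset_topspace[OF comp(1)[OF x]] by (auto simp: argmax_def intro: order_trans)
  ultimately show "argmax g K x \<in> compacts X"
    using P by (auto simp: compacts_def argmax_def)
next
  have comp: "compactin X (K x)" if "x \<in> space M" for x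
    using K that by (auto simp: measurable_correspondence_def compacts_def)
  fix F assume F: "closedin X F"
  let ?E = "\<lambda>A q x. \<exists>P\<in>K x \<inter> A. q \<le> g x P"
  have "{x \<in> space M. argmax g K x \<inter> F \<noteq> {}} =
      {x \<in> space M. K x \<inter> F \<noteq> {} \<and> (\<forall>q\<in>\<rat>. ?E (topspace X) q x \<longrightarrow> ?E F q x)}"
  proof (intro Collect_cong conj_cong refl iffI)
    fix x assume "x \<in> space M" "argmax g K x \<inter> F \<noteq> {}"
    then obtain P where P: "P \<in> K x" "P \<in> F" "\<forall>R\<in>K x. g x R \<le> g x P" by (auto simp: argmax_def)
    then show "K x \<inter> F \<noteq> {} \<and> (\<forall>q\<in>\<rat>. ?E (topspace X) q x \<longrightarrow> ?E F q x)"
      by (blast intro: order_trans)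
  next
    fix x assume x: "x \<in> space M" and *: "K x \<inter> F \<noteq> {} \<and> (\<forall>q\<in>\<rat>. ?E (topspace X) q x \<longrightarrow> ?E F q x)"
    obtain P where P: "P \<in> K x \<inter> F" "\<forall>R\<in>K x \<inter> F. g x R \<le> g x P"
      using compactin_attains_sup[OF compact_Int_closedin[OF comp[OF x] F] _ g[OF x]] * by blast
    have "g x R \<le> g x P" if R: "R \<in> K x" for R
    proof (rule ccontr)
      assume "\<not> g x R \<le> g x P"
      then obtain q where q: "q \<in> \<rat>" "g x P < q" "q < g x R"
        using Rats_dense_in_real[of "g x P" "g x R"] by auto
      moreover have "R \<in> topspace X" using R compactin_subset_topspace[OF comp[OF x]] by auto
      ultimately have "?E (topspace X) q x" using R by (auto intro!: bexI[of _ R])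
      then have "?E F q x" using * q(1) by blast
      then obtain S where "S \<in> K x \<inter> F" "q \<le> g x S" by blast
      then show False using P(2) q(2) by force
    qed
    then show "argmax g K x \<inter> F \<noteq> {}"
      using P(1) by (auto simp: argmax_def)
  qed
  also have "\<dots> \<in> sets M"
  proof (intro sets.sets_Collect_conj sets.sets_Collect_countable_All' countable_rat sets.sets_Collect_imp)
    show "{x \<in> space M. K x \<inter> F \<noteq> {}} \<in> sets M"
      using K F by (simp add: measurable_correspondence_def)
  qed (rule meas[OF F] meas[OF closedin_topspace])+
  finally show "{x \<in> space M. argmax g K x \<inter> F \<noteq> {}} \<in> sets M" .
qed

lemma measurable_correspondence_argmax_const:
  assumes K: "measurable_correspondence X M K" and g: "continuous_map X euclideanreal g"
  shows "measurable_correspondence X M (argmax (\<lambda>_. g) K)"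
proof (rule measurable_correspondence_argmax[OF K g])
  fix F and q :: real assume "closedin X F"
  moreover have "closedin X {P \<in> topspace X. q \<le> g P}"
    using g by (simp add: continuous_map_upper_lower_semicontinuous_le)
  ultimately have "closedin X (F \<inter> {P \<in> topspace X. q \<le> g P})"
    by (rule closedin_Int)
  then have "{x \<in> space M. K x \<inter> (F \<inter> {P \<in> topspace X. q \<le> g P}) \<noteq> {}} \<in> sets M"
    using K by (simp add: measurable_correspondence_def)
  also have "{x \<in> space M. K x \<inter> (F \<inter> {P \<in> topspace X. q \<le> g P}) \<noteq> {}} = {x \<in> space M. \<exists>P\<in>K x \<inter> F. q \<le> g P}"
    using closedin_subset[OF \<open>closedin X F\<close>] by auto
  finally show "{x \<in> space M. \<exists>P\<in>K x \<inter> F. q \<le> g P} \<in> sets M" .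
qed

text \<open>A closed set that meets every member of a decreasing sequence of compact sets meets the
  intersection, so hitting the intersection is a countable condition.\<close>

lemma measurable_correspondence_Inter:
  assumes H: "Hausdorff_space X" and K: "\<And>n::nat. measurable_correspondence X M (K n)"
    and dec: "\<And>n x. x \<in> space M \<Longrightarrow> K (Suc n) x \<subseteq> K n x"
  shows "measurable_correspondence X M (\<lambda>x. \<Inter>n. K n x)"
proof -
  have comp: "compactin X (K n x)" "K n x \<noteq> {}" if "x \<in> space M" for n x
    using K[of n] that by (auto simp: measurable_correspondence_def compacts_def)
  have cl: "closedin X (K n x)" if "x \<in> space M" for n x
    by (rule compactin_imp_closedin[OF H comp(1)[OF that]])
  have nest: "(\<Inter>n. K n x \<inter> F) \<noteq> {}" if x: "x \<in> space M" and F: "closedin X F" and ne: "\<And>n. K n x \<inter> F \<noteq> {}" for x F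
  proof (rule compact_space_imp_nest)
    let ?X = "subtopology X (K 0 x)"
    show "compact_space ?X" by (rule compact_space_subtopology[OF comp(1)[OF x]])
    have "decseq (\<lambda>n. K n x)" using dec[OF x] by (simp add: decseq_Suc_iff)
    then have sub: "K n x \<subseteq> K m x" if "m \<le> n" for m n using that by (auto simp: decseq_def)
    show "closedin ?X (K n x \<inter> F)" for n
      using sub[of 0 n] by (intro closedin_subset_topspace closedin_Int cl x F) auto
    show "decseq (\<lambda>n. K n x \<inter> F)"
      unfolding decseq_def using sub by blast
  qed (rule ne)
  show ?thesis
    unfolding measurable_correspondence_def
  proof (intro conjI ballI allI impI)
    fix x assume x: "x \<in> space M"
    have "compactin X (K 0 x \<inter> (\<Inter>n. K n x))"
      by (rule compact_Int_closedin[OF comp(1)[OF x]]) (intro closedin_INT, auto intro: cl x)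
    moreover have "K 0 x \<inter> (\<Inter>n. K n x) = (\<Inter>n. K n x)" by auto
    moreover have "(\<Inter>n. K n x \<inter> topspace X) \<noteq> {}"
      using comp[OF x] compactin_subset_topspace[OF comp(1)[OF x]] by (intro nest[OF x]) (auto simp: Int_absorb2)
    ultimately show "(\<Inter>n. K n x) \<in> compacts X"
      by (auto simp: compacts_def)
  next
    fix F assume F: "closedin X F"
    have "{x \<in> space M. (\<Inter>n. K n x) \<inter> F \<noteq> {}} = {x \<in> space M. \<forall>n. K n x \<inter> F \<noteq> {}}"
    proof (intro Collect_cong conj_cong refl iffI allI)
      fix x assume "x \<in> space M" "\<forall>n. K n x \<inter> F \<noteq> {}"
      then show "(\<Inter>n. K n x) \<inter> F \<noteq> {}" using nest[of x F] F by auto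
    qed auto
    also have "\<dots> \<in> sets M"
      using K F by (intro sets.sets_Collect_countable_All) (auto simp: measurable_correspondence_def)
    finally show "{x \<in> space M. (\<Inter>n. K n x) \<inter> F \<noteq> {}} \<in> sets M" .
  qed
qed

section \<open>Iterated maximization and measurable selection\<close>

fun iter_argmax :: "(nat \<Rightarrow> 'a \<Rightarrow> real) \<Rightarrow> ('x \<Rightarrow> 'a set) \<Rightarrow> nat \<Rightarrow> 'x \<Rightarrow> 'a set" where
  "iter_argmax G K 0 = K"
| "iter_argmax G K (Suc n) = argmax (\<lambda>_. G n) (iter_argmax G K n)"

lemma iter_argmax_Suc_subset: "iter_argmax G K (Suc n) x \<subseteq> iter_argmax G K n x"
  by (auto simp: argmax_def)

text \<open>Membership in stage \<open>Suc n\<close> fixes the value of \<open>G n\<close> to be the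
  maximum over stage \<open>n\<close>.\<close>

lemma iter_argmax_Inter_eq:
  assumes "P \<in> (\<Inter>n. iter_argmax G K n x)" "R \<in> (\<Inter>n. iter_argmax G K n x)"
  shows "G n P = G n R"
proof -
  have "P \<in> argmax (\<lambda>_. G n) (iter_argmax G K n) x" "R \<in> argmax (\<lambda>_. G n) (iter_argmax G K n) x"
    using assms by (metis INT_D UNIV_I iter_argmax.simps(2))+
  then show ?thesis by (intro antisym) (auto simp: argmax_def)
qed

lemma measurable_correspondence_iter_argmax:
  assumes "measurable_correspondence X M K" "\<And>n. continuous_map X euclideanreal (G n)"
  shows "measurable_correspondence X M (iter_argmax G K n)"
  using assms by (induction n) (auto intro: measurable_correspondence_argmax_const)

lemma measurable_correspondence_iter_argmax_Inter:
  assumes "Hausdorff_space X" "measurable_correspondence X M K" "\<And>n. continuous_map X euclideanreal (G n)"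
  shows "measurable_correspondence X M (\<lambda>x. \<Inter>n. iter_argmax G K n x)"
  using assms by (intro measurable_correspondence_Inter measurable_correspondence_iter_argmax iter_argmax_Suc_subset)

lemma measurable_of_singleton_correspondence:
  assumes K: "measurable_correspondence X M K" and s: "\<And>x. x \<in> space M \<Longrightarrow> K x = {s x}"
  shows "s \<in> M \<rightarrow>\<^sub>M borel_of X"
proof (rule measurable_borel_of_closed)
  show "s \<in> space M \<rightarrow> topspace X"
    using K s compactin_subset_topspace by (fastforce simp: measurable_correspondence_def compacts_def)
  fix F assume "closedin X F"
  then have "{x \<in> space M. K x \<inter> F \<noteq> {}} \<in> sets M"
    using K by (simp add: measurable_correspondence_def)
  also have "{x \<in> space M. K x \<inter> F \<noteq> {}} = s -` F \<inter> space M"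
    using s by auto
  finally show "s -` F \<inter> space M \<in> sets M" .
qed

text \<open>When countably many continuous functions separate points, maximizing them one after the other
  singles out one point of each value of the correspondence; this replaces the
  Kuratowski--Ryll-Nardzewski theorem.\<close>

lemma measurable_selection:
  assumes H: "Hausdorff_space X" and K: "measurable_correspondence X M K"
    and G: "\<And>n::nat. continuous_map X euclideanreal (G n)"
    and sep: "\<And>P R. P \<in> topspace X \<Longrightarrow> R \<in> topspace X \<Longrightarrow> (\<And>n. G n P = G n R) \<Longrightarrow> P = R"
  shows "\<exists>s. s \<in> M \<rightarrow>\<^sub>M borel_of X \<and> (\<forall>x\<in>space M. s x \<in> K x)"
proof -
  let ?K = "\<lambda>x. \<Inter>n. iter_argmax G K n x"
  have mc: "measurable_correspondence X M ?K"
    by (rule measurable_correspondence_iter_argmax_Inter[OF H K G])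
  have "\<exists>p. ?K x = {p}" if x: "x \<in> space M" for x
  proof -
    have ne: "?K x \<noteq> {}" and sub: "?K x \<subseteq> topspace X"
      using mc x compactin_subset_topspace by (auto simp: measurable_correspondence_def compacts_def)
    then obtain p where p: "p \<in> ?K x" by blast
    have "R = p" if "R \<in> ?K x" for R
      using sub p that iter_argmax_Inter_eq[OF that p] by (intro sep) blast+
    then show ?thesis using p by blast
  qed
  then obtain s where s: "\<And>x. x \<in> space M \<Longrightarrow> ?K x = {s x}" by metis
  have "s x \<in> K x" if "x \<in> space M" for x
  proof -
    have "s x \<in> iter_argmax G K 0 x" using s[OF that] by blast
    then show ?thesis by simp
  qed
  then show ?thesis
    using measurable_of_singleton_correspondence[OF mc s] by blast
qed

section \<open>From the Hausdorff metric to hit sets\<close>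

text \<open>A compact set keeps a positive distance \<open>\<rho>\<close> from a disjoint closed
  set, and a compact set within Hausdorff distance less than \<open>\<rho>\<close> cannot reach that
  closed set.\<close>

lemma openin_hausdorff_disjoint:
  assumes d: "metrizes d T" and F: "closedin T F"
  shows "openin (hausdorff_topology T d) {K \<in> compacts T. K \<inter> F = {}}"
proof -
  interpret M: Metric_space "topspace T" d
    using d by (simp add: metrizes_def)
  have T: "M.mtopology = T"
    using d by (simp add: metrizes_def)
  interpret H: Metric_space "compacts T" "hausdorff_dist T d"
    by (rule Metric_space_hausdorff_dist[OF d])
  show ?thesis
    unfolding hausdorff_topology_def H.openin_mtopology
  proof (intro conjI allI impI)
    fix K assume "K \<in> {K \<in> compacts T. K \<inter> F = {}}"
    then have K: "K \<in> compacts T" "K \<inter> F = {}" by auto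
    have Ksub: "K \<subseteq> topspace T" using K(1) compactin_subset_topspace by (auto simp: compacts_def)
    have "openin M.mtopology (topspace T - F)"
      using F by (auto simp: T)
    then have "\<exists>r>0. M.mball x r \<subseteq> topspace T - F" if "x \<in> K" for x
      using that K Ksub unfolding M.openin_mtopology by blast
    then obtain r where r: "\<And>x. x \<in> K \<Longrightarrow> 0 < r x" "\<And>x. x \<in> K \<Longrightarrow> M.mball x (r x) \<subseteq> topspace T - F"
      by metis
    have "\<exists>\<F>. finite \<F> \<and> \<F> \<subseteq> (\<lambda>x. M.mball x (r x / 2)) ` K \<and> K \<subseteq> \<Union>\<F>"
    proof (rule compactinD)
      show "compactin T K" using K(1) by (simp add: compacts_def)
      show "openin T U" if "U \<in> (\<lambda>x. M.mball x (r x / 2)) ` K" for U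
        using that M.openin_mball unfolding T by auto
      show "K \<subseteq> \<Union> ((\<lambda>x. M.mball x (r x / 2)) ` K)"
      proof
        fix x assume x: "x \<in> K"
        then have "x \<in> M.mball x (r x / 2)" using r(1)[OF x] Ksub by auto
        then show "x \<in> \<Union> ((\<lambda>x. M.mball x (r x / 2)) ` K)" using x by blast
      qed
    qed
    then obtain \<F> where \<F>: "finite \<F>" "\<F> \<subseteq> (\<lambda>x. M.mball x (r x / 2)) ` K" "K \<subseteq> \<Union>\<F>"
      by blast
    obtain K0 where "K0 \<subseteq> K" "finite K0" "\<F> = (\<lambda>x. M.mball x (r x / 2)) ` K0"
      using finite_subset_image[OF \<F>(1,2)] by blast
    with \<F>(3) have K0: "finite K0" "K0 \<subseteq> K" "K \<subseteq> (\<Union>x\<in>K0. M.mball x (r x / 2))"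
      by auto
    have "K \<noteq> {}" using K(1) by (simp add: compacts_def)
    then have "K0 \<noteq> {}" using K0(3) by auto
    \<comment> \<open>Half radii leave room for a second step: a point of \<open>L\<close> is within
      \<open>\<rho>\<close> of some \<open>c\<close> in \<open>K\<close>, and \<open>c\<close> is
      within \<open>r x / 2\<close> of a centre \<open>x\<close>.\<close>
    define \<rho> where "\<rho> = Min ((\<lambda>x. r x / 2) ` K0)"
    have "0 < \<rho>"
      unfolding \<rho>_def using K0 \<open>K0 \<noteq> {}\<close> r(1) by (subst Min_gr_iff) auto
    moreover have "\<rho> \<le> r x / 2" if "x \<in> K0" for x
      unfolding \<rho>_def using K0(1) that by (intro Min_le) auto
    ultimately have \<rho>: "0 < \<rho>" "\<And>x. x \<in> K0 \<Longrightarrow> \<rho> \<le> r x / 2" by auto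
    have "L \<inter> F = {}" if L: "L \<in> H.mball K \<rho>" for L
    proof (rule ccontr)
      assume "L \<inter> F \<noteq> {}"
      then obtain b where b: "b \<in> L" "b \<in> F" by blast
      have LT: "L \<in> compacts T" and dist: "hausdorff_dist T d K L < \<rho>" using L by auto
      have bT: "b \<in> topspace T" using b(2) closedin_subset[OF F] by blast
      have "(INF a\<in>K. d a b) < \<rho>"
        using hausdorff_dist_le_iff[OF d K(1) LT, of "hausdorff_dist T d K L"] b(1) dist by force
      then obtain c where c: "c \<in> K" "d c b < \<rho>"
        using \<open>K \<noteq> {}\<close> by (subst (asm) cINF_less_iff) (auto intro!: bdd_belowI2[of _ 0])
      obtain x where x: "x \<in> K0" "c \<in> M.mball x (r x / 2)" using K0(3) c(1) by blast
      have "d x b \<le> d x c + d c b"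
        using x(2) bT by (intro M.triangle) auto
      then have "b \<in> M.mball x (r x)"
        using x \<rho>(2)[OF x(1)] c(2) bT by auto
      then show False
        using r(2)[of x] x(1) K0(2) b(2) by blast
    qed
    then have "H.mball K \<rho> \<subseteq> {K \<in> compacts T. K \<inter> F = {}}"
      by (intro subsetI CollectI conjI) simp_all
    then show "\<exists>e>0. H.mball K e \<subseteq> {K \<in> compacts T. K \<inter> F = {}}"
      using \<rho>(1) by blast
  qed auto
qed

lemma measurable_correspondence_of_hausdorff:
  assumes d: "metrizes d T" and C: "C \<in> M \<rightarrow>\<^sub>M borel_of (hausdorff_topology T d)"
  shows "measurable_correspondence T M C"
proof -
  interpret H: Metric_space "compacts T" "hausdorff_dist T d"
    by (rule Metric_space_hausdorff_dist[OF d])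
  have top: "topspace (hausdorff_topology T d) = compacts T"
    by (simp add: hausdorff_topology_def)
  have Cx: "C x \<in> compacts T" if "x \<in> space M" for x
    using measurable_space[OF C that] by (simp add: top)
  have "{x \<in> space M. C x \<inter> F \<noteq> {}} \<in> sets M" if F: "closedin T F" for F
  proof -
    have "C -` {K \<in> compacts T. K \<inter> F = {}} \<inter> space M \<in> sets M"
      by (rule measurable_sets[OF C openin_sets_borel_of[OF openin_hausdorff_disjoint[OF d F]]])
    then have "space M - (C -` {K \<in> compacts T. K \<inter> F = {}} \<inter> space M) \<in> sets M" by auto
    also have "space M - (C -` {K \<in> compacts T. K \<inter> F = {}} \<inter> space M) = {x \<in> space M. C x \<inter> F \<noteq> {}}"
      using Cx by auto
    finally show ?thesis .
  qed
  with Cx show ?thesis by (simp add: measurable_correspondence_def)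
qed

lemma metrizes_imp_Hausdorff_space: "metrizes d T \<Longrightarrow> Hausdorff_space T"
  unfolding metrizes_def using Metric_space.Hausdorff_space_mtopology by metis

section \<open>Expectations at exponential times\<close>

abbreviation exp_law :: "real \<Rightarrow> real measure" where
  "exp_law l \<equiv> density lborel (exponential_density l)"

lemma integral_exp_law:
  fixes f :: "real \<Rightarrow> real"
  assumes "0 < l" "f \<in> borel_measurable borel"
  shows "(\<integral>s. f s \<partial>exp_law l) = (\<integral>s. exponential_density l s * f s \<partial>lborel)"
  using assms by (subst integral_density) (auto simp: exponential_density_nonneg)

lemma integrable_exp_law:
  fixes f :: "real \<Rightarrow> real"
  assumes "0 < l" "f \<in> borel_measurable borel" "\<And>s. \<bar>f s\<bar> \<le> B"
  shows "integrable (exp_law l) f" "integrable lborel (\<lambda>s. exponential_density l s * f s)"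
proof -
  interpret prob_space "exp_law l" by (rule prob_space_exponential_density) fact
  show 1: "integrable (exp_law l) f"
    using assms by (intro integrable_const_bound[where B=B]) auto
  then show "integrable lborel (\<lambda>s. exponential_density l s * f s)"
    using assms by (subst (asm) integrable_density) (auto simp: exponential_density_nonneg)
qed

text \<open>An expectation at an independent exponential time: up to the factor \<open>l\<close>, the Laplace transform
  at \<open>l\<close> of \<open>s \<mapsto> f (\<omega> s)\<close>.\<close>

definition discounted :: "real \<Rightarrow> ('e \<Rightarrow> real) \<Rightarrow> (real \<Rightarrow> 'e) \<Rightarrow> real" where
  "discounted l f \<omega> = (\<integral>s. f (\<omega> (max 0 s)) \<partial>exp_law l)"

text \<open>The maximum extends \<open>\<omega>\<close> continuously to the left of 0, where paths
  carry no information; the exponential law does not charge that side.\<close>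

lemma continuous_on_path_max:
  assumes "\<omega> \<in> paths 0" "continuous_on UNIV f"
  shows "continuous_on UNIV (\<lambda>s. f (\<omega> (max 0 s)))"
proof -
  have "continuous_on UNIV (\<lambda>s. \<omega> (max 0 s))"
    using paths_continuous[OF assms(1)]
    by (rule continuous_on_compose2[where f="\<lambda>s. max 0 s"]) (auto intro!: continuous_intros)
  then show ?thesis
    by (rule continuous_on_compose2[OF assms(2)]) simp
qed

lemma measurable_path_max:
  fixes f :: "'e::metric_space \<Rightarrow> real"
  assumes "\<omega> \<in> paths 0" "continuous_on UNIV f"
  shows "(\<lambda>s. f (\<omega> (max 0 s))) \<in> borel_measurable borel"
  by (rule borel_measurable_continuous_onI[OF continuous_on_path_max[OF assms]])

lemma discounted_bounded:
  assumes l: "0 < l" and f: "\<And>y. 0 \<le> f y \<and> f y \<le> 1"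
  shows "0 \<le> discounted l f \<omega>" "discounted l f \<omega> \<le> 1"
proof -
  interpret prob_space "exp_law l" by (rule prob_space_exponential_density) fact
  show "0 \<le> discounted l f \<omega>"
    unfolding discounted_def using f by (intro Bochner_Integration.integral_nonneg) auto
  show "discounted l f \<omega> \<le> 1"
  proof (cases "integrable (exp_law l) (\<lambda>s. f (\<omega> (max 0 s)))")
    case True
    then have "discounted l f \<omega> \<le> (\<integral>s. 1 \<partial>exp_law l)"
      unfolding discounted_def using f by (intro integral_mono) auto
    also have "(\<integral>s. 1 \<partial>exp_law l) = (1 :: real)" using prob_space by simp
    finally show ?thesis .
  next
    \<comment> \<open>An integral that does not exist has the value 0, so the bound holds here
      too.\<close>
    case False
    then show ?thesis by (simp add: discounted_def not_integrable_integral_eq)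
  qed
qed

text \<open>Lack of memory: for \<open>s \<ge> 0\<close> the exponential density at
  \<open>t + s\<close> is \<open>exp (- t * l)\<close> times the one at \<open>s\<close>, so cutting
  the integral at \<open>t\<close> and substituting leaves the same functional of the
  future.\<close>

lemma discounted_split:
  fixes f :: "'e::metric_space \<Rightarrow> real"
  assumes l: "0 < l" and f: "\<And>y. 0 \<le> f y \<and> f y \<le> 1" "continuous_on UNIV f"
    and t: "0 \<le> t" and \<omega>: "\<omega> \<in> paths 0"
  shows "discounted l f \<omega> = (\<integral>s. indicator {..<t} s * (exponential_density l s * f (\<omega> (max 0 s))) \<partial>lborel) +
     exp (- t * l) * discounted l f (unshift_path t \<omega>)"
proof -
  let ?h = "\<lambda>s. exponential_density l s * f (\<omega> (max 0 s))"
  have m: "(\<lambda>s. f (\<omega> (max 0 s))) \<in> borel_measurable borel"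
    by (rule measurable_path_max[OF \<omega> f(2)])
  have "\<bar>f y\<bar> \<le> 1" for y using f(1)[of y] by auto
  then have int: "integrable lborel ?h"
    by (rule integrable_exp_law(2)[OF l m])
  have int_ind: "integrable lborel (\<lambda>s. indicator A s * ?h s)" if "A \<in> sets borel" for A
    using integrable_real_mult_indicator[OF _ int, of A] that by (simp add: mult.commute)
  have \<omega>': "unshift_path t \<omega> \<in> paths 0"
  proof -
    have "time_change 0 0 (\<lambda>s. s + t)"
      unfolding time_change_def
    proof (intro conjI continuous_intros allI)
      fix T show "\<exists>T'\<ge>0. \<forall>s\<in>{0..T}. s + t \<le> T'" by (intro exI[of _ "max 0 (T + t)"]) auto
    qed (use t in auto)
    then show ?thesis using \<omega> by (rule reparam_in_paths)
  qed
  have "discounted l f \<omega> = (\<integral>s. ?h s \<partial>lborel)"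
    unfolding discounted_def by (rule integral_exp_law[OF l m])
  also have "\<dots> = (\<integral>s. indicator {..<t} s * ?h s + indicator {t..} s * ?h s \<partial>lborel)"
    by (intro Bochner_Integration.integral_cong) (auto simp: indicator_def)
  also have "\<dots> = (\<integral>s. indicator {..<t} s * ?h s \<partial>lborel) + (\<integral>s. indicator {t..} s * ?h s \<partial>lborel)"
    by (intro Bochner_Integration.integral_add int_ind) auto
  also have "(\<integral>s. indicator {t..} s * ?h s \<partial>lborel) = (\<integral>s. indicator {t..} (t + 1 * s) * ?h (t + 1 * s) \<partial>lborel)"
    using lborel_integral_real_affine[of 1 "\<lambda>s. indicator {t..} s * ?h s" t] by simp
  also have "\<dots> = (\<integral>s. exp (- t * l) * (exponential_density l s * f (unshift_path t \<omega> (max 0 s))) \<partial>lborel)"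
    using t by (intro Bochner_Integration.integral_cong)
      (auto simp: indicator_def exponential_density_def reparam_def max_def algebra_simps exp_add exp_diff exp_minus field_simps)
  also have "\<dots> = exp (- t * l) * discounted l f (unshift_path t \<omega>)"
    using integral_exp_law[OF l measurable_path_max[OF \<omega>' f(2)]] by (simp add: discounted_def)
  finally show ?thesis .
qed

text \<open>The first term of the splitting sees the path before \<open>t\<close> only. This is what
  makes the remainder of a functional measurable for the past.\<close>

lemma discounted_past:
  fixes f :: "'e::metric_space \<Rightarrow> real"
  assumes l: "0 < l" and f: "\<And>y. 0 \<le> f y \<and> f y \<le> 1" "continuous_on UNIV f"
    and t: "0 \<le> t" and \<omega>: "\<omega> \<in> paths 0" "\<eta> \<in> paths 0" and eq: "\<And>s. 0 \<le> s \<Longrightarrow> s \<le> t \<Longrightarrow> \<omega> s = \<eta> s"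
  shows "discounted l f \<omega> - exp (- t * l) * discounted l f (unshift_path t \<omega>) =
    discounted l f \<eta> - exp (- t * l) * discounted l f (unshift_path t \<eta>)"
proof -
  have "(\<integral>s. indicator {..<t} s * (exponential_density l s * f (\<omega> (max 0 s))) \<partial>lborel) =
    (\<integral>s. indicator {..<t} s * (exponential_density l s * f (\<eta> (max 0 s))) \<partial>lborel)"
    using eq t by (intro Bochner_Integration.integral_cong) (auto simp: indicator_def max_def)
  then show ?thesis
    using discounted_split[OF l f t \<omega>(1)] discounted_split[OF l f t \<omega>(2)] by simp
qed

lemma exp_law_tail:
  assumes "0 < l" "0 < e" shows "\<exists>T\<ge>0. measure (exp_law l) {T<..} < e"
proof -
  interpret prob_space "exp_law l" by (rule prob_space_exponential_density) fact
  have "(\<lambda>n. measure (exp_law l) {real n<..}) \<longlonglongrightarrow> measure (exp_law l) (\<Inter>n. {real n<..})"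
    by (rule finite_Lim_measure_decseq) (auto simp: decseq_def intro: le_less_trans[rotated])
  moreover have "(\<Inter>n. {real n<..}) = {}"
  proof (intro equals0I)
    fix x assume x: "x \<in> (\<Inter>n. {real n<..})"
    obtain n where "x < real n" using reals_Archimedean2 by blast
    then show False using x by (auto dest: spec[of _ n])
  qed
  ultimately have "(\<lambda>n. measure (exp_law l) {real n<..}) \<longlonglongrightarrow> 0" by simp
  then have "\<forall>\<^sub>F n in sequentially. measure (exp_law l) {real n<..} < e"
    using assms(2) by (rule order_tendstoD(2))
  then obtain n where "measure (exp_law l) {real n<..} < e"
    by (auto simp: eventually_sequentially)
  then show ?thesis by (intro exI[of _ "real n"]) auto
qed

text \<open>After a large \<open>T\<close> the exponential law has little mass and \<open>f\<close>
  is bounded; before \<open>T\<close> the Lipschitz bound turns uniform closeness of paths into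
  uniform closeness of values, wherever the paths run.\<close>

lemma continuous_map_discounted:
  fixes f :: "'e::metric_space \<Rightarrow> real"
  assumes l: "0 < l" and f: "\<And>y. 0 \<le> f y \<and> f y \<le> 1" and lip: "\<And>x y. \<bar>f x - f y\<bar> \<le> L * dist x y" and L: "0 < L"
  shows "continuous_map (paths_topology 0) euclideanreal (discounted l f)"
  unfolding continuous_map_def
proof (intro conjI allI impI)
  have "L-lipschitz_on UNIV f"
    using lip L by (intro lipschitz_onI) (auto simp: dist_real_def)
  then have cont: "continuous_on UNIV f" by (rule lipschitz_on_continuous_on)
  interpret prob_space "exp_law l" by (rule prob_space_exponential_density) fact
  fix U :: "real set" assume "openin euclideanreal U"
  then have U: "open U" by simp
  show "openin (paths_topology 0) {\<omega> \<in> topspace (paths_topology 0). discounted l f \<omega> \<in> U}"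
    unfolding openin_paths_topology paths_open_def
  proof (intro conjI ballI)
    fix \<omega> assume "\<omega> \<in> {\<omega> \<in> topspace (paths_topology 0). discounted l f \<omega> \<in> U}"
    then have \<omega>: "\<omega> \<in> paths 0" "discounted l f \<omega> \<in> U" by auto
    obtain e where e: "0 < e" "ball (discounted l f \<omega>) e \<subseteq> U"
      using U \<omega>(2) by (auto elim: openE)
    obtain T where T: "0 \<le> T" "measure (exp_law l) {T<..} < e / 2"
      using exp_law_tail[OF l, of "e / 2"] e by auto
    have "discounted l f \<eta> \<in> U"
      if \<eta>: "\<eta> \<in> paths 0" "\<forall>s\<in>{0..T}. dist (\<omega> s) (\<eta> s) < e / (2 * L)" for \<eta>
    proof -
      note m[measurable] = measurable_path_max[OF \<omega>(1) cont] measurable_path_max[OF \<eta>(1) cont]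
      have bound: "\<bar>f y\<bar> \<le> 1" for y using f[of y] by auto
      note int = integrable_exp_law(1)[OF l m(1) bound] integrable_exp_law(1)[OF l m(2) bound]
      have "\<bar>discounted l f \<omega> - discounted l f \<eta>\<bar> = \<bar>\<integral>s. f (\<omega> (max 0 s)) - f (\<eta> (max 0 s)) \<partial>exp_law l\<bar>"
        unfolding discounted_def using int by simp
      also have "\<dots> \<le> (\<integral>s. \<bar>f (\<omega> (max 0 s)) - f (\<eta> (max 0 s))\<bar> \<partial>exp_law l)"
        by (rule integral_abs_bound)
      also have "\<dots> \<le> (\<integral>s. e / 2 + indicator {T<..} s \<partial>exp_law l)"
      proof (rule integral_mono)
        show "integrable (exp_law l) (\<lambda>s. \<bar>f (\<omega> (max 0 s)) - f (\<eta> (max 0 s))\<bar>)"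
          using int by auto
        show "integrable (exp_law l) (\<lambda>s. e / 2 + indicator {T<..} s)"
          by (intro integrable_const_bound[where B="e/2 + 1"]) (use e in \<open>auto simp: indicator_def\<close>)
        fix s show "\<bar>f (\<omega> (max 0 s)) - f (\<eta> (max 0 s))\<bar> \<le> e / 2 + indicator {T<..} s"
        proof (cases "T < s")
          case True
          then show ?thesis using f[of "\<omega> (max 0 s)"] f[of "\<eta> (max 0 s)"] e by auto
        next
          case False
          then have "max 0 s \<in> {0..T}" using T(1) by auto
          then have "L * dist (\<omega> (max 0 s)) (\<eta> (max 0 s)) \<le> L * (e / (2 * L))"
            using \<eta>(2) L by (intro mult_left_mono less_imp_le) auto
          then show ?thesis using lip[of "\<omega> (max 0 s)" "\<eta> (max 0 s)"] False L by simp
        qed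
      qed
      also have "\<dots> = e / 2 + measure (exp_law l) {T<..}"
        using prob_space by (subst Bochner_Integration.integral_add) (auto simp: less_top[symmetric])
      also have "\<dots> < e" using T(2) by simp
      finally show ?thesis using e(2) by (auto simp: dist_real_def)
    qed
    then show "\<exists>T\<ge>0. \<exists>e>0. \<forall>\<eta>\<in>paths 0. (\<forall>s\<in>{0..T}. dist (\<omega> s) (\<eta> s) < e) \<longrightarrow>
        \<eta> \<in> {\<omega> \<in> topspace (paths_topology 0). discounted l f \<omega> \<in> U}"
      using T(1) e(1) L by (intro exI[of _ T] conjI exI[of _ "e / (2 * L)"]) auto
  qed auto
qed auto

text \<open>Prepares Fubini: time is rounded down to a grid of mesh \<open>1 / Suc n\<close>, which
  leaves countably many coordinates, and continuity of the path gives the limit.\<close>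

lemma measurable_path_evaluation:
  fixes f :: "'e::metric_space \<Rightarrow> real"
  assumes f: "continuous_on UNIV f"
  shows "(\<lambda>(s, \<omega>). f (\<omega> (max 0 s))) \<in> borel_measurable (borel \<Otimes>\<^sub>M coord_sigma 0 {0..})"
proof (rule borel_measurable_LIMSEQ_real)
  let ?r = "\<lambda>n i. max 0 (real_of_int i / real (Suc n))"
  fix n
  have fm: "f \<in> borel_measurable borel" using f by (rule borel_measurable_continuous_onI)
  show "(\<lambda>x. f (snd x (?r n \<lfloor>real (Suc n) * fst x\<rfloor>))) \<in> borel_measurable (borel \<Otimes>\<^sub>M coord_sigma 0 {0..})"
  proof (rule measurable_compose_countable[where f="\<lambda>i x. f (snd x (?r n i))"])
    show "(\<lambda>x. f (snd x (?r n i))) \<in> borel_measurable (borel \<Otimes>\<^sub>M coord_sigma 0 {0..})" for i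
      by (rule measurable_compose[OF _ fm], rule measurable_compose[OF measurable_snd measurable_coord]) auto
    show "(\<lambda>x. \<lfloor>real (Suc n) * fst x\<rfloor>) \<in> borel \<Otimes>\<^sub>M coord_sigma 0 {0..} \<rightarrow>\<^sub>M count_space UNIV"
      by measurable
  qed
next
  fix x :: "real \<times> (real \<Rightarrow> 'e)" assume "x \<in> space (borel \<Otimes>\<^sub>M coord_sigma 0 {0..})"
  then obtain s \<omega> where x: "x = (s, \<omega>)" and \<omega>: "\<omega> \<in> paths 0" by (auto simp: space_pair_measure)
  have "(\<lambda>n. real_of_int \<lfloor>real (Suc n) * s\<rfloor> / real (Suc n)) \<longlonglongrightarrow> s"
  proof (rule LIMSEQ_I)
    fix e :: real assume "0 < e"
    then obtain N where N: "inverse (real (Suc N)) < e" using reals_Archimedean by blast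
    have "norm (real_of_int \<lfloor>real (Suc n) * s\<rfloor> / real (Suc n) - s) < e" if "N \<le> n" for n
    proof -
      have "\<bar>real_of_int \<lfloor>real (Suc n) * s\<rfloor> - real (Suc n) * s\<bar> \<le> 1" by linarith
      then have "\<bar>real_of_int \<lfloor>real (Suc n) * s\<rfloor> - real (Suc n) * s\<bar> / real (Suc n) \<le> 1 / real (Suc n)"
        by (rule divide_right_mono) simp
      also have "\<bar>real_of_int \<lfloor>real (Suc n) * s\<rfloor> - real (Suc n) * s\<bar> / real (Suc n) =
          \<bar>(real_of_int \<lfloor>real (Suc n) * s\<rfloor> - real (Suc n) * s) / real (Suc n)\<bar>"
        by (simp only: abs_divide abs_of_nat)
      also have "(real_of_int \<lfloor>real (Suc n) * s\<rfloor> - real (Suc n) * s) / real (Suc n) =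
          real_of_int \<lfloor>real (Suc n) * s\<rfloor> / real (Suc n) - s"
        by (simp only: diff_divide_distrib) simp
      also have "1 / real (Suc n) \<le> inverse (real (Suc N))"
        using that by (simp add: inverse_eq_divide frac_le)
      finally show ?thesis using N by simp
    qed
    then show "\<exists>N. \<forall>n\<ge>N. norm (real_of_int \<lfloor>real (Suc n) * s\<rfloor> / real (Suc n) - s) < e" by blast
  qed
  from continuous_on_tendsto_compose[OF continuous_on_path_max[OF \<omega> f] this]
  show "(\<lambda>n. f (snd x (max 0 (real_of_int \<lfloor>real (Suc n) * fst x\<rfloor> / real (Suc n))))) \<longlonglongrightarrow> (case x of (s, \<omega>) \<Rightarrow> f (\<omega> (max 0 s)))"
    by (simp add: x)
qed

context dense_sequence begin

text \<open>Fubini turns a functional of the law into \<open>l\<close> times a Laplace transform of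
  the one-dimensional expectations.\<close>

lemma integral_discounted:
  fixes f :: "'e \<Rightarrow> real"
  assumes l: "0 < l" and f: "\<And>y. 0 \<le> f y \<and> f y \<le> 1" "continuous_on UNIV f"
    and P: "P \<in> prob_measures (paths_topology 0 :: (real \<Rightarrow> 'e) topology)"
  shows "(\<integral>\<omega>. discounted l f \<omega> \<partial>P) = (\<integral>s. (\<integral>\<omega>. f (\<omega> (max 0 s)) \<partial>P) \<partial>exp_law l)"
proof -
  interpret P: prob_space P by (rule prob_measuresD) fact
  interpret E: prob_space "exp_law l" by (rule prob_space_exponential_density) fact
  interpret EP: pair_prob_space "exp_law l" P ..
  have "sets (exp_law l \<Otimes>\<^sub>M P) = sets (borel \<Otimes>\<^sub>M coord_sigma 0 {0..})"
    using sets_law[OF P] by (intro sets_pair_measure_cong) auto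
  then have "(\<lambda>(s, \<omega>). f (\<omega> (max 0 s))) \<in> borel_measurable (exp_law l \<Otimes>\<^sub>M P)"
    using measurable_path_evaluation[OF f(2)] by (simp cong: measurable_cong_sets)
  then have "integrable (exp_law l \<Otimes>\<^sub>M P) (\<lambda>(s, \<omega>). f (\<omega> (max 0 s)))"
    using f(1) by (intro EP.P.integrable_const_bound[where B=1]) (auto simp: case_prod_beta abs_le_iff intro: order_trans[of _ 0])
  from EP.Fubini_integral[OF this] show ?thesis
    by (simp add: discounted_def)
qed

lemma continuous_on_marginal:
  fixes f :: "'e \<Rightarrow> real"
  assumes f: "\<And>y. 0 \<le> f y \<and> f y \<le> 1" "continuous_on UNIV f"
    and P: "P \<in> prob_measures (paths_topology 0 :: (real \<Rightarrow> 'e) topology)"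
  shows "continuous_on UNIV (\<lambda>s. \<integral>\<omega>. f (\<omega> (max 0 s)) \<partial>P)"
  unfolding continuous_on_sequentially
proof (intro allI ballI impI)
  interpret P: prob_space P by (rule prob_measuresD) fact
  fix u :: "nat \<Rightarrow> real" and s assume u: "(\<forall>n. u n \<in> UNIV) \<and> u \<longlonglongrightarrow> s"
  have fm: "f \<in> borel_measurable borel" using f(2) by (rule borel_measurable_continuous_onI)
  have m: "(\<lambda>\<omega>. f (\<omega> (max 0 r))) \<in> borel_measurable P" for r
  proof -
    have "(\<lambda>\<omega>. f (\<omega> (max 0 r))) \<in> borel_measurable (coord_sigma 0 {0..})"
      by (rule measurable_compose[OF measurable_coord fm]) auto
    then show ?thesis using sets_law[OF P] by (simp cong: measurable_cong_sets)
  qed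
  show "((\<lambda>s. \<integral>\<omega>. f (\<omega> (max 0 s)) \<partial>P) \<circ> u) \<longlonglongrightarrow> (\<integral>\<omega>. f (\<omega> (max 0 s)) \<partial>P)"
    unfolding o_def
  proof (rule integral_dominated_convergence[where w="\<lambda>_. 1"])
    show "AE \<omega> in P. (\<lambda>n. f (\<omega> (max 0 (u n)))) \<longlonglongrightarrow> f (\<omega> (max 0 s))"
    proof (rule AE_I2)
      fix \<omega> assume "\<omega> \<in> space P"
      then have "\<omega> \<in> paths 0" by (simp add: space_law[OF P])
      from continuous_on_tendsto_compose[OF continuous_on_path_max[OF this f(2)], of u s] u
      show "(\<lambda>n. f (\<omega> (max 0 (u n)))) \<longlonglongrightarrow> f (\<omega> (max 0 s))" by simp
    qed
    show "AE \<omega> in P. norm (f (\<omega> (max 0 (u n)))) \<le> 1" for n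
      using f(1) by (intro AE_I2) (auto simp: abs_le_iff intro: order_trans[of _ 0])
  qed (use m in auto)
qed

end

section \<open>Uniqueness of Laplace transforms from integer rates\<close>

text \<open>The exponential density of rate \<open>Suc n\<close> is
  \<open>Suc n * exp (- n * r)\<close> times that of rate 1, so the hypothesis says that
  \<open>b\<close> is orthogonal to all powers of \<open>exp (- r)\<close> under
  \<open>exp_law 1\<close>. By Weierstrass a polynomial in \<open>exp (- r)\<close> may stand for
  \<open>exp (- r) * b r\<close>, and so the mean of \<open>exp (- r) * (b r)^2\<close> is
  0.\<close>

lemma laplace_unique:
  fixes b :: "real \<Rightarrow> real"
  assumes cont: "continuous_on UNIV b" and bound: "\<And>s. \<bar>b s\<bar> \<le> B"
    and zero: "\<And>n::nat. (\<integral>s. b s \<partial>exp_law (real (Suc n))) = 0"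
    and s: "0 < s"
  shows "b s = 0"
proof -
  let ?\<mu> = "exp_law 1"
  interpret prob_space ?\<mu> by (rule prob_space_exponential_density) simp
  have bm[measurable]: "b \<in> borel_measurable borel"
    using cont by (rule borel_measurable_continuous_onI)
  have B: "0 \<le> B" using bound[of 0] by linarith
  have moment: "(\<integral>r. exp (- r) ^ n * b r \<partial>?\<mu>) = 0" for n
  proof -
    have "0 = (\<integral>r. exponential_density (real (Suc n)) r * b r \<partial>lborel)"
      using zero[of n] by (subst (asm) integral_exp_law) auto
    also have "\<dots> = (\<integral>r. real (Suc n) * (exponential_density 1 r * (exp (- r) ^ n * b r)) \<partial>lborel)"
      by (intro Bochner_Integration.integral_cong)
        (auto simp: exponential_density_def exp_of_nat_mult[symmetric] exp_add[symmetric] algebra_simps)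
    also have "\<dots> = real (Suc n) * (\<integral>r. exp (- r) ^ n * b r \<partial>?\<mu>)"
      by (subst integral_exp_law) auto
    finally show ?thesis by simp
  qed
  \<comment> \<open>In the variable \<open>u = exp (- r)\<close> the function
    \<open>b (- ln u)\<close> is bounded but may oscillate near 0; the extra factor \<open>u\<close>
    makes it continuous there.\<close>
  define g where "g u = (if u \<le> 0 then 0 else u * b (- ln u))" for u :: real
  have g_exp: "g (exp (- r)) = exp (- r) * b r" for r by (simp add: g_def)
  have g_cont: "continuous_on {0..1} g"
    unfolding continuous_on_eq_continuous_within
  proof
    fix u :: real assume u: "u \<in> {0..1}"
    show "continuous (at u within {0..1}) g"
    proof (cases "u = 0")
      case True
      have "(g \<longlongrightarrow> 0) (at 0 within {0..1})"
      proof (rule Lim_null_comparison)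
        show "\<forall>\<^sub>F x in at 0 within {0..1}. norm (g x) \<le> B * \<bar>x\<bar>"
          using bound B by (intro always_eventually) (auto simp: g_def abs_mult mult.commute intro!: mult_right_mono mult_nonpos_nonneg)
        show "((\<lambda>x. B * \<bar>x\<bar>) \<longlongrightarrow> 0) (at 0 within {0..1})"
          by (auto intro!: tendsto_eq_intros)
      qed
      then show ?thesis by (simp add: True continuous_within g_def)
    next
      case False
      then have u: "0 < u" using u by simp
      have "continuous_on {0<..} (\<lambda>u. u * b (- ln u))"
        by (intro continuous_intros continuous_on_compose2[OF cont]) auto
      then have "continuous_on {0<..} g"
        by (rule continuous_on_eq) (simp add: g_def)
      then have "continuous (at u) g"
        using u by (simp add: continuous_on_eq_continuous_at)
      then show ?thesis by (rule continuous_at_imp_continuous_at_within)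
    qed
  qed
  have poly: "\<exists>p. real_polynomial_function p \<and> (\<forall>u\<in>{0..1}. \<bar>g u - p u\<bar> < e)" if "0 < e" for e
    by (rule Stone_Weierstrass_real_polynomial_function[OF compact_Icc g_cont that]) blast
  have pos: "AE r in ?\<mu>. 0 \<le> r"
    by (subst AE_density) (auto simp: exponential_density_def)
  \<comment> \<open>\<open>max 0 r\<close> agrees with \<open>r\<close> almost surely and keeps
    \<open>exp (- max 0 r)\<close> at most 1 everywhere, so that the bounds hold for every
    \<open>r\<close>.\<close>
  have int_b2: "integrable ?\<mu> (\<lambda>r. exp (- max 0 r) * (b r)\<^sup>2)"
  proof (rule integrable_exp_law(1))
    fix r
    have "\<bar>exp (- max 0 r) * (b r)\<^sup>2\<bar> \<le> 1 * B\<^sup>2"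
      using bound[of r] B unfolding abs_mult by (intro mult_mono) (auto simp: abs_le_square_iff[symmetric])
    then show "\<bar>exp (- max 0 r) * (b r)\<^sup>2\<bar> \<le> B\<^sup>2" by simp
  qed auto
  have small: "\<bar>\<integral>r. exp (- max 0 r) * (b r)\<^sup>2 \<partial>?\<mu>\<bar> \<le> e * B" if e: "0 < e" for e
  proof -
    obtain p where p: "real_polynomial_function p" "\<And>u. u \<in> {0..1} \<Longrightarrow> \<bar>g u - p u\<bar> < e"
      using poly[OF e] by auto
    obtain c n where c: "p = (\<lambda>u. \<Sum>i\<le>n. c i * u ^ i)"
      using p(1) by (auto simp: real_polynomial_function_iff_sum)
    have intm: "integrable ?\<mu> (\<lambda>r. exp (- max 0 r) ^ i * b r)" for i
    proof (rule integrable_exp_law(1))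
      fix r
      have "\<bar>exp (- max 0 r) ^ i * b r\<bar> \<le> 1 * B"
        unfolding abs_mult using bound[of r] by (intro mult_mono) (auto intro!: power_le_one)
      then show "\<bar>exp (- max 0 r) ^ i * b r\<bar> \<le> B" by simp
    qed auto
    have "(\<integral>r. exp (- max 0 r) ^ i * b r \<partial>?\<mu>) = (\<integral>r. exp (- r) ^ i * b r \<partial>?\<mu>)" for i
      using pos by (intro integral_cong_AE) (auto simp: max_def)
    then have mom: "(\<integral>r. exp (- max 0 r) ^ i * b r \<partial>?\<mu>) = 0" for i
      by (simp add: moment)
    have "(\<integral>r. p (exp (- max 0 r)) * b r \<partial>?\<mu>) = (\<integral>r. (\<Sum>i\<le>n. c i * (exp (- max 0 r) ^ i * b r)) \<partial>?\<mu>)"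
      by (simp add: c sum_distrib_right mult.assoc)
    also have "\<dots> = 0"
      using intm mom by (subst Bochner_Integration.integral_sum) auto
    finally have p0: "(\<integral>r. p (exp (- max 0 r)) * b r \<partial>?\<mu>) = 0" .
    have intp: "integrable ?\<mu> (\<lambda>r. p (exp (- max 0 r)) * b r)"
      unfolding c sum_distrib_right mult.assoc using intm by auto
    have "\<bar>\<integral>r. exp (- max 0 r) * (b r)\<^sup>2 \<partial>?\<mu>\<bar> =
        \<bar>\<integral>r. exp (- max 0 r) * (b r)\<^sup>2 - p (exp (- max 0 r)) * b r \<partial>?\<mu>\<bar>"
      using int_b2 intp p0 by simp
    also have "\<dots> \<le> (\<integral>r. \<bar>exp (- max 0 r) * (b r)\<^sup>2 - p (exp (- max 0 r)) * b r\<bar> \<partial>?\<mu>)"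
      by (rule integral_abs_bound)
    also have "\<dots> \<le> (\<integral>r. e * B \<partial>?\<mu>)"
    proof (rule integral_mono_AE)
      show "AE r in ?\<mu>. \<bar>exp (- max 0 r) * (b r)\<^sup>2 - p (exp (- max 0 r)) * b r\<bar> \<le> e * B"
        using pos
      proof eventually_elim
        fix r :: real assume r: "0 \<le> r"
        have "exp (- r) * (b r)\<^sup>2 - p (exp (- r)) * b r = (g (exp (- r)) - p (exp (- r))) * b r"
          by (simp add: g_exp power2_eq_square algebra_simps)
        moreover have "\<bar>(g (exp (- r)) - p (exp (- r))) * b r\<bar> \<le> e * B"
          unfolding abs_mult using p(2)[of "exp (- r)"] r bound[of r] B e
          by (intro mult_mono) auto
        ultimately show "\<bar>exp (- max 0 r) * (b r)\<^sup>2 - p (exp (- max 0 r)) * b r\<bar> \<le> e * B"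
          using r by (simp add: max_def)
      qed
    qed (use int_b2 intp in auto)
    also have "\<dots> = e * B" using prob_space by simp
    finally show ?thesis .
  qed
  have "\<bar>\<integral>r. exp (- max 0 r) * (b r)\<^sup>2 \<partial>?\<mu>\<bar> \<le> 0 + e" if e: "0 < e" for e
  proof -
    \<comment> \<open>\<open>B + 1\<close> in the denominator covers the case
      \<open>B = 0\<close>.\<close>
    have "e / (B + 1) * B \<le> e"
      using B e by (simp add: divide_simps)
    then show ?thesis using small[of "e / (B + 1)"] e B by auto
  qed
  then have "\<bar>\<integral>r. exp (- max 0 r) * (b r)\<^sup>2 \<partial>?\<mu>\<bar> \<le> 0" by (rule field_le_epsilon)
  then have "(\<integral>r. exp (- max 0 r) * (b r)\<^sup>2 \<partial>?\<mu>) = 0" by (simp only: abs_le_zero_iff)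
  then have "AE r in ?\<mu>. exp (- max 0 r) * (b r)\<^sup>2 = 0"
    using int_b2 by (subst (asm) integral_nonneg_eq_0_iff_AE) auto
  then have "AE r in lborel. 0 < r \<longrightarrow> b r = 0"
    by (subst (asm) AE_density) (auto simp: exponential_density_def elim!: eventually_mono)
  then have "AE r in lborel. r \<notin> {r. 0 < r \<and> b r \<noteq> 0}"
    by eventually_elim auto
  moreover have meas: "{r. 0 < r \<and> b r \<noteq> 0} \<in> sets borel" by measurable
  ultimately have "{r. 0 < r \<and> b r \<noteq> 0} \<in> null_sets lborel"
    by (subst AE_iff_null_sets) auto
  then have "negligible {r. 0 < r \<and> b r \<noteq> 0}"
    by (simp add: negligible_iff_null_sets null_sets_completionI)
  \<comment> \<open>The set of positive times where \<open>b\<close> differs from 0 is null and, by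
    continuity, open, hence empty.\<close>
  moreover have "open {r. 0 < r \<and> b r \<noteq> 0}"
    by (intro open_Collect_conj open_Collect_less open_Collect_neq cont continuous_intros)
  ultimately have "{r. 0 < r \<and> b r \<noteq> 0} = {}"
    using open_not_negligible by blast
  then show ?thesis using s by blast
qed

section \<open>Maximization within a pre-Markov family\<close>

context dense_sequence begin

lemma coord_sets_law:
  assumes "P \<in> prob_measures (paths_topology t :: (real \<Rightarrow> 'e) topology)" "t \<le> s" "A \<in> sets borel"
  shows "{\<omega> \<in> paths t. \<omega> s \<in> A} \<in> sets P"
proof -
  have "(\<lambda>\<omega>. \<omega> s) -` A \<inter> space (coord_sigma t {t..}) \<in> sets (coord_sigma t {t..})"
    using assms by (intro measurable_sets[OF measurable_coord]) auto
  moreover have "(\<lambda>\<omega>. \<omega> s) -` A \<inter> paths t = {\<omega> \<in> paths t. \<omega> s \<in> A}" by auto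
  ultimately show ?thesis using sets_law[OF assms(1)] by simp
qed

section \<open>Distance of the initial state from a point\<close>

text \<open>On laws it vanishes exactly for those that start at \<open>y\<close>; truncated at 1, it
  is the integral of a bounded continuous function, hence weakly continuous.\<close>

definition start_gap :: "'e \<Rightarrow> (real \<Rightarrow> 'e) measure \<Rightarrow> real" where
  "start_gap y P = (\<integral>\<omega>. min 1 (dist (\<omega> 0) y) \<partial>P)"

lemma continuous_map_dist_coord: "continuous_map (paths_topology 0) euclideanreal (\<lambda>\<omega> :: real \<Rightarrow> 'e. min 1 (dist (\<omega> 0) y))"
proof -
  have "continuous_map euclidean euclideanreal (\<lambda>z. min 1 (dist z y))"
    by (auto intro!: continuous_intros)
  from continuous_map_compose[OF continuous_map_coord[of 0 0] this] show ?thesis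
    by (simp add: o_def)
qed

lemma continuous_map_start_gap: "continuous_map (path_law_space 0) euclideanreal (start_gap y)"
  unfolding start_gap_def
proof (rule continuous_map_weak_integral[OF continuous_map_dist_coord])
  show "bounded ((\<lambda>\<omega>. min 1 (dist (\<omega> 0) y)) ` topspace (paths_topology 0))"
    by (auto simp: bounded_iff intro!: exI[of _ 1])
qed

lemma measurable_dist_coord: "(\<lambda>\<omega> :: real \<Rightarrow> 'e. min 1 (dist (\<omega> 0) y)) \<in> borel_measurable (coord_sigma 0 {0..t})" if "0 \<le> t"
proof -
  have "(\<lambda>z. min 1 (dist z y)) \<in> borel_measurable borel"
    by (intro borel_measurable_continuous_onI continuous_intros)
  then show ?thesis
    using that by (intro measurable_compose[OF measurable_coord]) auto
qed

lemma integrable_dist_coord: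
  assumes P: "P \<in> prob_measures (paths_topology 0 :: (real \<Rightarrow> 'e) topology)"
  shows "integrable P (\<lambda>\<omega>. min 1 (dist (\<omega> 0) y))"
proof -
  interpret prob_space P by (rule prob_measuresD) fact
  show ?thesis
    using past_measurable_law[OF P measurable_dist_coord[of 0]]
    by (intro integrable_const_bound[where B=1]) auto
qed

text \<open>Lets the moving centre \<iota> x be replaced by points of the dense sequence.\<close>

lemma start_gap_lipschitz:
  assumes P: "P \<in> prob_measures (paths_topology 0)"
  shows "start_gap y P \<le> start_gap z P + dist y z"
proof -
  interpret prob_space P by (rule prob_measuresD) fact
  have "start_gap y P \<le> (\<integral>\<omega>. min 1 (dist (\<omega> 0) z) + dist y z \<partial>P)"
    unfolding start_gap_def
  proof (rule integral_mono)
    fix \<omega> :: "real \<Rightarrow> 'e"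
    show "min 1 (dist (\<omega> 0) y) \<le> min 1 (dist (\<omega> 0) z) + dist y z"
      using dist_triangle2[of "\<omega> 0" y z] unfolding min_def by (smt (verit) zero_le_dist)
  qed (use integrable_dist_coord[OF P] in auto)
  also have "\<dots> = start_gap z P + dist y z"
    using integrable_dist_coord[OF P] prob_space by (simp add: start_gap_def)
  finally show ?thesis .
qed

lemma start_gap_nonneg: "0 \<le> start_gap y P"
  unfolding start_gap_def by (rule Bochner_Integration.integral_nonneg) simp

text \<open>Trades a condition on a shifted law for the vanishing of a continuous functional of the
  original one.\<close>

lemma starts_at_shift_law_iff:
  assumes P: "P \<in> prob_measures (paths_topology 0 :: (real \<Rightarrow> 'e) topology)" and t: "0 \<le> t"
  shows "starts_at t y (shift_law t P) \<longleftrightarrow> start_gap y P = 0"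
proof -
  interpret prob_space P by (rule prob_measuresD) fact
  have sh: "shift_path t \<in> P \<rightarrow>\<^sub>M borel_of (paths_topology t)"
    using measurable_shift_path prob_measuresD(2)[OF P] by (simp cong: measurable_cong_sets)
  have "{\<eta> \<in> paths t. \<eta> t \<in> {y}} \<in> sets (shift_law t P)"
    by (rule coord_sets_law[OF shift_law_in_prob_measures[OF P]]) auto
  then have m: "{\<eta> \<in> paths t. \<eta> t = y} \<in> sets (borel_of (paths_topology t))"
    by (simp add: shift_law_def)
  have "measure (shift_law t P) {\<eta> \<in> paths t. \<eta> t = y} = measure P (shift_path t -` {\<eta> \<in> paths t. \<eta> t = y} \<inter> space P)"
    unfolding shift_law_def by (rule measure_distr[OF sh m])
  also have "shift_path t -` {\<eta> \<in> paths t. \<eta> t = y} \<inter> space P = {\<omega> \<in> paths 0. \<omega> 0 \<in> {y}}"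
    using reparam_in_paths[OF time_change_shift, of _ t]
    by (auto simp: space_law[OF P] shift_path_eq) (auto simp: reparam_def)
  finally have "starts_at t y (shift_law t P) \<longleftrightarrow> prob {\<omega> \<in> paths 0. \<omega> 0 \<in> {y}} = 1"
    by (simp add: starts_at_def)
  also have "\<dots> \<longleftrightarrow> (AE \<omega> in P. \<omega> \<in> {\<omega> \<in> paths 0. \<omega> 0 \<in> {y}})"
    by (rule prob_eq_1) (rule coord_sets_law[OF P], auto)
  also have "\<dots> \<longleftrightarrow> (AE \<omega> in P. min 1 (dist (\<omega> 0) y) = 0)"
    by (intro AE_cong) (auto simp: space_law[OF P] min_def)
  also have "\<dots> \<longleftrightarrow> start_gap y P = 0"
    unfolding start_gap_def using integrable_dist_coord[OF P]
    by (intro integral_nonneg_eq_0_iff_AE[symmetric]) auto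
  finally show ?thesis .
qed

text \<open>A function that does not change when the path is stopped at \<open>t\<close> factors
  through stopping, which is measurable from the past field.\<close>

lemma past_path_measurable:
  fixes D :: "(real \<Rightarrow> 'e) \<Rightarrow> real"
  assumes t: "0 \<le> t" and D: "D \<in> borel_measurable (coord_sigma 0 {0..})"
    and past: "\<And>\<omega>. \<omega> \<in> paths 0 \<Longrightarrow> D \<omega> = D (stop_path t \<omega>)"
  shows "D \<in> borel_measurable (coord_sigma 0 {0..t})"
proof -
  have "stop_path t \<in> coord_sigma 0 {0..t} \<rightarrow>\<^sub>M coord_sigma 0 {0..}"
    using t by (intro measurable_reparam time_change_stop) auto
  then have "(\<lambda>\<omega>. D (stop_path t \<omega>)) \<in> borel_measurable (coord_sigma 0 {0..t})"
    using D by (rule measurable_compose)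
  then show ?thesis
    using past by (subst measurable_cong[where g="\<lambda>\<omega>. D (stop_path t \<omega>)"]) auto
qed

section \<open>The functionals to be maximized\<close>

definition discount_functional :: "((real \<Rightarrow> 'e) measure \<Rightarrow> real) \<Rightarrow> bool" where
  "discount_functional J \<longleftrightarrow> (\<exists>l f L. 0 < l \<and> 0 < L \<and> (\<forall>y. 0 \<le> f y \<and> f y \<le> 1) \<and>
     (\<forall>x y. \<bar>f x - f y\<bar> \<le> L * dist x y) \<and> J = (\<lambda>P. \<integral>\<omega>. discounted l f \<omega> \<partial>P))"

lemma continuous_map_discount_functional:
  assumes "discount_functional J"
  shows "continuous_map (path_law_space 0) euclideanreal J"
proof -
  obtain l f L where *: "0 < l" "0 < L" "\<And>y. 0 \<le> f y \<and> f y \<le> 1" "\<And>x y. \<bar>f x - f y\<bar> \<le> L * dist x y"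
    and J: "J = (\<lambda>P. \<integral>\<omega>. discounted l f \<omega> \<partial>P)"
    using assms unfolding discount_functional_def by blast
  show ?thesis
    unfolding J
  proof (rule continuous_map_weak_integral)
    show "continuous_map (paths_topology 0) euclideanreal (discounted l f)"
      by (rule continuous_map_discounted[OF *(1,3,4,2)])
    show "bounded (discounted l f ` topspace (paths_topology 0))"
      using discounted_bounded[of l f, OF *(1,3)] by (auto simp: bounded_iff intro!: exI[of _ 1])
  qed
qed

lemma discount_functional_bounded:
  assumes "discount_functional J"
  shows "\<exists>b. \<forall>R\<in>prob_measures (paths_topology 0). \<bar>J R\<bar> \<le> b"
proof -
  obtain l f L where *: "0 < l" "0 < L" "\<And>y. 0 \<le> f y \<and> f y \<le> 1" "\<And>x y. \<bar>f x - f y\<bar> \<le> L * dist x y"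
    and J: "J = (\<lambda>P. \<integral>\<omega>. discounted l f \<omega> \<partial>P)"
    using assms unfolding discount_functional_def by blast
  have D: "0 \<le> discounted l f \<omega>" "discounted l f \<omega> \<le> 1" for \<omega>
    using discounted_bounded[of l f, OF *(1,3)] by auto
  have "\<bar>J R\<bar> \<le> 1" if R: "R \<in> prob_measures (paths_topology 0)" for R
  proof -
    interpret prob_space R by (rule prob_measuresD) fact
    have "discounted l f \<in> borel_measurable R"
      using continuous_map_borel_measurable[OF continuous_map_discounted[OF *(1,3,4,2)]] prob_measuresD(2)[OF R]
      by (simp cong: measurable_cong_sets)
    then have "integrable R (discounted l f)"
      using D by (intro integrable_const_bound[where B=1]) auto
    then have "J R \<le> 1" "0 \<le> J R"
      unfolding J using D by (auto intro!: integral_le_const Bochner_Integration.integral_nonneg)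
    then show ?thesis by simp
  qed
  then show ?thesis by blast
qed

text \<open>Both values split into the mean of a function of the past, the same for two laws that
  agree on the past, and \<open>c = exp (- t * l)\<close> times the mean of \<open>J\<close> over
  the conditional laws. Only the latter differ, and as functions of the past they can both be
  averaged under \<open>P\<close>.\<close>

lemma discount_functional_compare:
  assumes J: "discount_functional J" and t: "0 \<le> t"
  shows "\<exists>c>0. \<forall>P\<in>prob_measures (paths_topology 0). \<forall>R\<in>prob_measures (paths_topology 0). \<forall>Q Q'.
    (\<forall>A\<in>sets (coord_sigma 0 {0..t}). measure R A = measure P A) \<longrightarrow>
    conditional_kernel P t Q \<longrightarrow> conditional_kernel R t Q' \<longrightarrow>
    J R - J P = c * ((\<integral>\<omega>. J (unshift_law t (Q' \<omega>)) \<partial>P) - (\<integral>\<omega>. J (unshift_law t (Q \<omega>)) \<partial>P))"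
proof -
  obtain l f L where *: "0 < l" "0 < L" "\<And>y. 0 \<le> f y \<and> f y \<le> 1" "\<And>x y. \<bar>f x - f y\<bar> \<le> L * dist x y"
    and J_def: "J = (\<lambda>P. \<integral>\<omega>. discounted l f \<omega> \<partial>P)"
    using J unfolding discount_functional_def by blast
  have cont: "continuous_on UNIV f"
    using *(2,4) by (intro lipschitz_on_continuous_on[of L] lipschitz_onI) (auto simp: dist_real_def)
  let ?D = "discounted l f" and ?c = "exp (- t * l)"
  have Dm: "?D \<in> borel_measurable (coord_sigma 0 {0..})"
    using continuous_map_borel_measurable[OF continuous_map_discounted[OF *(1,3,4,2)]] sets_borel_of_paths[of 0]
    by (simp cong: measurable_cong_sets)
  have Db: "\<bar>?D \<omega>\<bar> \<le> 1" for \<omega> :: "real \<Rightarrow> 'e"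
    using discounted_bounded[of l f \<omega>, OF *(1,3)] by auto
  have DU: "(\<lambda>\<eta>. ?D (unshift_path t \<eta>)) \<in> borel_measurable (coord_sigma t {t..})"
    by (rule measurable_compose[OF measurable_reparam[OF time_change_unshift] Dm]) auto
  have Dfm: "(\<lambda>\<omega>. ?D (unshift_path t (future_path t \<omega>))) \<in> borel_measurable (coord_sigma 0 {0..})"
    by (rule measurable_compose[OF measurable_reparam[OF time_change_future[OF t]] DU]) (use t in auto)
  have fut: "unshift_path t (future_path t \<omega>) = unshift_path t \<omega>" for \<omega> :: "real \<Rightarrow> 'e"
    by (auto simp: reparam_def fun_eq_iff)
  \<comment> \<open>The contribution of the times before \<open>t\<close>, written as a difference
    to inherit measurability from the two discounted terms; the detour through
    \<open>future_path\<close> is the form to which the kernel applies.\<close>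
  define D1 where "D1 \<omega> = ?D \<omega> - ?c * ?D (unshift_path t (future_path t \<omega>))" for \<omega>
  have D1_past: "D1 \<in> borel_measurable (coord_sigma 0 {0..t})"
  proof (rule past_path_measurable[OF t])
    show "D1 \<in> borel_measurable (coord_sigma 0 {0..})"
      unfolding D1_def using Dm Dfm by measurable
    show "D1 \<omega> = D1 (stop_path t \<omega>)" if \<omega>: "\<omega> \<in> paths 0" for \<omega>
      unfolding D1_def fut
      by (rule discounted_past[OF *(1,3) cont t \<omega> reparam_in_paths[OF time_change_stop[OF t] \<omega>]])
        (auto simp: reparam_def)
  qed
  have split: "J R = (\<integral>\<omega>. D1 \<omega> \<partial>R) + ?c * (\<integral>\<omega>. J (unshift_law t (Q \<omega>)) \<partial>R)"
    if R: "R \<in> prob_measures (paths_topology 0)" and Q: "conditional_kernel R t Q" for R Q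
  proof -
    interpret R: prob_space R by (rule prob_measuresD) fact
    have bm: "g \<in> borel_measurable R" if "g \<in> borel_measurable (coord_sigma 0 {0..})" for g :: "(real \<Rightarrow> 'e) \<Rightarrow> real"
      using that sets_law[OF R] by (simp cong: measurable_cong_sets)
    have i1: "integrable R ?D"
      using Db by (intro R.integrable_const_bound[where B=1] bm Dm) auto
    have i2: "integrable R (\<lambda>\<omega>. ?D (unshift_path t (future_path t \<omega>)))"
      using Db by (intro R.integrable_const_bound[where B=1] bm Dfm) auto
    have "(\<integral>\<omega>. ?D (unshift_path t (future_path t \<omega>)) \<partial>R) = (\<integral>\<omega>. (\<integral>\<eta>. ?D (unshift_path t \<eta>) \<partial>Q \<omega>) \<partial>R)"
      using integral_conditional_kernel[OF t R Q DU, of 1] Db by simp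
    also have "\<dots> = (\<integral>\<omega>. J (unshift_law t (Q \<omega>)) \<partial>R)"
    proof (rule Bochner_Integration.integral_cong)
      fix \<omega> assume "\<omega> \<in> space R"
      then have Qpr: "Q \<omega> \<in> prob_measures (paths_topology t)"
        using Q conditional_kernel_space by (auto simp: conditional_kernel_def space_law[OF R])
      show "(\<integral>\<eta>. ?D (unshift_path t \<eta>) \<partial>Q \<omega>) = J (unshift_law t (Q \<omega>))"
        unfolding J_def unshift_law_def
      proof (rule integral_distr[symmetric])
        show "unshift_path t \<in> Q \<omega> \<rightarrow>\<^sub>M borel_of (paths_topology 0)"
          using measurable_unshift_path[of t] prob_measuresD(2)[OF Qpr] by (simp cong: measurable_cong_sets)
        show "?D \<in> borel_measurable (borel_of (paths_topology 0))"
          by (rule continuous_map_borel_measurable[OF continuous_map_discounted[OF *(1,3,4,2)]])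
      qed
    qed simp
    finally have "(\<integral>\<omega>. ?D (unshift_path t (future_path t \<omega>)) \<partial>R) = (\<integral>\<omega>. J (unshift_law t (Q \<omega>)) \<partial>R)" .
    then show ?thesis
      using i1 i2 by (simp add: D1_def J_def)
  qed
  show ?thesis
  proof (intro exI[of _ ?c] conjI ballI allI impI)
    fix P R Q Q'
    assume P: "P \<in> prob_measures (paths_topology 0 :: (real \<Rightarrow> 'e) topology)"
      and R: "R \<in> prob_measures (paths_topology 0 :: (real \<Rightarrow> 'e) topology)"
      and agree: "\<forall>A\<in>sets (coord_sigma 0 {0..t}). measure R A = measure P A"
      and Q: "conditional_kernel P t Q" and Q': "conditional_kernel R t Q'"
    have "(\<lambda>\<omega>. J (unshift_law t (Q' \<omega>))) \<in> borel_measurable (coord_sigma 0 {0..t})"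
    proof (rule measurable_compose[OF _ continuous_map_borel_measurable[OF continuous_map_discount_functional[OF J]]])
      show "(\<lambda>\<omega>. unshift_law t (Q' \<omega>)) \<in> coord_sigma 0 {0..t} \<rightarrow>\<^sub>M borel_of (path_law_space 0)"
        using Q' by (intro measurable_compose[OF _ continuous_map_measurable[OF continuous_map_unshift_law]])
          (auto simp: conditional_kernel_def)
    qed
    from integral_eq_of_past[OF P R _ this] integral_eq_of_past[OF P R _ D1_past]
    show "J R - J P = ?c * ((\<integral>\<omega>. J (unshift_law t (Q' \<omega>)) \<partial>P) - (\<integral>\<omega>. J (unshift_law t (Q \<omega>)) \<partial>P))"
      using agree split[OF P Q] split[OF R Q'] by (simp add: algebra_simps)
  qed simp
qed

end

section \<open>Families of laws over an embedded state space\<close>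

text \<open>\<open>\<kappa>\<close> reads a state of the path as an element of H in a Borel way,
  with arbitrary values outside the image of \<open>\<iota>\<close>.\<close>

locale state_embedding = dense_sequence a
  for a :: "nat \<Rightarrow> 'e::metric_space" +
  fixes \<iota> :: "'h::real_normed_vector \<Rightarrow> 'e" and \<kappa> :: "'e \<Rightarrow> 'h"
  assumes left_inverse: "\<And>x. \<kappa> (\<iota> x) = x"
    and embedding_measurable: "\<iota> \<in> borel \<rightarrow>\<^sub>M borel"
    and inverse_measurable: "\<kappa> \<in> borel \<rightarrow>\<^sub>M borel"
begin

abbreviation reconstruction_closed ::
    "('h \<Rightarrow> (real \<Rightarrow> 'e) measure set) \<Rightarrow> 'h \<Rightarrow> (real \<Rightarrow> 'e) measure \<Rightarrow> real \<Rightarrow> bool" where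
  "reconstruction_closed K x P t \<equiv> \<forall>Q. Q \<in> coord_sigma 0 {0..t} \<rightarrow>\<^sub>M borel_of (path_law_space t) \<longrightarrow>
     (AE \<omega> in P. starts_at t (\<omega> t) (Q \<omega>)) \<longrightarrow> selects \<iota> K P t Q \<longrightarrow> reconstruction P t Q \<in> K x"

end

text \<open>The null sets of excluded times become \<open>AE t in lebesgue\<close>, so that
  countably many of them combine by themselves. Of the metric, the Hausdorff property and
  measurability through hit sets are kept.\<close>

locale pre_Markov_family = state_embedding a \<iota> \<kappa>
  for a :: "nat \<Rightarrow> 'e::metric_space" and \<iota> :: "'h::real_normed_vector \<Rightarrow> 'e" and \<kappa> +
  fixes \<C> :: "'h \<Rightarrow> (real \<Rightarrow> 'e) measure set"
  assumes Hausdorff: "Hausdorff_space (path_law_space 0 :: (real \<Rightarrow> 'e) measure topology)"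
    and correspondence: "measurable_correspondence (path_law_space 0) borel \<C>"
    and disintegration: "\<And>x P. P \<in> \<C> x \<Longrightarrow> AE t in lebesgue. 0 < t \<longrightarrow> (\<exists>Q. rcpd P t Q \<and> selects \<iota> \<C> P t Q)"
    and reconstruction: "\<And>x P. P \<in> \<C> x \<Longrightarrow> AE t in lebesgue. 0 < t \<longrightarrow> reconstruction_closed \<C> x P t"
begin

text \<open>All versions that select from \<open>\<C>\<close> are required to select from
  \<open>K\<close>. A version obtained once from \<open>\<C>\<close> can thus be used at every
  stage, and in the limit.\<close>

abbreviation disintegrates_within :: "('h \<Rightarrow> (real \<Rightarrow> 'e) measure set) \<Rightarrow> (real \<Rightarrow> 'e) measure \<Rightarrow> real \<Rightarrow> bool" where
  "disintegrates_within K P t \<equiv> \<forall>Q. rcpd P t Q \<longrightarrow> selects \<iota> \<C> P t Q \<longrightarrow> selects \<iota> K P t Q"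

lemma laws_in_prob_measures:
  assumes "measurable_correspondence (path_law_space 0) borel K" "P \<in> K x"
  shows "P \<in> prob_measures (paths_topology 0)"
proof -
  have "compactin (path_law_space 0) (K x)"
    using assms by (auto simp: measurable_correspondence_def compacts_def)
  then show ?thesis
    using compactin_subset_topspace assms(2) by fastforce
qed

text \<open>Nothing forces the laws in \<^term>\<open>\<C> x\<close> to start at \<^term>\<open>\<iota> x\<close>. Those which start as close to
  \<^term>\<open>\<iota> x\<close> as possible form a smaller family, in which the laws met by disintegration do start at
  their state.\<close>

definition starting :: "'h \<Rightarrow> (real \<Rightarrow> 'e) measure set" where
  "starting = argmax (\<lambda>x P. - start_gap (\<iota> x) P) \<C>"

lemma starting_subset: "starting x \<subseteq> \<C> x"
  by (auto simp: starting_def argmax_def)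

text \<open>The objective moves with x, so its level sets are not one closed set of laws. Up to an
  error \<open>1 / Suc n\<close> the point \<iota> x is replaced by a nearby \<open>a k\<close>, for
  which they are; countably many \<open>k\<close> and \<open>n\<close> then describe the level sets
  exactly.\<close>

lemma correspondence_starting: "measurable_correspondence (path_law_space 0) borel starting"
  unfolding starting_def
proof (rule measurable_correspondence_argmax[OF correspondence])
  let ?X = "path_law_space 0 :: (real \<Rightarrow> 'e) measure topology"
  show "continuous_map ?X euclideanreal (\<lambda>P. - start_gap (\<iota> x) P)" for x
    by (intro continuous_map_minus continuous_map_start_gap)
  fix F and q :: real assume F: "closedin ?X F"
  let ?N = "\<lambda>k r. {x. \<C> x \<inter> (F \<inter> {P \<in> topspace ?X. r \<le> - start_gap (a k) P}) \<noteq> {}}"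
  have N: "?N k r \<in> sets borel" for k r
  proof -
    have "closedin ?X {P \<in> topspace ?X. start_gap (a k) P \<le> - r}"
      using continuous_map_start_gap[of "a k"] by (simp add: continuous_map_upper_lower_semicontinuous_le)
    then have "closedin ?X {P \<in> topspace ?X. r \<le> - start_gap (a k) P}"
      by (simp add: le_minus_iff)
    then have "closedin ?X (F \<inter> {P \<in> topspace ?X. r \<le> - start_gap (a k) P})"
      using F by (intro closedin_Int)
    then show ?thesis
      using correspondence by (simp add: measurable_correspondence_def)
  qed
  have "{x. \<exists>P\<in>\<C> x \<inter> F. q \<le> - start_gap (\<iota> x) P} =
      (\<Inter>n. \<Union>k. {x. dist (\<iota> x) (a k) < 1 / real (Suc n)} \<inter> ?N k (q - 1 / real (Suc n)))"
  proof (intro equalityI subsetI)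
    fix x assume "x \<in> {x. \<exists>P\<in>\<C> x \<inter> F. q \<le> - start_gap (\<iota> x) P}"
    then obtain P where P: "P \<in> \<C> x" "P \<in> F" "q \<le> - start_gap (\<iota> x) P" by auto
    have Ppr: "P \<in> prob_measures (paths_topology 0)" by (rule laws_in_prob_measures[OF correspondence P(1)])
    have "\<exists>k. dist (\<iota> x) (a k) < 1 / real (Suc n) \<and> x \<in> ?N k (q - 1 / real (Suc n))" for n
    proof -
      obtain k where k: "dist (\<iota> x) (a k) < 1 / real (Suc n)" using dense[of "1 / real (Suc n)" "\<iota> x"] by auto
      have "q - 1 / real (Suc n) \<le> - start_gap (a k) P"
        using start_gap_lipschitz[OF Ppr, of "a k" "\<iota> x"] k P(3) dist_commute[of "a k" "\<iota> x"] by argo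
      then show ?thesis using k P Ppr by (intro exI[of _ k]) auto
    qed
    then show "x \<in> (\<Inter>n. \<Union>k. {x. dist (\<iota> x) (a k) < 1 / real (Suc n)} \<inter> ?N k (q - 1 / real (Suc n)))"
      by blast
  next
    fix x assume x: "x \<in> (\<Inter>n. \<Union>k. {x. dist (\<iota> x) (a k) < 1 / real (Suc n)} \<inter> ?N k (q - 1 / real (Suc n)))"
    have near: "\<exists>P\<in>\<C> x \<inter> F. q - 2 * (1 / real (Suc n)) \<le> - start_gap (\<iota> x) P" for n
    proof -
      from x obtain k P where k: "dist (\<iota> x) (a k) < 1 / real (Suc n)"
        and P: "P \<in> \<C> x \<inter> F" "q - 1 / real (Suc n) \<le> - start_gap (a k) P" by blast
      have "P \<in> prob_measures (paths_topology 0)" using laws_in_prob_measures[OF correspondence] P by blast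
      from start_gap_lipschitz[OF this, of "\<iota> x" "a k"]
      have "q - 2 * (1 / real (Suc n)) \<le> - start_gap (\<iota> x) P" using k P(2) by argo
      then show ?thesis using P(1) by (rule bexI)
    qed
    \<comment> \<open>The approximate levels come from a different law for each \<open>n\<close>; a
      maximizer over the compact set \<open>\<C> x \<inter> F\<close> dominates them all, so that
      the error can go to 0.\<close>
    have "compactin ?X (\<C> x \<inter> F)"
      using correspondence F by (intro compact_Int_closedin) (auto simp: measurable_correspondence_def compacts_def)
    then obtain P where P: "P \<in> \<C> x \<inter> F" "\<forall>R\<in>\<C> x \<inter> F. - start_gap (\<iota> x) R \<le> - start_gap (\<iota> x) P"
      using near[of 0] compactin_attains_sup[OF _ _ continuous_map_minus[OF continuous_map_start_gap[of "\<iota> x"]]]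
      by blast
    have "q \<le> - start_gap (\<iota> x) P"
    proof (rule LIMSEQ_le_const2)
      have "(\<lambda>n. q - 2 * (1 / real (Suc n))) \<longlonglongrightarrow> q - 2 * 0"
        by (intro tendsto_intros LIMSEQ_Suc[OF lim_1_over_n])
      then show "(\<lambda>n. q - 2 * (1 / real (Suc n))) \<longlonglongrightarrow> q" by simp
      show "\<exists>N. \<forall>n\<ge>N. q - 2 * (1 / real (Suc n)) \<le> - start_gap (\<iota> x) P"
      proof (intro exI allI impI)
        fix n
        obtain R where "R \<in> \<C> x \<inter> F" "q - 2 * (1 / real (Suc n)) \<le> - start_gap (\<iota> x) R"
          using near[of n] by blast
        with P(2) show "q - 2 * (1 / real (Suc n)) \<le> - start_gap (\<iota> x) P"
          by (meson order_trans)
      qed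
    qed
    then show "x \<in> {x. \<exists>P\<in>\<C> x \<inter> F. q \<le> - start_gap (\<iota> x) P}" using P(1) by blast
  qed
  also have "\<dots> \<in> sets borel"
  proof -
    have "{x. dist (\<iota> x) (a k) < 1 / real (Suc n)} \<in> sets borel" for n k
    proof -
      have "(\<lambda>z. dist z (a k)) \<in> borel_measurable borel"
        by (intro borel_measurable_continuous_onI continuous_intros)
      from measurable_compose[OF embedding_measurable this]
      have [measurable]: "(\<lambda>x. dist (\<iota> x) (a k)) \<in> borel_measurable borel" .
      show ?thesis by measurable
    qed
    then show ?thesis
      using N by (intro sets.countable_INT sets.countable_UN image_subsetI sets.Int) auto
  qed
  finally show "{x \<in> space borel. \<exists>P\<in>\<C> x \<inter> F. q \<le> - start_gap (\<iota> x) P} \<in> sets borel" by simp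
qed

text \<open>The gap is non-negative, so one law in \<open>\<C> x\<close> that starts at \<iota> x is
  a maximizer and forces every other maximizer to start there too.\<close>

lemma starting_of_gap_zero:
  assumes "R \<in> \<C> x" "start_gap (\<iota> x) R = 0"
  shows "R \<in> starting x" "\<And>S. S \<in> starting x \<Longrightarrow> start_gap (\<iota> x) S = 0"
proof -
  show "R \<in> starting x"
    using assms start_gap_nonneg by (auto simp: starting_def argmax_def)
  fix S assume "S \<in> starting x"
  then have "start_gap (\<iota> x) S \<le> start_gap (\<iota> x) R"
    using assms(1) by (auto simp: starting_def argmax_def)
  then show "start_gap (\<iota> x) S = 0"
    using assms(2) start_gap_nonneg[of "\<iota> x" S] by simp
qed

text \<open>A regular conditional law starts at the current state. So at the states met by
  disintegration \<open>\<C>\<close> does contain a law that starts correctly, and then all laws in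
  \<open>starting\<close> do.\<close>

lemma rcpd_selects_starting:
  assumes t: "0 < t" and Q: "rcpd P t Q" and N: "\<forall>\<omega>\<in>paths 0 - N. \<exists>h. \<omega> t = \<iota> h \<and> Q \<omega> \<in> shift_law t ` \<C> h"
    and \<omega>: "\<omega> \<in> paths 0 - N"
  shows "\<exists>h. \<omega> t = \<iota> h \<and> Q \<omega> \<in> shift_law t ` starting h \<and> (\<forall>S\<in>starting h. starts_at t (\<omega> t) (shift_law t S))"
proof -
  obtain h R where h: "\<omega> t = \<iota> h" "R \<in> \<C> h" "Q \<omega> = shift_law t R"
    using N \<omega> by blast
  have "starts_at t (\<iota> h) (shift_law t R)"
    using Q \<omega> h unfolding rcpd_def by auto
  then have gap: "start_gap (\<iota> h) R = 0"
    using starts_at_shift_law_iff[OF laws_in_prob_measures[OF correspondence h(2)]] t by auto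
  note st = starting_of_gap_zero[OF h(2) gap]
  have "starts_at t (\<iota> h) (shift_law t S)" if "S \<in> starting h" for S
    using starts_at_shift_law_iff[OF laws_in_prob_measures[OF correspondence_starting that]] st(2)[OF that] t by auto
  then show ?thesis using h st(1) by auto
qed

text \<open>The invariant of the iteration. Being inside \<open>starting\<close> is what allows a
  law chosen from \<open>K\<close> to replace a conditional law: it starts at the state where the
  past ends.\<close>

definition Markovian :: "('h \<Rightarrow> (real \<Rightarrow> 'e) measure set) \<Rightarrow> bool" where
  "Markovian K \<longleftrightarrow> measurable_correspondence (path_law_space 0) borel K \<and> (\<forall>x. K x \<subseteq> starting x) \<and>
    (\<forall>x. \<forall>P\<in>K x. AE t in lebesgue. 0 < t \<longrightarrow> disintegrates_within K P t) \<and>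
    (\<forall>x. \<forall>P\<in>K x. AE t in lebesgue. 0 < t \<longrightarrow>
      reconstruction_closed K x P t)"

lemma selects_mono:
  assumes "selects \<iota> K P t Q" "\<And>x. K x \<subseteq> L x" shows "selects \<iota> L P t Q"
  using assms unfolding selects_def by (meson image_mono subsetD)

text \<open>Reconstruction does not touch the past, in particular not the initial law; so it keeps
  the distance from \<iota> x, and with it minimality.\<close>

lemma Markovian_starting: "Markovian starting"
  unfolding Markovian_def
proof (intro conjI allI ballI correspondence_starting order_refl)
  fix x P assume P: "P \<in> starting x"
  have Ppr: "P \<in> prob_measures (paths_topology 0)" by (rule laws_in_prob_measures[OF correspondence_starting P])
  show "AE t in lebesgue. 0 < t \<longrightarrow> disintegrates_within starting P t"
  proof (intro always_eventually allI impI)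
    fix t Q assume "0 < t" "rcpd P t Q" "selects \<iota> \<C> P t Q"
    then show "selects \<iota> starting P t Q"
      using rcpd_selects_starting[of t P Q] unfolding selects_def by meson
  qed
  from P have "P \<in> \<C> x" using starting_subset by blast
  from reconstruction[OF this] show "AE t in lebesgue. 0 < t \<longrightarrow>
      reconstruction_closed starting x P t"
  proof (rule eventually_mono, intro impI allI)
    fix t Q
    assume rec: "0 < t \<longrightarrow> reconstruction_closed \<C> x P t"
      and t: "0 < t" and Q: "Q \<in> coord_sigma 0 {0..t} \<rightarrow>\<^sub>M borel_of (path_law_space t)"
      and st: "AE \<omega> in P. starts_at t (\<omega> t) (Q \<omega>)" and sel: "selects \<iota> starting P t Q"
    let ?R = "reconstruction P t Q"
    have RC: "?R \<in> \<C> x" using rec t Q st selects_mono[OF sel starting_subset] by blast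
    note R = reconstruction_properties[OF less_imp_le[OF t] Ppr Q st]
    have "start_gap (\<iota> x) ?R = start_gap (\<iota> x) P"
      unfolding start_gap_def
      by (rule integral_eq_of_past[OF Ppr R(1,2) measurable_dist_coord]) (use t in auto)
    then show "?R \<in> starting x"
      using P RC by (simp add: starting_def argmax_def)
  qed
qed

lemma Markovian_correspondence: "Markovian K \<Longrightarrow> measurable_correspondence (path_law_space 0) borel K"
  by (simp add: Markovian_def)

lemma measurable_selection_law:
  assumes "measurable_correspondence (path_law_space 0) borel K"
  shows "\<exists>S. S \<in> borel \<rightarrow>\<^sub>M borel_of (path_law_space 0 :: (real \<Rightarrow> 'e) measure topology) \<and> (\<forall>x. S x \<in> K x)"
proof -
  obtain G :: "nat \<Rightarrow> (real \<Rightarrow> 'e) measure \<Rightarrow> real"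
    where G: "\<And>k. continuous_map (path_law_space 0) euclideanreal (G k)"
      "\<And>P R. P \<in> prob_measures (paths_topology 0) \<Longrightarrow> R \<in> prob_measures (paths_topology 0) \<Longrightarrow> (\<forall>k. G k P = G k R) \<Longrightarrow> P = R"
    using countable_separating_functionals[of 0] by blast
  have "\<exists>S. S \<in> borel \<rightarrow>\<^sub>M borel_of (path_law_space 0 :: (real \<Rightarrow> 'e) measure topology) \<and> (\<forall>x\<in>space borel. S x \<in> K x)"
  proof (rule measurable_selection[where G=G, OF Hausdorff assms G(1)])
    fix P R :: "(real \<Rightarrow> 'e) measure"
    assume "P \<in> topspace (path_law_space 0)" "R \<in> topspace (path_law_space 0)" "\<And>n. G n P = G n R"
    then show "P = R" by (intro G(2)) simp_all
  qed
  then show ?thesis by simp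
qed

section \<open>Replacing conditional laws by selected maximizers\<close>

lemma measurable_past_state:
  assumes "0 \<le> t" shows "(\<lambda>\<omega>. \<kappa> (\<omega> t)) \<in> coord_sigma 0 {0..t} \<rightarrow>\<^sub>M borel"
  using assms by (intro measurable_compose[OF measurable_coord inverse_measurable]) auto

lemma measurable_shifted_selection:
  assumes "0 \<le> t" "S \<in> borel \<rightarrow>\<^sub>M borel_of (path_law_space 0)"
  shows "(\<lambda>\<omega>. shift_law t (S (\<kappa> (\<omega> t)))) \<in> coord_sigma 0 {0..t} \<rightarrow>\<^sub>M borel_of (path_law_space t)"
  by (rule measurable_compose[OF measurable_compose[OF measurable_past_state[OF assms(1)] assms(2)]
        continuous_map_measurable[OF continuous_map_shift_law]])

lemma past_null_AE:
  assumes "P \<in> prob_measures (paths_topology 0 :: (real \<Rightarrow> 'e) topology)"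
    "N \<in> sets (coord_sigma 0 {0..t})" "emeasure P N = 0"
  shows "AE \<omega> in P. \<omega> \<in> paths 0 - N"
proof -
  have "N \<in> null_sets P" using past_sets_law[OF assms(1,2)] assms(3) by (simp add: null_sets_def)
  then have "AE \<omega> in P. \<omega> \<notin> N" by (rule AE_not_in)
  then show ?thesis
    using AE_space by eventually_elim (simp add: space_law[OF assms(1)])
qed

text \<open>If the conditional laws of a maximizer of \<^term>\<open>J\<close> were not maximizers with positive
  probability, replacing them by maximizers would increase \<^term>\<open>J\<close> within \<^term>\<open>K x\<close>.\<close>

lemma argmax_disintegration:
  assumes K: "Markovian K" and J: "discount_functional J" and P: "P \<in> argmax (\<lambda>_. J) K x"
    and t: "0 < t" and Q: "rcpd P t Q" and sel\<C>: "selects \<iota> \<C> P t Q"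
    and selK: "selects \<iota> K P t Q"
    and rec: "\<And>Q. Q \<in> coord_sigma 0 {0..t} \<rightarrow>\<^sub>M borel_of (path_law_space t) \<Longrightarrow>
        (AE \<omega> in P. starts_at t (\<omega> t) (Q \<omega>)) \<Longrightarrow> selects \<iota> K P t Q \<Longrightarrow> reconstruction P t Q \<in> K x"
  shows "selects \<iota> (argmax (\<lambda>_. J) K) P t Q"
proof -
  let ?K' = "argmax (\<lambda>_. J) K" and ?B = "coord_sigma 0 {0..t} :: (real \<Rightarrow> 'e) measure"
  note Kmc = Markovian_correspondence[OF K]
  have Ppr: "P \<in> prob_measures (paths_topology 0)"
    using P by (intro laws_in_prob_measures[OF Kmc, of _ x]) (simp add: argmax_def)
  interpret P: prob_space P by (rule prob_measuresD) fact
  have Jc: "continuous_map (path_law_space 0) euclideanreal J"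
    by (rule continuous_map_discount_functional[OF J])
  obtain S where S: "S \<in> borel \<rightarrow>\<^sub>M borel_of (path_law_space 0 :: (real \<Rightarrow> 'e) measure topology)" "\<And>y. S y \<in> ?K' y"
    using measurable_selection_law[OF measurable_correspondence_argmax_const[OF Kmc Jc]] by blast
  have Spr: "S y \<in> prob_measures (paths_topology 0)" for y
    using S(2)[of y] by (intro laws_in_prob_measures[OF Kmc, of _ y]) (simp add: argmax_def)
  have Qk: "conditional_kernel P t Q" and Qm: "Q \<in> ?B \<rightarrow>\<^sub>M borel_of (path_law_space t)"
    and Qst: "\<And>\<omega>. \<omega> \<in> paths 0 \<Longrightarrow> starts_at t (\<omega> t) (Q \<omega>)"
    using Q by (auto simp: rcpd_def conditional_kernel_def)
  obtain N1 where N1: "N1 \<in> sets ?B" "emeasure P N1 = 0"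
    "\<forall>\<omega>\<in>paths 0 - N1. \<exists>h. \<omega> t = \<iota> h \<and> Q \<omega> \<in> shift_law t ` \<C> h"
    using sel\<C> by (auto simp: selects_def)
  obtain N2 where N2: "N2 \<in> sets ?B" "emeasure P N2 = 0"
    "\<forall>\<omega>\<in>paths 0 - N2. \<exists>h. \<omega> t = \<iota> h \<and> Q \<omega> \<in> shift_law t ` K h"
    using selK by (auto simp: selects_def)
  define N where "N = N1 \<union> N2"
  have N: "N \<in> sets ?B" "emeasure P N = 0"
    using N1(1,2) N2(1,2) past_sets_law[OF Ppr N1(1)] past_sets_law[OF Ppr N2(1)]
    by (auto simp: N_def intro: emeasure_Un_null_set[THEN trans] simp: null_sets_def)
  \<comment> \<open>Off \<open>N\<close> the state lies in H, the conditional law is a shifted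
    member of \<open>K\<close>, and the law selected by \<open>S\<close> starts at that state. As
    \<iota> is injective, the elements of H supplied by \<open>N1\<close> and by \<open>N2\<close>
    coincide.\<close>
  have state: "\<exists>R. \<omega> t = \<iota> (\<kappa> (\<omega> t)) \<and> Q \<omega> = shift_law t R \<and> R \<in> K (\<kappa> (\<omega> t)) \<and>
      starts_at t (\<omega> t) (shift_law t (S (\<kappa> (\<omega> t))))" if \<omega>: "\<omega> \<in> paths 0 - N" for \<omega>
  proof -
    have "\<omega> \<in> paths 0 - N2" using \<omega> by (simp add: N_def)
    then obtain h R where h: "\<omega> t = \<iota> h" "Q \<omega> = shift_law t R" "R \<in> K h"
      using N2(3) by blast
    obtain h' where h': "\<omega> t = \<iota> h'" "\<forall>S\<in>starting h'. starts_at t (\<omega> t) (shift_law t S)"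
      using rcpd_selects_starting[OF t Q N1(3), of \<omega>] \<omega> by (auto simp: N_def)
    have eq: "\<kappa> (\<omega> t) = h" "h' = h"
      using h(1) h'(1) left_inverse by metis+
    have "S h \<in> starting h"
      using S(2)[of h] K by (auto simp: argmax_def Markovian_def)
    then show ?thesis using h h' eq by auto
  qed
  define jQ where "jQ \<omega> = J (unshift_law t (Q \<omega>))" for \<omega>
  define jS where "jS \<omega> = J (S (\<kappa> (\<omega> t)))" for \<omega> :: "real \<Rightarrow> 'e"
  note JM = continuous_map_borel_measurable[OF Jc]
  have jQm: "jQ \<in> borel_measurable ?B"
    unfolding jQ_def
    by (rule measurable_compose[OF measurable_compose[OF Qm continuous_map_measurable[OF continuous_map_unshift_law]] JM])
  have jSm: "jS \<in> borel_measurable ?B"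
    unfolding jS_def using t
    by (intro measurable_compose[OF measurable_compose[OF measurable_past_state S(1)] JM]) simp
  have jle: "jQ \<omega> \<le> jS \<omega>" if \<omega>: "\<omega> \<in> paths 0 - N" for \<omega>
  proof -
    obtain R where R: "Q \<omega> = shift_law t R" "R \<in> K (\<kappa> (\<omega> t))" using state[OF \<omega>] by blast
    then have "jQ \<omega> = J R"
      using unshift_shift_law[OF laws_in_prob_measures[OF Kmc R(2)]] by (simp add: jQ_def)
    then show ?thesis using S(2)[of "\<kappa> (\<omega> t)"] R(2) by (simp add: jS_def argmax_def)
  qed
  \<comment> \<open>The event that the conditional law is not optimal. It belongs to the past, so
    switching to \<open>S\<close> on it gives an admissible kernel.\<close>
  define B where "B = {\<omega> \<in> space ?B. jQ \<omega> < jS \<omega>} - N"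
  have B: "B \<in> sets ?B"
    unfolding B_def using jQm jSm N(1) by measurable
  have B': "B \<inter> space ?B \<in> sets ?B"
    by (rule sets.Int[OF B sets.top])
  define Q' where "Q' \<omega> = (if \<omega> \<in> B then shift_law t (S (\<kappa> (\<omega> t))) else Q \<omega>)" for \<omega>
  have Q'm: "Q' \<in> ?B \<rightarrow>\<^sub>M borel_of (path_law_space t)"
    unfolding Q'_def using t by (intro measurable_If_set[OF _ _ B'] measurable_shifted_selection S(1) Qm) simp
  note AE_N = past_null_AE[OF Ppr N]
  have Q'st: "AE \<omega> in P. starts_at t (\<omega> t) (Q' \<omega>)"
    using AE_N
  proof eventually_elim
    fix \<omega> assume \<omega>: "\<omega> \<in> paths 0 - N"
    then show "starts_at t (\<omega> t) (Q' \<omega>)"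
      using state[OF \<omega>] Qst[of \<omega>] by (auto simp: Q'_def)
  qed
  have "selects \<iota> K P t Q'"
    unfolding selects_def
  proof (intro bexI[of _ N] conjI N ballI)
    fix \<omega> assume \<omega>: "\<omega> \<in> paths 0 - N"
    have "S (\<kappa> (\<omega> t)) \<in> K (\<kappa> (\<omega> t))" using S(2) by (simp add: argmax_def)
    then show "\<exists>h. \<omega> t = \<iota> h \<and> Q' \<omega> \<in> shift_law t ` K h"
      using state[OF \<omega>] by (auto simp: Q'_def intro!: exI[of _ "\<kappa> (\<omega> t)"])
  qed
  with rec[OF Q'm Q'st] have RK: "reconstruction P t Q' \<in> K x" .
  note R = reconstruction_properties[OF less_imp_le[OF t] Ppr Q'm Q'st]
  obtain c where c: "0 < c" "J (reconstruction P t Q') - J P =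
      c * ((\<integral>\<omega>. J (unshift_law t (Q' \<omega>)) \<partial>P) - (\<integral>\<omega>. jQ \<omega> \<partial>P))"
    using discount_functional_compare[OF J less_imp_le[OF t]] Ppr R Qk unfolding jQ_def by blast
  have jQ': "J (unshift_law t (Q' \<omega>)) = (if \<omega> \<in> B then jS \<omega> else jQ \<omega>)" for \<omega>
    by (simp add: Q'_def jQ_def jS_def unshift_shift_law[OF Spr])
  have "J (reconstruction P t Q') \<le> J P"
    using RK P by (simp add: argmax_def)
  then have le: "(\<integral>\<omega>. (if \<omega> \<in> B then jS \<omega> else jQ \<omega>) \<partial>P) \<le> (\<integral>\<omega>. jQ \<omega> \<partial>P)"
    using c by (simp add: jQ' mult_le_0_iff zero_less_mult_iff) (smt (verit) mult_pos_pos)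
  obtain b where b: "\<And>R. R \<in> prob_measures (paths_topology 0) \<Longrightarrow> \<bar>J R\<bar> \<le> b"
    using discount_functional_bounded[OF J] by blast
  have jQb: "\<bar>jQ \<omega>\<bar> \<le> b" if "\<omega> \<in> paths 0" for \<omega>
    unfolding jQ_def by (intro b unshift_law_in_prob_measures conditional_kernel_space[OF Qm that])
  have jSb: "\<bar>jS \<omega>\<bar> \<le> b" for \<omega>
    unfolding jS_def by (intro b Spr)
  have intQ: "integrable P jQ"
    using jQb by (intro P.integrable_const_bound[where B=b] past_measurable_law[OF Ppr jQm] AE_I2) (simp add: space_law[OF Ppr])
  have intQ': "integrable P (\<lambda>\<omega>. if \<omega> \<in> B then jS \<omega> else jQ \<omega>)"
  proof (rule P.integrable_const_bound[where B=b])
    show "AE \<omega> in P. norm (if \<omega> \<in> B then jS \<omega> else jQ \<omega>) \<le> b"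
      using jQb jSb by (intro AE_I2) (simp add: space_law[OF Ppr])
    show "(\<lambda>\<omega>. if \<omega> \<in> B then jS \<omega> else jQ \<omega>) \<in> borel_measurable P"
      by (rule past_measurable_law[OF Ppr measurable_If_set[OF jSm jQm B']])
  qed
  \<comment> \<open>The integrand is non-negative, and maximality of \<open>P\<close> makes its mean
    at most 0; hence it vanishes almost surely and \<open>B\<close> is null.\<close>
  have "(\<integral>\<omega>. (if \<omega> \<in> B then jS \<omega> else jQ \<omega>) - jQ \<omega> \<partial>P) = 0"
  proof (rule antisym)
    show "(\<integral>\<omega>. (if \<omega> \<in> B then jS \<omega> else jQ \<omega>) - jQ \<omega> \<partial>P) \<le> 0"
      using le intQ intQ' by simp
    show "0 \<le> (\<integral>\<omega>. (if \<omega> \<in> B then jS \<omega> else jQ \<omega>) - jQ \<omega> \<partial>P)"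
      by (rule Bochner_Integration.integral_nonneg) (auto simp: B_def)
  qed
  then have "AE \<omega> in P. (if \<omega> \<in> B then jS \<omega> else jQ \<omega>) - jQ \<omega> = 0"
    using intQ intQ' by (subst (asm) integral_nonneg_eq_0_iff_AE) (auto simp: B_def)
  then have "AE \<omega> in P. \<omega> \<notin> B"
  proof eventually_elim
    fix \<omega> assume *: "(if \<omega> \<in> B then jS \<omega> else jQ \<omega>) - jQ \<omega> = 0"
    show "\<omega> \<notin> B"
    proof
      assume B: "\<omega> \<in> B"
      then have "jS \<omega> - jQ \<omega> = 0" using * by simp
      then show False using B by (simp add: B_def)
    qed
  qed
  then have B0: "B \<in> null_sets P"
    using past_sets_law[OF Ppr B] by (simp add: AE_iff_null_sets)
  show ?thesis
    unfolding selects_def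
  proof (intro bexI[of _ "N \<union> B"] conjI ballI)
    show "N \<union> B \<in> sets ?B" using N(1) B by auto
    show "emeasure P (N \<union> B) = 0"
      using emeasure_Un_null_set[OF past_sets_law[OF Ppr N(1)] B0] N(2) by simp
    fix \<omega> assume \<omega>: "\<omega> \<in> paths 0 - (N \<union> B)"
    then obtain R where R: "\<omega> t = \<iota> (\<kappa> (\<omega> t))" "Q \<omega> = shift_law t R" "R \<in> K (\<kappa> (\<omega> t))"
      using state[of \<omega>] by blast
    have "jS \<omega> \<le> jQ \<omega>" using \<omega> by (auto simp: B_def)
    moreover have "jQ \<omega> = J R"
      using unshift_shift_law[OF laws_in_prob_measures[OF Kmc R(3)]] by (simp add: jQ_def R(2))
    ultimately have "R \<in> ?K' (\<kappa> (\<omega> t))"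
      using S(2)[of "\<kappa> (\<omega> t)"] R(3) by (auto simp: argmax_def jS_def intro: order_trans)
    then show "\<exists>h. \<omega> t = \<iota> h \<and> Q \<omega> \<in> shift_law t ` ?K' h"
      using R by (intro exI[of _ "\<kappa> (\<omega> t)"]) auto
  qed
qed

text \<open>Two maximizers at the same state have the same \<open>J\<close>. So \<open>Q\<close> and
  the kernel \<open>Q0\<close> of \<open>P\<close> itself have equal means of \<open>J\<close>, and
  the reconstructed law attains \<open>J P\<close>, the maximum over \<open>K x\<close>.\<close>

lemma argmax_reconstruction:
  assumes K: "Markovian K" and J: "discount_functional J" and P: "P \<in> argmax (\<lambda>_. J) K x" and t: "0 < t"
    and Q0: "conditional_kernel P t Q0" and sel0: "selects \<iota> (argmax (\<lambda>_. J) K) P t Q0"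
    and Q: "Q \<in> coord_sigma 0 {0..t} \<rightarrow>\<^sub>M borel_of (path_law_space t)"
    and st: "AE \<omega> in P. starts_at t (\<omega> t) (Q \<omega>)" and sel: "selects \<iota> (argmax (\<lambda>_. J) K) P t Q"
    and rec: "reconstruction P t Q \<in> K x"
  shows "reconstruction P t Q \<in> argmax (\<lambda>_. J) K x"
proof -
  let ?K' = "argmax (\<lambda>_. J) K"
  note Kmc = Markovian_correspondence[OF K]
  have Ppr: "P \<in> prob_measures (paths_topology 0)"
    using P by (intro laws_in_prob_measures[OF Kmc, of _ x]) (simp add: argmax_def)
  note R = reconstruction_properties[OF less_imp_le[OF t] Ppr Q st]
  obtain c where c: "J (reconstruction P t Q) - J P =
      c * ((\<integral>\<omega>. J (unshift_law t (Q \<omega>)) \<partial>P) - (\<integral>\<omega>. J (unshift_law t (Q0 \<omega>)) \<partial>P))"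
    using discount_functional_compare[OF J less_imp_le[OF t]] Ppr R Q0 by blast
  have JM: "(\<lambda>\<omega>. J (unshift_law t (Q1 \<omega>))) \<in> borel_measurable P"
    if "Q1 \<in> coord_sigma 0 {0..t} \<rightarrow>\<^sub>M borel_of (path_law_space t)" for Q1
    by (rule past_measurable_law[OF Ppr measurable_compose[OF measurable_compose[OF that
        continuous_map_measurable[OF continuous_map_unshift_law]]
        continuous_map_borel_measurable[OF continuous_map_discount_functional[OF J]]]])
  obtain N where N: "N \<in> sets (coord_sigma 0 {0..t})" "emeasure P N = 0"
    "\<forall>\<omega>\<in>paths 0 - N. \<exists>h. \<omega> t = \<iota> h \<and> Q \<omega> \<in> shift_law t ` ?K' h"
    using sel by (auto simp: selects_def)
  obtain N0 where N0: "N0 \<in> sets (coord_sigma 0 {0..t})" "emeasure P N0 = 0"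
    "\<forall>\<omega>\<in>paths 0 - N0. \<exists>h. \<omega> t = \<iota> h \<and> Q0 \<omega> \<in> shift_law t ` ?K' h"
    using sel0 by (auto simp: selects_def)
  have "(\<integral>\<omega>. J (unshift_law t (Q \<omega>)) \<partial>P) = (\<integral>\<omega>. J (unshift_law t (Q0 \<omega>)) \<partial>P)"
  proof (rule integral_cong_AE[OF JM[OF Q] JM])
    show "Q0 \<in> coord_sigma 0 {0..t} \<rightarrow>\<^sub>M borel_of (path_law_space t)"
      using Q0 by (simp add: conditional_kernel_def)
    show "AE \<omega> in P. J (unshift_law t (Q \<omega>)) = J (unshift_law t (Q0 \<omega>))"
      using past_null_AE[OF Ppr N(1,2)] past_null_AE[OF Ppr N0(1,2)]
    proof eventually_elim
      fix \<omega> assume \<omega>: "\<omega> \<in> paths 0 - N" "\<omega> \<in> paths 0 - N0"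
      obtain h R where h: "\<omega> t = \<iota> h" "Q \<omega> = shift_law t R" "R \<in> ?K' h" using N(3) \<omega>(1) by blast
      obtain h' R' where h': "\<omega> t = \<iota> h'" "Q0 \<omega> = shift_law t R'" "R' \<in> ?K' h'" using N0(3) \<omega>(2) by blast
      have "h' = h" using h(1) h'(1) left_inverse by metis
      moreover have "R \<in> prob_measures (paths_topology 0)" "R' \<in> prob_measures (paths_topology 0)"
        using h(3) h'(3) laws_in_prob_measures[OF Kmc] by (auto simp: argmax_def)
      moreover have "J R = J R'"
        using h(3) h'(3) \<open>h' = h\<close> by (intro antisym) (auto simp: argmax_def)
      ultimately show "J (unshift_law t (Q \<omega>)) = J (unshift_law t (Q0 \<omega>))"
        using h(2) h'(2) by (simp add: unshift_shift_law)
    qed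
  qed
  then have "J (reconstruction P t Q) = J P" using c by simp
  then show ?thesis using P rec by (simp add: argmax_def)
qed

lemma Markovian_argmax:
  assumes K: "Markovian K" and J: "discount_functional J"
  shows "Markovian (argmax (\<lambda>_. J) K)"
proof -
  let ?K' = "argmax (\<lambda>_. J) K"
  note Kmc = Markovian_correspondence[OF K]
  have sub: "?K' x \<subseteq> K x" for x by (auto simp: argmax_def)
  have Ksub: "K x \<subseteq> \<C> x" for x using K starting_subset unfolding Markovian_def by blast
  have dis: "AE t in lebesgue. 0 < t \<longrightarrow> disintegrates_within ?K' P t"
    if P: "P \<in> ?K' x" for x P
  proof -
    have "P \<in> K x" using P sub by blast
    then have "AE t in lebesgue. 0 < t \<longrightarrow> disintegrates_within K P t"
      "AE t in lebesgue. 0 < t \<longrightarrow> reconstruction_closed K x P t"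
      using K unfolding Markovian_def by blast+
    then show ?thesis
    proof (rule eventually_elim2, intro impI allI)
      fix t Q
      assume 1: "0 < t \<longrightarrow> disintegrates_within K P t"
        and 2: "0 < t \<longrightarrow> reconstruction_closed K x P t"
        and t: "0 < t" and Q: "rcpd P t Q" "selects \<iota> \<C> P t Q"
      show "selects \<iota> ?K' P t Q"
        by (rule argmax_disintegration[OF K J P t Q]) (use 1 2 t Q in blast)+
    qed
  qed
  show ?thesis
    unfolding Markovian_def
  proof (intro conjI allI ballI)
    show "measurable_correspondence (path_law_space 0) borel ?K'"
      by (rule measurable_correspondence_argmax_const[OF Kmc continuous_map_discount_functional[OF J]])
    show "?K' x \<subseteq> starting x" for x
      using sub K unfolding Markovian_def by blast
    fix x P assume P: "P \<in> ?K' x"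
    show "AE t in lebesgue. 0 < t \<longrightarrow> disintegrates_within ?K' P t"
      by (rule dis[OF P])
    have PK: "P \<in> K x" "P \<in> \<C> x" using P sub Ksub by blast+
    have recK: "AE t in lebesgue. 0 < t \<longrightarrow> reconstruction_closed K x P t"
      using K PK(1) unfolding Markovian_def by blast
    show "AE t in lebesgue. 0 < t \<longrightarrow> reconstruction_closed ?K' x P t"
      using dis[OF P] disintegration[OF PK(2)] recK
    proof (eventually_elim, intro impI allI)
      fix t Q
      assume 1: "0 < t \<longrightarrow> disintegrates_within ?K' P t"
        and 2: "0 < t \<longrightarrow> (\<exists>Q. rcpd P t Q \<and> selects \<iota> \<C> P t Q)"
        and 3: "0 < t \<longrightarrow> reconstruction_closed K x P t"
        and t: "0 < t" and Q: "Q \<in> coord_sigma 0 {0..t} \<rightarrow>\<^sub>M borel_of (path_law_space t)"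
        and st: "AE \<omega> in P. starts_at t (\<omega> t) (Q \<omega>)" and sel: "selects \<iota> ?K' P t Q"
      obtain Q0 where Q0: "rcpd P t Q0" "selects \<iota> ?K' P t Q0" using 1 2 t by blast
      have "reconstruction P t Q \<in> K x"
        using 3 t Q st selects_mono[OF sel sub] by blast
      with Q0 show "reconstruction P t Q \<in> ?K' x"
        by (intro argmax_reconstruction[OF K J P t _ Q0(2) Q st sel]) (simp_all add: rcpd_def)
    qed
  qed
qed

end

section \<open>The limit family\<close>

text \<open>Dynkin's lemma for one-dimensional distributions asks for a base closed under
  intersections; \<open>UNIV\<close> is the empty intersection.\<close>

lemma ex_countable_Int_stable_basis:
  fixes \<U> :: "'a::topological_space set set"
  assumes "countable \<U>" "topological_basis \<U>"
  shows "\<exists>\<V> :: 'a set set. countable \<V> \<and> topological_basis \<V> \<and> Int_stable \<V> \<and> UNIV \<in> \<V>"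
proof (intro exI conjI)
  let ?\<V> = "{\<Inter>\<S> | \<S>. finite \<S> \<and> \<S> \<subseteq> \<U>}"
  have "?\<V> = Inter ` {\<S>. finite \<S> \<and> \<S> \<subseteq> \<U>}" by auto
  then show "countable ?\<V>"
    using countable_Collect_finite_subset[OF assms(1)] by simp
  show "topological_basis ?\<V>"
  proof (rule topological_basisI)
    fix V assume "V \<in> ?\<V>"
    then show "open V" using topological_basis_open[OF assms(2)] by (auto intro!: open_Inter)
  next
    fix W and y :: 'a assume "open W" "y \<in> W"
    then obtain U where "U \<in> \<U>" "y \<in> U" "U \<subseteq> W" using topological_basisE[OF assms(2)] by blast
    moreover have "U = \<Inter>{U}" by simp
    ultimately show "\<exists>V\<in>?\<V>. y \<in> V \<and> V \<subseteq> W"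
      by (intro bexI[of _ U] CollectI exI[of _ "{U}"]) auto
  qed
  show "Int_stable ?\<V>"
  proof (rule Int_stableI)
    fix A B assume "A \<in> ?\<V>" "B \<in> ?\<V>"
    then obtain S T where "A = \<Inter>S" "B = \<Inter>T" "finite (S \<union> T)" "S \<union> T \<subseteq> \<U>" by auto
    then show "A \<inter> B \<in> ?\<V>" by (intro CollectI exI[of _ "S \<union> T"]) auto
  qed
  show "UNIV \<in> ?\<V>" by (intro CollectI exI[of _ "{}"]) auto
qed

text \<open>A null set contains no interval, so almost every time still means a dense set of
  times.\<close>

lemma AE_lebesgue_dense:
  assumes "AE t in lebesgue. 0 < t \<longrightarrow> \<Phi> t"
  shows "{0..} \<subseteq> closure {t :: real. 0 < t \<and> \<Phi> t}"
proof
  fix s :: real assume s: "s \<in> {0..}"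
  show "s \<in> closure {t. 0 < t \<and> \<Phi> t}"
    unfolding closure_approachable
  proof (intro allI impI)
    fix e :: real assume e: "0 < e"
    obtain N where N: "N \<in> null_sets lebesgue" "{t. \<not> (0 < t \<longrightarrow> \<Phi> t)} \<subseteq> N"
      using assms unfolding eventually_ae_filter by auto
    then have "negligible N" by (simp add: negligible_iff_null_sets)
    then have "\<not> {s<..<s + e} \<subseteq> N"
      using open_not_negligible[of "{s<..<s + e}"] e negligible_subset[of N "{s<..<s + e}"] by auto
    then obtain t where "t \<in> {s<..<s + e}" "t \<notin> N" by blast
    then have t: "s < t" "t < s + e" "t \<notin> N" by auto
    moreover have "0 < t" using t(1) s by simp
    ultimately have "0 < t \<and> \<Phi> t" using N(2) by blast
    then show "\<exists>y\<in>{t. 0 < t \<and> \<Phi> t}. dist y s < e"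
      using t by (intro bexI[of _ t]) (auto simp: dist_real_def)
  qed
qed

context dense_sequence begin

text \<open>The expectation of a bump at time \<open>r\<close> is a bounded continuous function of
  \<open>r\<close>, and equal transforms at the rates 1, 2, 3, ... make the functions for
  \<open>P\<close> and \<open>R\<close> agree at positive times. Bumps increase to indicators of
  base sets, which determine a law on states.\<close>

lemma marginals_eqI:
  assumes P: "P \<in> prob_measures (paths_topology 0 :: (real \<Rightarrow> 'e) topology)" and R: "R \<in> prob_measures (paths_topology 0)"
    and \<V>: "countable \<V>" "topological_basis \<V>" "Int_stable \<V>" "UNIV \<in> \<V>"
    and eq: "\<And>i k U. U \<in> \<V> \<Longrightarrow> (\<integral>\<omega>. discounted (real (Suc i)) (bump U k) \<omega> \<partial>P) = (\<integral>\<omega>. discounted (real (Suc i)) (bump U k) \<omega> \<partial>R)"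
    and s: "0 < s" and A: "A \<in> sets borel"
  shows "measure P {\<omega> \<in> paths 0. \<omega> s \<in> A} = measure R {\<omega> \<in> paths 0. \<omega> s \<in> A}"
proof -
  interpret P: prob_space P by (rule prob_measuresD) fact
  interpret R: prob_space R by (rule prob_measuresD) fact
  have bump: "(\<integral>\<omega>. bump U k (\<omega> s) \<partial>P) = (\<integral>\<omega>. bump U k (\<omega> s) \<partial>R)" if U: "U \<in> \<V>" for U k
  proof -
    let ?b = "\<lambda>r. (\<integral>\<omega>. bump U k (\<omega> (max 0 r)) \<partial>P) - (\<integral>\<omega>. bump U k (\<omega> (max 0 r)) \<partial>R)"
    have bb: "0 \<le> bump U k y \<and> bump U k y \<le> 1" for y by (simp add: bump_bounds)
    note cP = continuous_on_marginal[OF bb continuous_bump P] and cR = continuous_on_marginal[OF bb continuous_bump R]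
    have int01: "\<bar>\<integral>\<omega>. bump U k (\<omega> (max 0 r)) \<partial>S\<bar> \<le> 1" if "S = P \<or> S = R" for S r
    proof -
      interpret S: prob_space S using that P.prob_space_axioms R.prob_space_axioms by auto
      have Spr: "S \<in> prob_measures (paths_topology 0)" using that P R by auto
      have "bump U k \<in> borel_measurable borel"
        by (intro borel_measurable_continuous_onI continuous_bump)
      from measurable_compose[OF measurable_coord this, of "max 0 r" "{0..max 0 r}" 0]
      have "(\<lambda>\<omega>. bump U k (\<omega> (max 0 r))) \<in> borel_measurable S"
        by (intro past_measurable_law[OF Spr]) auto
      then have "integrable S (\<lambda>\<omega>. bump U k (\<omega> (max 0 r)))"
        using bb by (intro S.integrable_const_bound[where B=1]) (auto simp: abs_le_iff intro: order_trans[of _ 0])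
      then have "(\<integral>\<omega>. bump U k (\<omega> (max 0 r)) \<partial>S) \<le> 1" "0 \<le> (\<integral>\<omega>. bump U k (\<omega> (max 0 r)) \<partial>S)"
        using bb by (auto intro!: S.integral_le_const Bochner_Integration.integral_nonneg)
      then show ?thesis by simp
    qed
    have "?b s = 0"
    proof (rule laplace_unique[OF _ _ _ s])
      show "continuous_on UNIV ?b" by (intro continuous_on_diff cP cR)
      show "\<bar>?b r\<bar> \<le> 2" for r using int01[of P r] int01[of R r] by auto
      fix n
      have "integrable (exp_law (real (Suc n))) (\<lambda>r. \<integral>\<omega>. bump U k (\<omega> (max 0 r)) \<partial>S)" if "S = P \<or> S = R" for S
        using int01[OF that] cP cR that
        by (intro integrable_exp_law(1)[where B=1] borel_measurable_continuous_onI) auto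
      then show "(\<integral>r. ?b r \<partial>exp_law (real (Suc n))) = 0"
        using eq[OF U, of n k] integral_discounted[OF _ bb continuous_bump P, of "real (Suc n)"]
          integral_discounted[OF _ bb continuous_bump R, of "real (Suc n)"]
        by (subst Bochner_Integration.integral_diff) auto
    qed
    then show ?thesis using s by simp
  qed
  have open_\<V>: "open U" if "U \<in> \<V>" for U using topological_basis_open[OF \<V>(2) that] .
  have cyl: "cyl 0 [(s, U)] = {\<omega> \<in> paths 0. \<omega> s \<in> U}" for U :: "'e set" by (auto simp: cyl_def)
  have cb: "cyl_bump k [(s, U)] \<omega> = bump U k (\<omega> s)" for U :: "'e set" and k and \<omega> :: "real \<Rightarrow> 'e" by (simp add: cyl_bump_def)
  have basic: "measure P {\<omega> \<in> paths 0. \<omega> s \<in> U} = measure R {\<omega> \<in> paths 0. \<omega> s \<in> U}" if U: "U \<in> \<V>" for U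
  proof (rule LIMSEQ_unique)
    show "(\<lambda>k. \<integral>\<omega>. bump U k (\<omega> s) \<partial>P) \<longlonglongrightarrow> measure P {\<omega> \<in> paths 0. \<omega> s \<in> U}"
      using measure_cyl_tendsto[OF P, of "[(s, U)]"] open_\<V>[OF U] s by (simp add: cyl cb)
    show "(\<lambda>k. \<integral>\<omega>. bump U k (\<omega> s) \<partial>P) \<longlonglongrightarrow> measure R {\<omega> \<in> paths 0. \<omega> s \<in> U}"
      using measure_cyl_tendsto[OF R, of "[(s, U)]"] open_\<V>[OF U] s by (simp add: cyl cb bump[OF U])
  qed
  have coord: "(\<lambda>\<omega>. \<omega> s) \<in> S \<rightarrow>\<^sub>M borel" if "S \<in> prob_measures (paths_topology 0 :: (real \<Rightarrow> 'e) topology)" for S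
    by (rule past_measurable_law[OF that measurable_coord[of s "{0..s}"]]) (use s in auto)
  have dist: "emeasure (distr S borel (\<lambda>\<omega>. \<omega> s)) X = measure S {\<omega> \<in> paths 0. \<omega> s \<in> X}"
    if S: "S \<in> prob_measures (paths_topology 0 :: (real \<Rightarrow> 'e) topology)" and X: "X \<in> sets borel" for S X
  proof -
    interpret S: prob_space S by (rule prob_measuresD) fact
    have "(\<lambda>\<omega>. \<omega> s) -` X \<inter> space S = {\<omega> \<in> paths 0. \<omega> s \<in> X}" by (auto simp: space_law[OF S])
    then show ?thesis using coord[OF S] X by (simp add: emeasure_distr S.emeasure_eq_measure)
  qed
  have borel: "(borel :: 'e measure) = sigma UNIV \<V>"
    by (rule borel_eq_countable_basis[OF \<V>(1,2)])
  have "distr P borel (\<lambda>\<omega>. \<omega> s) = distr R borel (\<lambda>\<omega>. \<omega> s)"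
  proof (rule measure_eqI_generator_eq[OF \<V>(3), where \<Omega>=UNIV and A="\<lambda>_. UNIV"])
    fix X assume X: "X \<in> \<V>"
    then have "X \<in> sets borel" using open_\<V> by auto
    then show "emeasure (distr P borel (\<lambda>\<omega>. \<omega> s)) X = emeasure (distr R borel (\<lambda>\<omega>. \<omega> s)) X"
      using basic[OF X] dist[OF P] dist[OF R] by simp
  next
    show "sets (distr P borel (\<lambda>\<omega>. \<omega> s)) = sigma_sets UNIV \<V>" "sets (distr R borel (\<lambda>\<omega>. \<omega> s)) = sigma_sets UNIV \<V>"
      by (simp_all add: borel)
    show "emeasure (distr P borel (\<lambda>\<omega>. \<omega> s)) UNIV \<noteq> \<infinity>"
      using dist[OF P, of UNIV] by simp
  qed (use \<V>(4) in auto)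
  then show ?thesis
    using dist[OF P A] dist[OF R A] by simp
qed

end

context pre_Markov_family begin

lemma iter_argmax_Markovian:
  assumes "\<And>n. discount_functional (G n)"
  shows "Markovian (iter_argmax G starting n)"
proof (induction n)
  case 0
  then show ?case by (simp add: Markovian_starting)
next
  case (Suc n)
  then show ?case using Markovian_argmax[OF Suc assms] by simp
qed

text \<open>For one version \<open>Q\<close> the exceptional sets of all stages are united. The
  shift is injective on laws, so the law that shifts to \<open>Q \<omega>\<close> is the same at
  every stage and lies in the intersection.\<close>

lemma limit_disintegration:
  assumes G: "\<And>n. discount_functional (G n)" and P: "P \<in> (\<Inter>n. iter_argmax G starting n x)"
  shows "AE t in lebesgue. 0 < t \<longrightarrow>
    disintegrates_within (\<lambda>x. \<Inter>n. iter_argmax G starting n x) P t"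
proof -
  let ?K = "iter_argmax G starting"
  have M: "Markovian (?K n)" for n by (rule iter_argmax_Markovian[OF G])
  have Ppr: "P \<in> prob_measures (paths_topology 0)"
    using P by (intro laws_in_prob_measures[OF Markovian_correspondence[OF M[of 0]], of _ x]) blast
  have each: "AE t in lebesgue. 0 < t \<longrightarrow> disintegrates_within (?K n) P t" for n
    using M[of n] P unfolding Markovian_def by blast
  have "AE t in lebesgue. \<forall>n. 0 < t \<longrightarrow> disintegrates_within (?K n) P t"
    unfolding AE_all_countable using each by blast
  then show ?thesis
  proof (rule eventually_mono, intro impI allI)
    fix t Q
    assume *: "\<forall>n. 0 < t \<longrightarrow> disintegrates_within (?K n) P t"
      and t: "0 < t" "rcpd P t Q" "selects \<iota> \<C> P t Q"
    then have "\<forall>n. \<exists>N\<in>sets (coord_sigma 0 {0..t}). emeasure P N = 0 \<and>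
        (\<forall>\<omega>\<in>paths 0 - N. \<exists>h. \<omega> t = \<iota> h \<and> Q \<omega> \<in> shift_law t ` ?K n h)"
      unfolding selects_def by blast
    then obtain N where N: "\<And>n. N n \<in> sets (coord_sigma 0 {0..t})" "\<And>n. emeasure P (N n) = 0"
      "\<And>n \<omega>. \<omega> \<in> paths 0 - N n \<Longrightarrow> \<exists>h. \<omega> t = \<iota> h \<and> Q \<omega> \<in> shift_law t ` ?K n h"
      by metis
    show "selects \<iota> (\<lambda>x. \<Inter>n. ?K n x) P t Q"
      unfolding selects_def
    proof (intro bexI[of _ "\<Union>n. N n"] conjI ballI)
      show "(\<Union>n. N n) \<in> sets (coord_sigma 0 {0..t})" using N(1) by auto
      have "N n \<in> null_sets P" for n using N(2) past_sets_law[OF Ppr N(1)] by (simp add: null_sets_def)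
      then have "(\<Union>n. N n) \<in> null_sets P" by auto
      then show "emeasure P (\<Union>n. N n) = 0" by auto
      fix \<omega> assume \<omega>: "\<omega> \<in> paths 0 - (\<Union>n. N n)"
      have in_K: "\<omega> t = \<iota> (\<kappa> (\<omega> t)) \<and> unshift_law t (Q \<omega>) \<in> ?K n (\<kappa> (\<omega> t)) \<and> Q \<omega> = shift_law t (unshift_law t (Q \<omega>))" for n
      proof -
        obtain h R where h: "\<omega> t = \<iota> h" "Q \<omega> = shift_law t R" "R \<in> ?K n h"
          using N(3)[of \<omega> n] \<omega> by blast
        have "unshift_law t (shift_law t R) = R"
          by (rule unshift_shift_law[OF laws_in_prob_measures[OF Markovian_correspondence[OF M] h(3)]])
        then show ?thesis using h by (simp add: left_inverse)
      qed
      show "\<exists>h. \<omega> t = \<iota> h \<and> Q \<omega> \<in> shift_law t ` (\<Inter>n. ?K n h)"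
      proof (intro exI[of _ "\<kappa> (\<omega> t)"] conjI)
        show "\<omega> t = \<iota> (\<kappa> (\<omega> t))" using in_K by blast
        have "unshift_law t (Q \<omega>) \<in> (\<Inter>n. ?K n (\<kappa> (\<omega> t)))" using in_K by blast
        then show "Q \<omega> \<in> shift_law t ` (\<Inter>n. ?K n (\<kappa> (\<omega> t)))" using in_K by blast
      qed
    qed
  qed
qed

text \<open>The finite-dimensional distributions are computed by conditioning at the last but one time;
  as the one-dimensional ones are functions of the state, so are all of them.\<close>

lemma law_eq_of_marginals:
  fixes K :: "'h \<Rightarrow> (real \<Rightarrow> 'e) measure set"
  assumes K: "measurable_correspondence (path_law_space 0) borel K"
    and marg: "\<And>x P R s A. P \<in> K x \<Longrightarrow> R \<in> K x \<Longrightarrow> 0 < s \<Longrightarrow> A \<in> sets borel \<Longrightarrow>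
      measure P {\<omega> \<in> paths 0. \<omega> s \<in> A} = measure R {\<omega> \<in> paths 0. \<omega> s \<in> A}"
    and dis: "\<And>x P. P \<in> K x \<Longrightarrow> AE t in lebesgue. 0 < t \<longrightarrow> (\<exists>Q. conditional_kernel P t Q \<and> selects \<iota> K P t Q)"
    and P1: "P1 \<in> K x" and P2: "P2 \<in> K x"
  shows "P1 = P2"
proof -
  obtain S where S: "S \<in> borel \<rightarrow>\<^sub>M borel_of (path_law_space 0 :: (real \<Rightarrow> 'e) measure topology)" "\<And>y. S y \<in> K y"
    using measurable_selection_law[OF K] by blast
  have Kpr: "P \<in> prob_measures (paths_topology 0)" if "P \<in> K y" for P y
    by (rule laws_in_prob_measures[OF K that])
  \<comment> \<open>Times at which both laws disintegrate within \<open>K\<close>; they are dense,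
    and only cylinders over them are compared.\<close>
  define I where "I = {t. 0 < t \<and> (\<exists>Q. conditional_kernel P1 t Q \<and> selects \<iota> K P1 t Q) \<and>
    (\<exists>Q. conditional_kernel P2 t Q \<and> selects \<iota> K P2 t Q)}"
  have "AE t in lebesgue. 0 < t \<longrightarrow> (\<exists>Q. conditional_kernel P1 t Q \<and> selects \<iota> K P1 t Q) \<and>
    (\<exists>Q. conditional_kernel P2 t Q \<and> selects \<iota> K P2 t Q)"
    using dis[OF P1] dis[OF P2] by eventually_elim blast
  from AE_lebesgue_dense[OF this] have I: "I \<subseteq> {0..}" "{0..} \<subseteq> closure I"
    unfolding I_def by auto
  \<comment> \<open>The probability of being in \<open>B\<close> after a further time
    \<open>r\<close> from the state \<open>y\<close>. The selection \<open>S\<close> serves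
    measurability in \<open>y\<close>; by \<open>marg\<close>, for \<open>r > 0\<close> every law in
    \<open>K\<close> at that state gives the same value.\<close>
  define \<phi> where "\<phi> r B y = measure (S (\<kappa> y)) {\<omega> \<in> paths 0. \<omega> r \<in> B}" for r B and y :: 'e
  have \<phi>: "\<phi> r B \<in> borel_measurable borel" if "0 \<le> r" "B \<in> sets borel" for r B
  proof -
    have "(\<lambda>\<omega>. \<omega> r) -` B \<inter> space (coord_sigma 0 {0..}) \<in> sets (coord_sigma 0 {0..})"
      using that by (intro measurable_sets[OF measurable_coord]) auto
    also have "(\<lambda>\<omega>. \<omega> r) -` B \<inter> space (coord_sigma 0 {0..}) = {\<omega> \<in> paths 0. \<omega> r \<in> B}" by auto
    finally have "{\<omega> \<in> paths 0. \<omega> r \<in> B} \<in> sets (coord_sigma 0 {0..})" .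
    from measurable_measure_subprob_algebra[OF this]
    show ?thesis
      unfolding \<phi>_def
      by (rule measurable_compose[OF measurable_compose[OF measurable_compose[OF inverse_measurable S(1)] measurable_law_subprob]])
  qed
  \<comment> \<open>Conditioning at \<open>s\<close> replaces the constraint at the later time
    \<open>t\<close> by a function of the state at \<open>s\<close> that does not depend on
    \<open>P\<close>.\<close>
  have step: "measure P (\<Gamma> \<inter> {\<omega> \<in> paths 0. \<omega> t \<in> B}) = (\<integral>\<omega>\<in>\<Gamma>. \<phi> (t - s) B (\<omega> s) \<partial>P)"
    if P: "P \<in> K x" and Q: "conditional_kernel P s Q" and sel: "selects \<iota> K P s Q" and s: "0 < s" "s < t"
      and \<Gamma>: "\<Gamma> \<in> sets (coord_sigma 0 {0..s})" and B: "B \<in> sets borel" for P Q s t \<Gamma> B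
  proof -
    have Qm: "Q \<in> coord_sigma 0 {0..s} \<rightarrow>\<^sub>M borel_of (path_law_space s)"
      using Q by (simp add: conditional_kernel_def)
    have "(\<lambda>\<omega>. \<omega> t) -` B \<inter> space (coord_sigma s {s..}) \<in> sets (coord_sigma s {s..})"
      using s B by (intro measurable_sets[OF measurable_coord]) auto
    also have "(\<lambda>\<omega>. \<omega> t) -` B \<inter> space (coord_sigma s {s..}) = {\<eta> \<in> paths s. \<eta> t \<in> B}" by auto
    finally have Bs: "{\<eta> \<in> paths s. \<eta> t \<in> B} \<in> sets (coord_sigma s {s..})" .
    have sub: "\<Gamma> \<subseteq> paths 0" using sets.sets_into_space[OF \<Gamma>] by simp
    have fut: "restrict \<omega> {s..} \<in> paths s" if "\<omega> \<in> paths 0" for \<omega> :: "real \<Rightarrow> 'e"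
      using reparam_in_paths[OF time_change_future that, of s] s(1) by (simp add: restrict_eq_future_path)
    have "\<Gamma> \<inter> {\<omega> \<in> paths 0. \<omega> t \<in> B} = {\<omega> \<in> \<Gamma>. restrict \<omega> {s..} \<in> {\<eta> \<in> paths s. \<eta> t \<in> B}}"
      using sub fut s by auto
    moreover have "measure P {\<omega> \<in> \<Gamma>. restrict \<omega> {s..} \<in> {\<eta> \<in> paths s. \<eta> t \<in> B}} =
        (\<integral>\<omega>\<in>\<Gamma>. measure (Q \<omega>) {\<eta> \<in> paths s. \<eta> t \<in> B} \<partial>P)"
      using Q \<Gamma> Bs unfolding conditional_kernel_def by blast
    ultimately have "measure P (\<Gamma> \<inter> {\<omega> \<in> paths 0. \<omega> t \<in> B}) = (\<integral>\<omega>\<in>\<Gamma>. measure (Q \<omega>) {\<eta> \<in> paths s. \<eta> t \<in> B} \<partial>P)"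
      by (simp only:)
    also have "\<dots> = (\<integral>\<omega>\<in>\<Gamma>. \<phi> (t - s) B (\<omega> s) \<partial>P)"
      unfolding set_lebesgue_integral_def
    proof (rule integral_cong_AE)
      show "(\<lambda>\<omega>. indicator \<Gamma> \<omega> *\<^sub>R measure (Q \<omega>) {\<eta> \<in> paths s. \<eta> t \<in> B}) \<in> borel_measurable P"
        using measurable_kernel_measure[OF Qm Bs] \<Gamma>
        by (intro past_measurable_law[OF Kpr[OF P]] borel_measurable_scaleR borel_measurable_indicator)
      show "(\<lambda>\<omega>. indicator \<Gamma> \<omega> *\<^sub>R \<phi> (t - s) B (\<omega> s)) \<in> borel_measurable P"
        using \<Gamma> s B
        by (intro past_measurable_law[OF Kpr[OF P]] borel_measurable_scaleR borel_measurable_indicator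
            measurable_compose[OF measurable_coord \<phi>]) auto
      obtain N where N: "N \<in> sets (coord_sigma 0 {0..s})" "emeasure P N = 0"
        "\<forall>\<omega>\<in>paths 0 - N. \<exists>h. \<omega> s = \<iota> h \<and> Q \<omega> \<in> shift_law s ` K h"
        using sel by (auto simp: selects_def)
      show "AE \<omega> in P. indicator \<Gamma> \<omega> *\<^sub>R measure (Q \<omega>) {\<eta> \<in> paths s. \<eta> t \<in> B} = indicator \<Gamma> \<omega> *\<^sub>R \<phi> (t - s) B (\<omega> s)"
        using past_null_AE[OF Kpr[OF P] N(1,2)]
      proof eventually_elim
        fix \<omega> assume "\<omega> \<in> paths 0 - N"
        then obtain h R where h: "\<omega> s = \<iota> h" "Q \<omega> = shift_law s R" "R \<in> K h" using N(3) by blast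
        note Rpr = Kpr[OF h(3)]
        have sh: "shift_path s \<in> R \<rightarrow>\<^sub>M borel_of (paths_topology s)"
          using measurable_shift_path prob_measuresD(2)[OF Rpr] by (simp cong: measurable_cong_sets)
        have "measure (Q \<omega>) {\<eta> \<in> paths s. \<eta> t \<in> B} = measure R (shift_path s -` {\<eta> \<in> paths s. \<eta> t \<in> B} \<inter> space R)"
          unfolding h(2) shift_law_def using Bs by (intro measure_distr[OF sh]) (simp add: sets_borel_of_paths)
        also have "shift_path s -` {\<eta> \<in> paths s. \<eta> t \<in> B} \<inter> space R = {\<omega> \<in> paths 0. \<omega> (t - s) \<in> B}"
          using reparam_in_paths[OF time_change_shift, of _ s] s
          by (auto simp: space_law[OF Rpr] shift_path_eq) (auto simp: reparam_def)
        also have "measure R \<dots> = \<phi> (t - s) B (\<omega> s)"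
          unfolding \<phi>_def h(1) left_inverse using s B by (intro marg[OF h(3) S(2)]) auto
        finally show "indicator \<Gamma> \<omega> *\<^sub>R measure (Q \<omega>) {\<eta> \<in> paths s. \<eta> t \<in> B} = indicator \<Gamma> \<omega> *\<^sub>R \<phi> (t - s) B (\<omega> s)"
          by simp
      qed
    qed
    finally show ?thesis .
  qed
  \<comment> \<open>Latest time at the head, so that the head of the list is the constraint to be
    integrated out.\<close>
  have fdd: "measure P1 (cyl 0 l) = measure P2 (cyl 0 l)"
    if "sorted_wrt (\<lambda>u v. fst v < fst u) l" "set l \<subseteq> I \<times> sets borel" for l :: "(real \<times> 'e set) list"
    using that
  proof (induction l rule: length_induct)
    case (1 l)
    note P1pr = Kpr[OF P1] and P2pr = Kpr[OF P2]
    interpret P1: prob_space P1 by (rule prob_measuresD(1)[OF P1pr])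
    interpret P2: prob_space P2 by (rule prob_measuresD(1)[OF P2pr])
    show ?case
    proof (cases l)
      case Nil
      then have "cyl 0 l = space P1" "cyl 0 l = space P2"
        by (auto simp: cyl_def space_law[OF P1pr] space_law[OF P2pr])
      then show ?thesis using P1.prob_space P2.prob_space by simp
    next
      case (Cons u l1)
      obtain t B where u: "u = (t, B)" by fastforce
      have t: "0 < t" "B \<in> sets borel" using 1(3) Cons u by (auto simp: I_def)
      show ?thesis
      proof (cases l1)
        case Nil
        then have "cyl 0 l = {\<omega> \<in> paths 0. \<omega> t \<in> B}" using Cons u by (auto simp: cyl_def)
        then show ?thesis using marg[OF P1 P2 t] by simp
      next
        case (Cons v l2)
        obtain s A where v: "v = (s, A)" by fastforce
        have l: "l = (t, B) # (s, A) # l2" using Cons v u \<open>l = u # l1\<close> by simp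
        have s: "s \<in> I" "0 < s" "s < t" "A \<in> sets borel" using 1(2,3) by (auto simp: l I_def)
        define \<Gamma> where "\<Gamma> = cyl 0 ((s, A) # l2)"
        have \<Gamma>: "\<Gamma> \<in> sets (coord_sigma 0 {0..s})"
          unfolding \<Gamma>_def using 1(2,3) s by (intro cyl_sets) (fastforce simp: l I_def)
        have cyl_l: "cyl 0 l = \<Gamma> \<inter> {\<omega> \<in> paths 0. \<omega> t \<in> B}" by (auto simp: \<Gamma>_def l cyl_def)
        have ms: "(\<lambda>\<omega>. \<omega> s) \<in> density P (indicator \<Gamma>) \<rightarrow>\<^sub>M borel" if "P \<in> prob_measures (paths_topology 0)" for P
          using past_measurable_law[OF that measurable_coord[of s "{0..s}" 0]] s by simp
        have mass: "emeasure (distr (density P (indicator \<Gamma>)) borel (\<lambda>\<omega>. \<omega> s)) X = measure P (cyl 0 ((s, A \<inter> X) # l2))"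
          if P: "P \<in> prob_measures (paths_topology 0)" and X: "X \<in> sets borel" for P X
        proof -
          interpret prob_space P by (rule prob_measuresD(1)[OF P])
          have "(\<lambda>\<omega>. \<omega> s) -` X \<inter> space P \<in> sets P"
            using measurable_sets[OF ms[OF P] X] by simp
          then have "emeasure (distr (density P (indicator \<Gamma>)) borel (\<lambda>\<omega>. \<omega> s)) X = emeasure P (\<Gamma> \<inter> ((\<lambda>\<omega>. \<omega> s) -` X \<inter> space P))"
            using emeasure_distr[OF ms[OF P] X] past_sets_law[OF P \<Gamma>] by (simp add: emeasure_restricted)
          also have "\<Gamma> \<inter> ((\<lambda>\<omega>. \<omega> s) -` X \<inter> space P) = cyl 0 ((s, A \<inter> X) # l2)"
            by (auto simp: \<Gamma>_def cyl_def space_law[OF P])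
          finally show ?thesis by (simp add: emeasure_eq_measure)
        qed
        \<comment> \<open>Sharpening the constraint at \<open>s\<close> by an arbitrary Borel set
          \<open>X\<close> still leaves a list shorter than \<open>l\<close>. The induction
          hypothesis therefore identifies the whole distribution of the state at \<open>s\<close> on
          \<open>\<Gamma>\<close>, beyond the mass of \<open>\<Gamma>\<close>.\<close>
        have "distr (density P1 (indicator \<Gamma>)) borel (\<lambda>\<omega>. \<omega> s) = distr (density P2 (indicator \<Gamma>)) borel (\<lambda>\<omega>. \<omega> s)"
        proof (rule measure_eqI)
          fix X assume "X \<in> sets (distr (density P1 (indicator \<Gamma>)) borel (\<lambda>\<omega>. \<omega> s))"
          then have X: "X \<in> sets borel" by simp
          have "measure P1 (cyl 0 ((s, A \<inter> X) # l2)) = measure P2 (cyl 0 ((s, A \<inter> X) # l2))"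
            using 1(1)[rule_format, of "(s, A \<inter> X) # l2"] 1(2,3) s X by (auto simp: l)
          then show "emeasure (distr (density P1 (indicator \<Gamma>)) borel (\<lambda>\<omega>. \<omega> s)) X =
              emeasure (distr (density P2 (indicator \<Gamma>)) borel (\<lambda>\<omega>. \<omega> s)) X"
            using mass[OF P1pr X] mass[OF P2pr X] by simp
        qed simp
        then have eq: "(\<integral>y. \<phi> (t - s) B y \<partial>distr (density P1 (indicator \<Gamma>)) borel (\<lambda>\<omega>. \<omega> s)) =
            (\<integral>y. \<phi> (t - s) B y \<partial>distr (density P2 (indicator \<Gamma>)) borel (\<lambda>\<omega>. \<omega> s))" by simp
        have \<phi>m: "\<phi> (t - s) B \<in> borel_measurable borel" using s t by (intro \<phi>) auto
        have int: "(\<integral>y. \<phi> (t - s) B y \<partial>distr (density P (indicator \<Gamma>)) borel (\<lambda>\<omega>. \<omega> s)) = (\<integral>\<omega>\<in>\<Gamma>. \<phi> (t - s) B (\<omega> s) \<partial>P)"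
          if P: "P \<in> prob_measures (paths_topology 0)" for P
        proof -
          have m: "(\<lambda>\<omega>. \<phi> (t - s) B (\<omega> s)) \<in> borel_measurable P"
            using measurable_compose[OF ms[OF P] \<phi>m] by simp
          have "(\<integral>y. \<phi> (t - s) B y \<partial>distr (density P (indicator \<Gamma>)) borel (\<lambda>\<omega>. \<omega> s)) =
              (\<integral>\<omega>. \<phi> (t - s) B (\<omega> s) \<partial>density P (indicator \<Gamma>))"
            by (rule integral_distr[OF ms[OF P] \<phi>m])
          also have "\<dots> = (\<integral>\<omega>. \<phi> (t - s) B (\<omega> s) \<partial>density P (\<lambda>\<omega>. ennreal (indicator \<Gamma> \<omega>)))"
            by (simp add: ennreal_indicator)
          also have "\<dots> = (\<integral>\<omega>\<in>\<Gamma>. \<phi> (t - s) B (\<omega> s) \<partial>P)"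
            unfolding set_lebesgue_integral_def using past_sets_law[OF P \<Gamma>]
            by (intro integral_density m) auto
          finally show ?thesis .
        qed
        from s(1) obtain Q1 Q2 where Q: "conditional_kernel P1 s Q1" "selects \<iota> K P1 s Q1"
          "conditional_kernel P2 s Q2" "selects \<iota> K P2 s Q2" by (auto simp: I_def)
        show ?thesis
          unfolding cyl_l using step[OF P1 Q(1,2) s(2,3) \<Gamma> t(2)] step[OF P2 Q(3,4) s(2,3) \<Gamma> t(2)]
            eq int[OF P1pr] int[OF P2pr] by simp
      qed
    qed
  qed
  show ?thesis
  proof (rule laws_eqI[OF Kpr[OF P1] Kpr[OF P2] I])
    show "borel = sigma UNIV {U :: 'e set. open U}" by (simp add: borel_def)
    fix l :: "(real \<times> 'e set) list" assume l: "set l \<subseteq> I \<times> {U. open U}"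
    \<comment> \<open>\<open>l\<close> may repeat times and be unordered: constraints at the same
      time are merged by intersection and the times sorted downwards.\<close>
    let ?A = "\<lambda>s. \<Inter>{U. (s, U) \<in> set l}"
    define l' where "l' = map (\<lambda>s. (s, ?A s)) (rev (sorted_list_of_set (fst ` set l)))"
    have "cyl 0 l = cyl 0 l'"
      by (force simp: cyl_def l'_def)
    moreover have "sorted_wrt (\<lambda>u v. fst v < fst u) l'"
      unfolding l'_def sorted_wrt_map sorted_wrt_rev by simp
    moreover have "set l' \<subseteq> I \<times> sets borel"
    proof -
      have "?A s \<in> sets borel" for s
      proof (intro borel_open open_Inter)
        have "{U. (s, U) \<in> set l} \<subseteq> snd ` set l" by force
        then show "finite {U. (s, U) \<in> set l}" by (rule finite_subset) simp
      qed (use l in auto)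
      then show ?thesis using l by (auto simp: l'_def)
    qed
    ultimately show "measure P1 (cyl 0 l) = measure P2 (cyl 0 l)"
      using fdd by simp
  qed
qed

lemma Markov_selection:
  "\<exists>S. S \<in> borel \<rightarrow>\<^sub>M borel_of (path_law_space 0) \<and> (\<forall>x. S x \<in> \<C> x) \<and>
    (\<forall>x. AE t in lebesgue. 0 < t \<longrightarrow>
      (\<exists>Q. rcpd (S x) t Q \<and> (AE \<omega> in S x. \<exists>h. \<omega> t = \<iota> h \<and> Q \<omega> = shift_law t (S h))))"
proof -
  obtain \<U> :: "'e set set" where "countable \<U>" "topological_basis \<U>"
    using ex_countable_basis_of_dense by blast
  then obtain \<V> :: "'e set set" where \<V>: "countable \<V>" "topological_basis \<V>" "Int_stable \<V>" "UNIV \<in> \<V>"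
    using ex_countable_Int_stable_basis by blast
  have \<V>ne: "\<V> \<noteq> {}" using \<V>(4) by auto
  define J where "J i k j P = (\<integral>\<omega>. discounted (real (Suc i)) (bump (from_nat_into \<V> j) k) \<omega> \<partial>P)"
    for i k j and P :: "(real \<Rightarrow> 'e) measure"
  \<comment> \<open>Rates, degrees of smoothing and base sets are enumerated together by decoding a
    natural number twice.\<close>
  define G where "G n = (case prod_decode n of (i, m) \<Rightarrow> case prod_decode m of (k, j) \<Rightarrow> J i k j)" for n
  have Jd: "discount_functional (J i k j)" for i k j
  proof -
    \<comment> \<open>\<open>k + 1\<close> in place of \<open>k\<close> keeps the Lipschitz constant
      positive for \<open>k = 0\<close>.\<close>
    have "\<bar>bump U k x - bump U k y\<bar> \<le> (real k + 1) * dist x y" for U and x y :: 'e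
    proof -
      have "real k * dist x y \<le> (real k + 1) * dist x y" by (intro mult_right_mono) auto
      then show ?thesis using bump_lipschitz[of U k x y] by linarith
    qed
    then show ?thesis
      unfolding discount_functional_def J_def[abs_def]
      by (intro exI[of _ "real (Suc i)"] exI[of _ "bump (from_nat_into \<V> j) k"] exI[of _ "real k + 1"])
        (auto simp: bump_bounds)
  qed
  then have Gd: "discount_functional (G n)" for n
    by (simp add: G_def split: prod.split)
  let ?K = "\<lambda>x. \<Inter>n. iter_argmax G starting n x"
  have Kmc: "measurable_correspondence (path_law_space 0) borel ?K"
    by (rule measurable_correspondence_iter_argmax_Inter[OF Hausdorff correspondence_starting
          continuous_map_discount_functional[OF Gd]])
  have Ksub: "?K x \<subseteq> \<C> x" for x
  proof -
    have "?K x \<subseteq> iter_argmax G starting 0 x" by blast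
    then show ?thesis using starting_subset[of x] by simp
  qed
  have marg: "measure P {\<omega> \<in> paths 0. \<omega> s \<in> A} = measure R {\<omega> \<in> paths 0. \<omega> s \<in> A}"
    if PR: "P \<in> ?K x" "R \<in> ?K x" and s: "0 < s" "A \<in> sets borel" for x P R s A
  proof (rule marginals_eqI[OF laws_in_prob_measures[of ?K, OF Kmc PR(1)] laws_in_prob_measures[of ?K, OF Kmc PR(2)] \<V> _ s])
    fix i k U assume "U \<in> \<V>"
    then obtain j where j: "from_nat_into \<V> j = U" using from_nat_into_surj[OF \<V>(1)] by blast
    have "G (prod_encode (i, prod_encode (k, j))) P = G (prod_encode (i, prod_encode (k, j))) R"
      by (rule iter_argmax_Inter_eq[OF PR])
    then show "(\<integral>\<omega>. discounted (real (Suc i)) (bump U k) \<omega> \<partial>P) = (\<integral>\<omega>. discounted (real (Suc i)) (bump U k) \<omega> \<partial>R)"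
      by (simp add: G_def J_def j)
  qed
  have dis: "AE t in lebesgue. 0 < t \<longrightarrow> (\<exists>Q. rcpd P t Q \<and> selects \<iota> ?K P t Q)" if P: "P \<in> ?K x" for x P
  proof -
    have "P \<in> \<C> x" using P Ksub by blast
    from disintegration[OF this] limit_disintegration[OF Gd P] show ?thesis
      by eventually_elim blast
  qed
  have single: "P = R" if "P \<in> ?K x" "R \<in> ?K x" for x P R
  proof (rule law_eq_of_marginals[OF Kmc marg _ that])
    show "AE t in lebesgue. 0 < t \<longrightarrow> (\<exists>Q. conditional_kernel P t Q \<and> selects \<iota> ?K P t Q)" if "P \<in> ?K x" for x P
      using dis[OF that] by eventually_elim (auto simp: rcpd_def)
  qed
  have ne: "?K x \<noteq> {}" for x
  proof -
    have "x \<in> space borel" by simp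
    with Kmc have "?K x \<in> compacts (path_law_space 0)"
      unfolding measurable_correspondence_def by blast
    then show ?thesis unfolding compacts_def by blast
  qed
  have "\<exists>P. ?K x = {P}" for x
  proof -
    obtain P where P: "P \<in> ?K x" using ne[of x] by (rule ex_in_conv[THEN iffD2, THEN exE])
    have "?K x = {P}"
    proof (rule equalityI)
      show "?K x \<subseteq> {P}" by (rule subsetI, drule single[OF P]) (simp only: singleton_iff)
      show "{P} \<subseteq> ?K x" using P by (simp only: insert_subset empty_subsetI)
    qed
    then show ?thesis by (rule exI)
  qed
  then obtain S where S: "\<And>x. ?K x = {S x}" by metis
  have SK: "S x \<in> ?K x" for x using S by blast
  show ?thesis
  proof (intro exI[of _ S] conjI allI)
    show "S \<in> borel \<rightarrow>\<^sub>M borel_of (path_law_space 0)"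
      by (rule measurable_of_singleton_correspondence[OF Kmc S])
    show "S x \<in> \<C> x" for x using SK Ksub by blast
    show "AE t in lebesgue. 0 < t \<longrightarrow>
      (\<exists>Q. rcpd (S x) t Q \<and> (AE \<omega> in S x. \<exists>h. \<omega> t = \<iota> h \<and> Q \<omega> = shift_law t (S h)))" for x
      using dis[OF SK]
    proof (rule eventually_mono, intro impI)
      fix t :: real assume "0 < t \<longrightarrow> (\<exists>Q. rcpd (S x) t Q \<and> selects \<iota> ?K (S x) t Q)" "0 < t"
      then obtain Q N where Q: "rcpd (S x) t Q" and N: "N \<in> sets (coord_sigma 0 {0..t})" "emeasure (S x) N = 0"
        "\<forall>\<omega>\<in>paths 0 - N. \<exists>h. \<omega> t = \<iota> h \<and> Q \<omega> \<in> shift_law t ` ?K h"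
        unfolding selects_def by blast
      \<comment> \<open>The limit family has singleton values, so selecting from it at
        \<open>h\<close> means being the shift of \<open>S h\<close>.\<close>
      have "AE \<omega> in S x. \<exists>h. \<omega> t = \<iota> h \<and> Q \<omega> = shift_law t (S h)"
        using past_null_AE[OF laws_in_prob_measures[of ?K, OF Kmc SK] N(1,2)]
      proof eventually_elim
        fix \<omega> assume "\<omega> \<in> paths 0 - N"
        then obtain h where "\<omega> t = \<iota> h" "Q \<omega> \<in> shift_law t ` ?K h" using N(3) by blast
        then show "\<exists>h. \<omega> t = \<iota> h \<and> Q \<omega> = shift_law t (S h)"
          unfolding S by blast
      qed
      with Q show "\<exists>Q. rcpd (S x) t Q \<and> (AE \<omega> in S x. \<exists>h. \<omega> t = \<iota> h \<and> Q \<omega> = shift_law t (S h))" by blast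
    qed
  qed
qed

end

section \<open>Application to the Gelfand triple\<close>

theorem theorem2p8:
  fixes j :: "'v::{real_inner, polish_space} \<Rightarrow>\<^sub>L 'h::{real_inner, polish_space}"
    and d :: "(real \<Rightarrow> 'v \<Rightarrow>\<^sub>L real) measure \<Rightarrow> (real \<Rightarrow> 'v \<Rightarrow>\<^sub>L real) measure \<Rightarrow> real"
    and \<C> :: "'h \<Rightarrow> (real \<Rightarrow> 'v \<Rightarrow>\<^sub>L real) measure set"
  assumes "gelfand_triple j"
    and "metrizes d (path_law_space 0)"
    and "almost_surely_pre_Markov (gelfand_embedding j) d \<C>"
    and "\<And>x. \<C> x \<noteq> {}"
    and "\<And>x. convex_measures (\<C> x)"
  shows "\<exists>P. P \<in> borel \<rightarrow>\<^sub>M borel_of (path_law_space 0) \<and> (\<forall>x. P x \<in> \<C> x) \<and>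
           almost_sure_Markov (gelfand_embedding j) P"
proof -
  let ?\<iota> = "gelfand_embedding j"
  \<comment> \<open>The inverse of the embedding, continued by the constant 0 off the image of H; as
    that image is Borel, so is the continued map.\<close>
  define \<kappa> where "\<kappa> y = (if y \<in> range ?\<iota> then inv ?\<iota> y else 0)" for y
  have inj: "inj ?\<iota>" by (rule inj_gelfand_embedding) fact
  obtain a :: "nat \<Rightarrow> 'v \<Rightarrow>\<^sub>L real" where a: "\<And>y e. 0 < e \<Longrightarrow> \<exists>k. dist y (a k) < e"
    using separable_dual by blast
  have pM: "\<C> \<in> borel \<rightarrow>\<^sub>M borel_of (hausdorff_topology (path_law_space 0) d)"
    "\<And>x P. P \<in> \<C> x \<Longrightarrow> measure P (weakly_continuous_paths ?\<iota>) = 1"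
    "\<And>x P. P \<in> \<C> x \<Longrightarrow> \<exists>T \<in> null_sets lebesgue. T \<subseteq> {0<..} \<and> (\<forall>t\<in>{0<..} - T.
        (\<exists>Q. rcpd P t Q \<and> selects ?\<iota> \<C> P t Q) \<and>
        (\<forall>Q. Q \<in> coord_sigma 0 {0..t} \<rightarrow>\<^sub>M borel_of (path_law_space t) \<longrightarrow>
             (AE \<omega> in P. starts_at t (\<omega> t) (Q \<omega>)) \<longrightarrow>
             selects ?\<iota> \<C> P t Q \<longrightarrow>
             reconstruction P t Q \<in> \<C> x))"
    using assms(3) unfolding almost_surely_pre_Markov_def by blast+
  interpret pre_Markov_family a ?\<iota> \<kappa> \<C>
  proof
    show "\<exists>k. dist y (a k) < e" if "0 < e" for y e using a[OF that] .
    show "\<kappa> (?\<iota> x) = x" for x by (simp add: \<kappa>_def inv_f_f[OF inj])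
    show "?\<iota> \<in> borel_measurable borel"
      by (rule borel_measurable_continuous_onI[OF continuous_gelfand_embedding])
    show "\<kappa> \<in> borel_measurable borel"
    proof (rule borel_measurableI)
      fix U :: "'h set" assume U: "open U"
      \<comment> \<open>Preimages split along the image of the embedding: on it they are images of
        open sets of H, off it everything or nothing according to whether 0 lies in
        \<open>U\<close>.\<close>
      have "\<kappa> -` U \<inter> space borel = ?\<iota> ` U \<union> (if 0 \<in> U then - range ?\<iota> else {})"
      proof (rule set_eqI)
        fix y
        show "y \<in> \<kappa> -` U \<inter> space borel \<longleftrightarrow> y \<in> ?\<iota> ` U \<union> (if 0 \<in> U then - range ?\<iota> else {})"
          by (cases "y \<in> range ?\<iota>") (auto simp: \<kappa>_def inv_f_f[OF inj] inj_image_mem_iff[OF inj])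
      qed
      also have "\<dots> \<in> sets borel"
        using gelfand_embedding_open_borel[OF U] gelfand_embedding_open_borel[OF open_UNIV, of j] by auto
      finally show "\<kappa> -` U \<inter> space borel \<in> sets borel" .
    qed
    show "Hausdorff_space (path_law_space 0 :: (real \<Rightarrow> 'v \<Rightarrow>\<^sub>L real) measure topology)"
      by (rule metrizes_imp_Hausdorff_space[OF assms(2)])
    show "measurable_correspondence (path_law_space 0) borel \<C>"
      by (rule measurable_correspondence_of_hausdorff[OF assms(2) pM(1)])
    fix x P assume P: "P \<in> \<C> x"
    obtain T where T: "T \<in> null_sets lebesgue"
      "\<And>t. t \<in> {0<..} - T \<Longrightarrow> \<exists>Q. rcpd P t Q \<and> selects ?\<iota> \<C> P t Q"
      "\<And>t. t \<in> {0<..} - T \<Longrightarrow> \<forall>Q. Q \<in> coord_sigma 0 {0..t} \<rightarrow>\<^sub>M borel_of (path_law_space t) \<longrightarrow>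
             (AE \<omega> in P. starts_at t (\<omega> t) (Q \<omega>)) \<longrightarrow> selects ?\<iota> \<C> P t Q \<longrightarrow> reconstruction P t Q \<in> \<C> x"
      using pM(3)[OF P] by blast
    have AE_T: "AE t in lebesgue. t \<notin> T" by (rule AE_not_in[OF T(1)])
    then show "AE t in lebesgue. 0 < t \<longrightarrow> (\<exists>Q. rcpd P t Q \<and> selects ?\<iota> \<C> P t Q)"
      by eventually_elim (use T(2) in auto)
    from AE_T show "AE t in lebesgue. 0 < t \<longrightarrow> (\<forall>Q. Q \<in> coord_sigma 0 {0..t} \<rightarrow>\<^sub>M borel_of (path_law_space t) \<longrightarrow>
             (AE \<omega> in P. starts_at t (\<omega> t) (Q \<omega>)) \<longrightarrow> selects ?\<iota> \<C> P t Q \<longrightarrow> reconstruction P t Q \<in> \<C> x)"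
      by (rule eventually_mono) (use T(3) in blast)
  qed
  obtain S where S: "S \<in> borel \<rightarrow>\<^sub>M borel_of (path_law_space 0)" "\<And>x. S x \<in> \<C> x"
    "\<And>x. AE t in lebesgue. 0 < t \<longrightarrow>
      (\<exists>Q. rcpd (S x) t Q \<and> (AE \<omega> in S x. \<exists>h. \<omega> t = ?\<iota> h \<and> Q \<omega> = shift_law t (S h)))"
    using Markov_selection by blast
  have "\<exists>T \<in> null_sets lebesgue. T \<subseteq> {0<..} \<and> (\<forall>t\<in>{0<..} - T.
        \<exists>Q. rcpd (S x) t Q \<and> (AE \<omega> in S x. \<exists>h. \<omega> t = ?\<iota> h \<and> Q \<omega> = shift_law t (S h)))" for x
  proof -
    obtain N where N: "N \<in> null_sets lebesgue" "{t \<in> space lebesgue. \<not> (0 < t \<longrightarrow>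
      (\<exists>Q. rcpd (S x) t Q \<and> (AE \<omega> in S x. \<exists>h. \<omega> t = ?\<iota> h \<and> Q \<omega> = shift_law t (S h))))} \<subseteq> N"
      using S(3)[of x] unfolding eventually_ae_filter by blast
    \<comment> \<open>The excluded times are to lie in the open half line, whereas the null set
      behind an almost everywhere statement may contain any reals.\<close>
    have "N \<inter> {0<..} \<in> null_sets lebesgue"
      using N(1) by (intro null_set_Int2) auto
    then show ?thesis
      using N(2) by (intro bexI[of _ "N \<inter> {0<..}"]) auto
  qed
  then have "almost_sure_Markov ?\<iota> S"
    unfolding almost_sure_Markov_def using S(1,2) pM(2) by blast
  with S(1,2) show ?thesis by blast
qed

end
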